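(* Let $(\Omega_1,\mu_1),\ldots,(\Omega_n,\mu_n)$ be $\sigma$-finite measure spaces and let $(\Omega,\mu)=(\Omega_1\times\cdots\times\Omega_n,\mu_1\otimes\cdots\otimes\mu_n)$ be the product measure space. Let $1\leq p<\infty$, let $X$ be a Banach space and let $Z$ be an index set. For $k=1,\ldots,n$ and $z\in Z$, assume that $S_z^k\colon \mathrm{L}^p(\Omega_k)\to \mathrm{L}^p(\Omega_k)$ is a bounded operator such that the family $\{S^k_z\otimes\mathrm{Id}_X:z\in Z\}$ is $R$-bounded over the Bochner space $\mathrm{L}^p(\Omega_k,X)$. Then for any $z\in Z$ the tensor product $$S_z=S_z^1\otimes S_z^2\otimes\cdots\otimes S_z^n\otimes\mathrm{Id}_X$$ extends to a bounded operator on $\mathrm{L}^p(\Omega,X)$ and the family $\{S_z:z\in Z\}$ is $R$-bounded over the Bochner space $\mathrm{L}^p(\Omega,X)$.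
   Context: A set $\mathcal{F}$ of bounded operators on a Banach space $Y$ is $R$-bounded if there is $C\geq0$ such that for all $N$, all $T_1,\ldots,T_N\in\mathcal{F}$ and $x_1,\ldots,x_N\in Y$, $\|\sum_k\varepsilon_k\otimes T_kx_k\|_{\mathrm{L}^q(\Omega_0,Y)}\leq C\|\sum_k\varepsilon_k\otimes x_k\|_{\mathrm{L}^q(\Omega_0,Y)}$, where $(\varepsilon_k)$ are independent Rademacher variables on a probability space $\Omega_0$ and $1<q<\infty$ (the property does not depend on $q$). *)

theory Defs
  imports "HOL-Probability.Probability"
begin

text \<open>
  Scalars are the elements of a type \<open>'k\<close> of class \<open>real_normed_field\<close> (such as \<open>real\<close> and
  \<open>complex\<close>), so that real and complex Banach spaces are treated together. The library has no class
  of complex Banach spaces: a Banach space over \<open>'k\<close> is a type of class \<open>banach\<close> together with a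
  scalar multiplication \<open>sc\<close> that extends the real one.
\<close>

definition normed_scaling :: "('k::real_normed_field \<Rightarrow> 'x::real_normed_vector \<Rightarrow> 'x) \<Rightarrow> bool" where
  "normed_scaling sc \<longleftrightarrow>
     vector_space sc \<and>
     (\<forall>a x. norm (sc a x) = norm a * norm x) \<and>
     (\<forall>r x. sc (of_real r) x = r *\<^sub>R x)"

lemma normed_scaling_scaleR: "normed_scaling (scaleR :: real \<Rightarrow> 'x::real_normed_vector \<Rightarrow> 'x)"
  unfolding normed_scaling_def by (auto intro!: vector_space.intro simp: algebra_simps)

lemma normed_scaling_mult: "normed_scaling ((*) :: 'k::real_normed_field \<Rightarrow> 'k \<Rightarrow> 'k)"
  unfolding normed_scaling_def
  by (auto intro!: vector_space.intro simp: algebra_simps norm_mult scaleR_conv_of_real)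

text \<open>
  Bochner measurability. Borel measurability alone would be too weak when the target space is not
  separable.
\<close>

definition strongly_measurable :: "'a measure \<Rightarrow> ('a \<Rightarrow> 'b::real_normed_vector) \<Rightarrow> bool" where
  "strongly_measurable M f \<longleftrightarrow>
     (\<exists>s :: nat \<Rightarrow> 'a \<Rightarrow> 'b.
        (\<forall>i. simple_function M (s i)) \<and> (\<forall>t\<in>space M. (\<lambda>i. s i t) \<longlonglongrightarrow> f t))"

text \<open>
  Elements of a Bochner space are represented by functions; two functions represent the same element
  if they agree almost everywhere.
\<close>

definition Lp_space :: "real \<Rightarrow> 'a measure \<Rightarrow> ('a \<Rightarrow> 'b::real_normed_vector) set" where
  "Lp_space p M = {f. strongly_measurable M f \<and> integrable M (\<lambda>t. norm (f t) powr p)}"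

definition Lp_norm :: "real \<Rightarrow> 'a measure \<Rightarrow> ('a \<Rightarrow> 'b::real_normed_vector) \<Rightarrow> real" where
  "Lp_norm p M f = (\<integral>t. norm (f t) powr p \<partial>M) powr (1 / p)"

text \<open>
  A map of representatives that is linear almost everywhere and bounded respects equality almost
  everywhere, hence is the same as a bounded linear operator on the space of equivalence classes.
\<close>

definition bounded_operator_Lp ::
  "('k::real_normed_field \<Rightarrow> 'x::real_normed_vector \<Rightarrow> 'x) \<Rightarrow> real \<Rightarrow> 'a measure
     \<Rightarrow> (('a \<Rightarrow> 'x) \<Rightarrow> ('a \<Rightarrow> 'x)) \<Rightarrow> bool" where
  "bounded_operator_Lp sc p M T \<longleftrightarrow>
     (\<forall>f\<in>Lp_space p M. T f \<in> Lp_space p M) \<and>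
     (\<forall>f\<in>Lp_space p M. \<forall>g\<in>Lp_space p M. AE t in M. T (\<lambda>t. f t + g t) t = T f t + T g t) \<and>
     (\<forall>a. \<forall>f\<in>Lp_space p M. AE t in M. T (\<lambda>t. sc a (f t)) t = sc a (T f t)) \<and>
     (\<exists>C\<ge>0. \<forall>f\<in>Lp_space p M. Lp_norm p M (T f) \<le> C * Lp_norm p M f)"

text \<open>
  In the next two definitions \<open>T\<close> is a bounded extension of a tensor product of operators, which
  lives on the linear span of the elementary tensors. As \<open>T\<close> is linear, it suffices to prescribe
  its values on the elementary tensors themselves.
\<close>

definition extends_tensor_Id ::
  "('k::real_normed_field \<Rightarrow> 'x::real_normed_vector \<Rightarrow> 'x) \<Rightarrow> real \<Rightarrow> 'a measure
     \<Rightarrow> (('a \<Rightarrow> 'k) \<Rightarrow> ('a \<Rightarrow> 'k)) \<Rightarrow> (('a \<Rightarrow> 'x) \<Rightarrow> ('a \<Rightarrow> 'x)) \<Rightarrow> bool" where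
  "extends_tensor_Id sc p M S T \<longleftrightarrow>
     bounded_operator_Lp sc p M T \<and>
     (\<forall>f\<in>Lp_space p M. \<forall>x. AE t in M. T (\<lambda>t. sc (f t) x) t = sc (S f t) x)"

definition extends_tensor_prod_Id ::
  "('k::real_normed_field \<Rightarrow> 'x::real_normed_vector \<Rightarrow> 'x) \<Rightarrow> real \<Rightarrow> nat \<Rightarrow> (nat \<Rightarrow> 'a measure)
     \<Rightarrow> (nat \<Rightarrow> ('a \<Rightarrow> 'k) \<Rightarrow> ('a \<Rightarrow> 'k))
     \<Rightarrow> (((nat \<Rightarrow> 'a) \<Rightarrow> 'x) \<Rightarrow> ((nat \<Rightarrow> 'a) \<Rightarrow> 'x)) \<Rightarrow> bool" where
  "extends_tensor_prod_Id sc p n M S T \<longleftrightarrow>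
     bounded_operator_Lp sc p (PiM {1..n} M) T \<and>
     (\<forall>f x. (\<forall>k\<in>{1..n}. f k \<in> Lp_space p (M k)) \<longrightarrow>
        (AE t in PiM {1..n} M.
           T (\<lambda>t. sc (\<Prod>k=1..n. f k (t k)) x) t = sc (\<Prod>k=1..n. S k (f k) (t k)) x))"

definition rademacher :: "'o measure \<Rightarrow> (nat \<Rightarrow> 'o \<Rightarrow> real) \<Rightarrow> bool" where
  "rademacher P \<epsilon> \<longleftrightarrow>
     prob_space P \<and>
     prob_space.indep_vars P (\<lambda>_. borel) \<epsilon> UNIV \<and>
     (\<forall>k. measure P {\<omega>\<in>space P. \<epsilon> k \<omega> = 1} = 1 / 2 \<and>
          measure P {\<omega>\<in>space P. \<epsilon> k \<omega> = -1} = 1 / 2)"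

text \<open>
  \<open>R\<close>-boundedness on the Banach space \<open>Y\<close> of \<open>p\<close>-integrable functions over \<open>M\<close>. The norm
  of an element of the Bochner space of \<open>Y\<close>-valued functions over \<open>P\<close> is the \<open>q\<close>-norm
  of the real function \<open>\<omega> \<mapsto> \<parallel>\<dots>\<parallel>\<close>, the inner norm being that of \<open>Y\<close>.
\<close>

definition R_bounded_Lp ::
  "'o measure \<Rightarrow> (nat \<Rightarrow> 'o \<Rightarrow> real) \<Rightarrow> real \<Rightarrow> real \<Rightarrow> 'a measure
     \<Rightarrow> (('a \<Rightarrow> 'x::real_normed_vector) \<Rightarrow> ('a \<Rightarrow> 'x)) set \<Rightarrow> bool" where
  "R_bounded_Lp P \<epsilon> q p M F \<longleftrightarrow>
     (\<exists>C\<ge>0. \<forall>N T f. (\<forall>k\<in>{1..N}. T k \<in> F \<and> f k \<in> Lp_space p M) \<longrightarrow>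
        Lp_norm q P (\<lambda>\<omega>. Lp_norm p M (\<lambda>t. \<Sum>k=1..N. \<epsilon> k \<omega> *\<^sub>R T k (f k) t))
        \<le> C * Lp_norm q P (\<lambda>\<omega>. Lp_norm p M (\<lambda>t. \<Sum>k=1..N. \<epsilon> k \<omega> *\<^sub>R f k t)))"

end

theory Submission
  imports Defs
begin

text \<open>
  The operator \<open>S\<^sub>z\<close> is the composition over \<open>k\<close> of the operators acting by \<open>S\<^sup>k\<^sub>z \<otimes> Id\<close> in the
  \<open>k\<close>-th variable and trivially in the others, and products of \<open>R\<close>-bounded families are
  \<open>R\<close>-bounded, so a single variable has to be treated. There, an \<open>R\<close>-bound with exponent
  \<open>q = p\<close> passes from \<open>L\<^sup>p(\<Omega>\<^sub>k, X)\<close> to \<open>L\<^sup>p(\<Omega>, X)\<close> by applying it on almost every slice and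
  integrating over the remaining variables. Kahane's inequality permits the change of exponent. It is
  proved for \<open>\<Psi>(s) = \<integral> \<parallel>\<Sum> s\<^sub>k f\<^sub>k\<parallel>\<^sup>p\<close>, a function of the signs \<open>s\<^sub>k\<close> that is convex in each of them
  and homogeneous of degree \<open>p\<close>, via a (4,2)-hypercontractive estimate.
\<close>

section \<open>Kahane's inequality\<close>

text \<open>The estimates are kept at the level of \<open>Lp_int\<close>, the p-th power of the
  norm, because by Fubini's theorem it is the integral of the same quantity over slices. For q
  different from p the outer q-norm does not commute with integration over the remaining variables,
  so the passage to q = p cannot be avoided. It is made through \<Psi> with the exponent \<theta> =
  q / p, which may lie on either side of 1; both directions of the comparison are required.

  Hypercontractivity enters because halving all signs multiplies \<Psi> by (1/2)^p: an estimate at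
  halved signs becomes a comparison of moments whose constant is independent of the number of signs.
  Halving takes the part of the noise operator, since in each coordinate convexity bounds the value
  at 1/2 by the average of the values at 1 and -1 with weights 3/4 and 1/4.

  The other obstacle is measurability. Operators act on representatives, so applying one on every
  slice gives no control in the remaining variables. The slicewise operator is therefore built as a
  graph, and its domain is shown to be everything by going from rectangles to a Dynkin class and
  then to limits.\<close>

definition sgn_of :: "nat set \<Rightarrow> nat \<Rightarrow> real" where
  "sgn_of B k = (if k \<in> B then 1 else -1)"

text \<open>Expectation over independent uniform signs on \<open>A\<close>, each sign vector being
  encoded by the set of its positive coordinates. Coordinates outside \<open>A\<close> carry the
  default sign -1.\<close>

definition sign_avg :: "nat set \<Rightarrow> ((nat \<Rightarrow> real) \<Rightarrow> real) \<Rightarrow> real" where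
  "sign_avg A F = (\<Sum>B\<in>Pow A. F (sgn_of B)) / 2 ^ card A"

lemma sign_avg_empty [simp]: "sign_avg {} F = F (sgn_of {})"
  by (simp add: sign_avg_def)

lemma sign_avg_insert:
  assumes "finite A" "x \<notin> A"
  shows "sign_avg (insert x A) F =
    (sign_avg A (\<lambda>s. F (s(x := 1))) + sign_avg A (\<lambda>s. F (s(x := -1)))) / 2"
proof -
  have 1: "(\<Sum>B\<in>Pow A. F (sgn_of (insert x B))) = (\<Sum>B\<in>Pow A. F ((sgn_of B)(x := 1)))"
    by (rule sum.cong) (auto simp: sgn_of_def fun_eq_iff intro!: arg_cong[where f = F])
  \<comment> \<open>As \<open>x\<close> lies outside every such \<open>B\<close>, the default sign
    of \<open>sgn_of B\<close> at \<open>x\<close> is already -1.\<close>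
  have 2: "(\<Sum>B\<in>Pow A. F (sgn_of B)) = (\<Sum>B\<in>Pow A. F ((sgn_of B)(x := -1)))"
    using assms by (intro sum.cong) (auto simp: sgn_of_def fun_eq_iff intro!: arg_cong[where f = F])
  have "(\<Sum>B\<in>Pow (insert x A). F (sgn_of B)) =
    (\<Sum>B\<in>Pow A. F (sgn_of B)) + (\<Sum>B\<in>insert x ` Pow A. F (sgn_of B))"
    unfolding Pow_insert using assms by (intro sum.union_disjoint) auto
  also have "(\<Sum>B\<in>insert x ` Pow A. F (sgn_of B)) = (\<Sum>B\<in>Pow A. F (sgn_of (insert x B)))"
  proof (subst sum.reindex)
    show "inj_on (insert x) (Pow A)"
      using assms(2) by (auto simp: inj_on_def)
  qed simp
  finally show ?thesis
    using assms 1 2 by (simp add: sign_avg_def field_simps)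
qed

lemma sign_avg_add: "sign_avg A (\<lambda>s. F s + G s) = sign_avg A F + sign_avg A G"
  by (simp add: sign_avg_def sum.distrib add_divide_distrib)

lemma sign_avg_cmult: "sign_avg A (\<lambda>s. c * F s) = c * sign_avg A F"
  by (simp add: sign_avg_def sum_distrib_left)

lemma sign_avg_const: "finite A \<Longrightarrow> sign_avg A (\<lambda>s. c) = c"
  by (simp add: sign_avg_def card_Pow)

lemma sign_avg_mono: "(\<And>s. F s \<le> G s) \<Longrightarrow> sign_avg A F \<le> sign_avg A G"
  by (simp add: sign_avg_def divide_right_mono sum_mono)

lemma sign_avg_nonneg: "(\<And>s. 0 \<le> F s) \<Longrightarrow> 0 \<le> sign_avg A F"
  by (simp add: sign_avg_def sum_nonneg)

lemma sign_avg_eq_0D: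
  assumes "finite A" "\<And>s. 0 \<le> F s" "sign_avg A F = 0" "B \<subseteq> A"
  shows "F (sgn_of B) = 0"
  using assms by (auto simp: sign_avg_def sum_nonneg_eq_0_iff)

lemma sign_avg_Cauchy_Schwarz:
  "(sign_avg A (\<lambda>s. F s * G s))\<^sup>2 \<le> sign_avg A (\<lambda>s. (F s)\<^sup>2) * sign_avg A (\<lambda>s. (G s)\<^sup>2)"
  using Cauchy_Schwarz_ineq_sum[of "\<lambda>B. F (sgn_of B)" "\<lambda>B. G (sgn_of B)" "Pow A"]
  by (simp add: sign_avg_def power_divide power2_eq_square divide_right_mono)

text \<open>
  All that is needed of convexity in each coordinate, since the hypercontractive estimate below is
  used with the contraction factor \<open>1/2\<close> only.
\<close>

definition midconvex :: "((nat \<Rightarrow> real) \<Rightarrow> real) \<Rightarrow> bool" where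
  "midconvex \<Psi> \<longleftrightarrow> (\<forall>s. 0 \<le> \<Psi> s) \<and>
     (\<forall>s k. \<Psi> (s(k := 1/2)) \<le> 3/4 * \<Psi> (s(k := 1)) + 1/4 * \<Psi> (s(k := -1))) \<and>
     (\<forall>s k. \<Psi> (s(k := -1/2)) \<le> 1/4 * \<Psi> (s(k := 1)) + 3/4 * \<Psi> (s(k := -1)))"

text \<open>Lets the induction hypothesis be applied after one coordinate has been frozen. For
  \<open>k = x\<close> all three values coincide, and the weights sum to 1.\<close>

lemma midconvex_upd:
  assumes "midconvex \<Psi>"
  shows "midconvex (\<lambda>s. \<Psi> (s(x := c)))"
  unfolding midconvex_def
proof (intro conjI allI)
  fix s :: "nat \<Rightarrow> real" and k
  have nn: "0 \<le> \<Psi> s" for s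
    using assms by (simp add: midconvex_def)
  show "0 \<le> \<Psi> (s(x := c))"
    by (rule nn)
  show "\<Psi> (s(k := 1/2, x := c)) \<le> 3/4 * \<Psi> (s(k := 1, x := c)) + 1/4 * \<Psi> (s(k := -1, x := c))"
  proof (cases "k = x")
    case False
    then show ?thesis
      using assms unfolding midconvex_def by (metis fun_upd_twist)
  qed simp
  show "\<Psi> (s(k := -1/2, x := c)) \<le> 1/4 * \<Psi> (s(k := 1, x := c)) + 3/4 * \<Psi> (s(k := -1, x := c))"
  proof (cases "k = x")
    case False
    then show ?thesis
      using assms unfolding midconvex_def by (metis fun_upd_twist)
  qed simp
qed

text \<open>Jensen's inequality for the square, with the variance term a b (x - y)^2 as deficit.
  Nonnegativity of \<Psi> is what makes squaring monotone.\<close>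

lemma midconvex_square:
  assumes "midconvex \<Psi>"
  shows "midconvex (\<lambda>s. (\<Psi> s)\<^sup>2)"
proof -
  have *: "z\<^sup>2 \<le> a * x\<^sup>2 + b * y\<^sup>2"
    if "0 \<le> z" "z \<le> a * x + b * y" "a + b = 1" "0 \<le> a" "0 \<le> b" for a b x y z :: real
  proof -
    have "z\<^sup>2 \<le> (a * x + b * y)\<^sup>2"
      using that by (intro power_mono) auto
    also have "\<dots> = (a * x\<^sup>2 + b * y\<^sup>2) * (a + b) - a * b * (x - y)\<^sup>2"
      by (simp add: power2_eq_square algebra_simps)
    also have "\<dots> \<le> a * x\<^sup>2 + b * y\<^sup>2"
      using that by simp
    finally show ?thesis .
  qed
  show ?thesis
    unfolding midconvex_def
  proof (intro conjI allI)
    fix s :: "nat \<Rightarrow> real" and k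
    show "(\<Psi> (s(k := 1/2)))\<^sup>2 \<le> 3/4 * (\<Psi> (s(k := 1)))\<^sup>2 + 1/4 * (\<Psi> (s(k := -1)))\<^sup>2"
      using assms unfolding midconvex_def by (intro *) auto
    show "(\<Psi> (s(k := -1/2)))\<^sup>2 \<le> 1/4 * (\<Psi> (s(k := 1)))\<^sup>2 + 3/4 * (\<Psi> (s(k := -1)))\<^sup>2"
      using assms unfolding midconvex_def by (intro *) auto
  qed simp
qed

text \<open>Feeds powers of \<Psi> into the hypercontractive estimate, which then compares
  consecutive moments of orders 2^m.\<close>

lemma midconvex_power_two:
  assumes "midconvex \<Psi>"
  shows "midconvex (\<lambda>s. \<Psi> s ^ (2 ^ m))"
proof (induction m)
  case (Suc m)
  from midconvex_square[OF this] show ?case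
    by (simp flip: power_mult add: mult.commute)
qed (use assms in simp)

section \<open>Hypercontractivity and integer moments\<close>

definition halve :: "nat set \<Rightarrow> (nat \<Rightarrow> real) \<Rightarrow> nat \<Rightarrow> real" where
  "halve A s k = (if k \<in> A then s k / 2 else s k)"

text \<open>The two-point inequality in terms of second moments: \<open>P\<close>, \<open>Q\<close>,
  \<open>R\<close> will be the averages of g^2, h^2 and g h, where the values at the signs 1 and -1
  are g + h and g - h. Halving the sign replaces h by h/2, whence Q/4 and the coefficient 1 of R.
  The bound R^2 \<le> P Q raises the coefficient of P Q from 1/2 to 3/2, still below the 2 on the
  right.\<close>

lemma hypercontractive_real:
  fixes P Q R :: real
  assumes "R\<^sup>2 \<le> P * Q" "0 \<le> P" "0 \<le> Q"
  shows "((P + Q/4 + R)\<^sup>2 + (P + Q/4 - R)\<^sup>2) / 2 \<le> (P + Q)\<^sup>2"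
proof -
  have "((P + Q/4 + R)\<^sup>2 + (P + Q/4 - R)\<^sup>2) / 2 = (P + Q/4)\<^sup>2 + R\<^sup>2"
    by (simp add: power2_eq_square algebra_simps)
  also have "\<dots> \<le> (P + Q/4)\<^sup>2 + P * Q"
    using assms by simp
  also have "\<dots> = (P + Q)\<^sup>2 - P * Q / 2 - 15/16 * Q\<^sup>2"
    by (simp add: power2_eq_square algebra_simps)
  also have "\<dots> \<le> (P + Q)\<^sup>2"
    using mult_nonneg_nonneg[OF assms(2,3)] zero_le_power2[of Q] by linarith
  finally show ?thesis .
qed

text \<open>
  In the induction step one coordinate is split off; the two-point inequality in that coordinate is
  combined with the Cauchy-Schwarz inequality in the others.
\<close>

lemma sign_avg_hypercontractive:
  assumes "finite A" "midconvex \<Psi>"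
  shows "sign_avg A (\<lambda>s. \<Psi> (halve A s) ^ 4) \<le> (sign_avg A (\<lambda>s. (\<Psi> s)\<^sup>2))\<^sup>2"
  using assms
proof (induction A arbitrary: \<Psi> rule: finite_induct)
  case empty
  then show ?case by (simp add: halve_def[abs_def] flip: power_mult)
next
  case (insert x A)
  define a where "a s = \<Psi> (s(x := 1))" for s
  define b where "b s = \<Psi> (s(x := -1))" for s
  \<comment> \<open>Even and odd parts of \<Psi> in the coordinate \<open>x\<close>, so a = g + h
    and b = g - h. The weights 3/4 and 1/4 in \<open>midconvex\<close> then say exactly that the
    values at 1/2 and -1/2 are at most g + h/2 and g - h/2.\<close>
  define g where "g s = (a s + b s) / 2" for s
  define h where "h s = (a s - b s) / 2" for s
  define P where "P = sign_avg A (\<lambda>s. (g s)\<^sup>2)"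
  define Q where "Q = sign_avg A (\<lambda>s. (h s)\<^sup>2)"
  define R where "R = sign_avg A (\<lambda>s. g s * h s)"
  have nn: "0 \<le> \<Psi> s" for s
    using insert.prems by (simp add: midconvex_def)
  have h1: "halve (insert x A) (s(x := c)) = (halve A s)(x := c / 2)" for s c
    using insert.hyps by (auto simp: halve_def fun_eq_iff)
  have up: "sign_avg A (\<lambda>s. (\<Psi> (s(x := 1/2)))\<^sup>2) \<le> P + Q/4 + R"
  proof -
    have "sign_avg A (\<lambda>s. (\<Psi> (s(x := 1/2)))\<^sup>2) \<le> sign_avg A (\<lambda>s. (g s + h s / 2)\<^sup>2)"
    proof (intro sign_avg_mono power_mono nn)
      fix s
      have "\<Psi> (s(x := 1/2)) \<le> 3/4 * \<Psi> (s(x := 1)) + 1/4 * \<Psi> (s(x := -1))"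
        using insert.prems unfolding midconvex_def by blast
      then show "\<Psi> (s(x := 1/2)) \<le> g s + h s / 2"
        unfolding g_def h_def a_def b_def by (simp add: field_simps)
    qed
    also have "(\<lambda>s. (g s + h s / 2)\<^sup>2) = (\<lambda>s. (g s)\<^sup>2 + (1/4 * (h s)\<^sup>2 + g s * h s))"
      by (auto simp: power2_eq_square field_simps)
    also have "sign_avg A \<dots> = P + Q/4 + R"
      unfolding sign_avg_add sign_avg_cmult P_def Q_def R_def by simp
    finally show ?thesis .
  qed
  have down: "sign_avg A (\<lambda>s. (\<Psi> (s(x := -1/2)))\<^sup>2) \<le> P + Q/4 - R"
  proof -
    have "sign_avg A (\<lambda>s. (\<Psi> (s(x := -1/2)))\<^sup>2) \<le> sign_avg A (\<lambda>s. (g s - h s / 2)\<^sup>2)"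
    proof (intro sign_avg_mono power_mono nn)
      fix s
      have "\<Psi> (s(x := -1/2)) \<le> 1/4 * \<Psi> (s(x := 1)) + 3/4 * \<Psi> (s(x := -1))"
        using insert.prems unfolding midconvex_def by blast
      then show "\<Psi> (s(x := -1/2)) \<le> g s - h s / 2"
        unfolding g_def h_def a_def b_def by (simp add: field_simps)
    qed
    also have "(\<lambda>s. (g s - h s / 2)\<^sup>2) = (\<lambda>s. (g s)\<^sup>2 + (1/4 * (h s)\<^sup>2 + (-1) * (g s * h s)))"
      by (auto simp: power2_eq_square field_simps)
    also have "sign_avg A \<dots> = P + Q/4 - R"
      unfolding sign_avg_add sign_avg_cmult P_def Q_def R_def by simp
    finally show ?thesis .
  qed
  have 1: "sign_avg A (\<lambda>s. \<Psi> ((halve A s)(x := 1/2)) ^ 4) \<le> (P + Q/4 + R)\<^sup>2"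
  proof -
    have "sign_avg A (\<lambda>s. \<Psi> ((halve A s)(x := 1/2)) ^ 4) \<le> (sign_avg A (\<lambda>s. (\<Psi> (s(x := 1/2)))\<^sup>2))\<^sup>2"
      by (rule insert.IH[OF midconvex_upd[OF insert.prems]])
    also have "\<dots> \<le> (P + Q/4 + R)\<^sup>2"
      by (intro power_mono up sign_avg_nonneg) simp
    finally show ?thesis .
  qed
  have 2: "sign_avg A (\<lambda>s. \<Psi> ((halve A s)(x := -1/2)) ^ 4) \<le> (P + Q/4 - R)\<^sup>2"
  proof -
    have "sign_avg A (\<lambda>s. \<Psi> ((halve A s)(x := -1/2)) ^ 4) \<le> (sign_avg A (\<lambda>s. (\<Psi> (s(x := -1/2)))\<^sup>2))\<^sup>2"
      by (rule insert.IH[OF midconvex_upd[OF insert.prems]])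
    also have "\<dots> \<le> (P + Q/4 - R)\<^sup>2"
      by (intro power_mono down sign_avg_nonneg) simp
    finally show ?thesis .
  qed
  have "sign_avg (insert x A) (\<lambda>s. \<Psi> (halve (insert x A) s) ^ 4)
      \<le> ((P + Q/4 + R)\<^sup>2 + (P + Q/4 - R)\<^sup>2) / 2"
    using 1 2 insert.hyps by (simp add: sign_avg_insert h1)
  also have "\<dots> \<le> (P + Q)\<^sup>2"
    by (rule hypercontractive_real)
       (simp_all add: P_def Q_def R_def sign_avg_Cauchy_Schwarz sign_avg_nonneg)
  also have "P + Q = sign_avg (insert x A) (\<lambda>s. (\<Psi> s)\<^sup>2)"
  proof -
    have "P + Q = sign_avg A (\<lambda>s. 1/2 * (a s)\<^sup>2 + 1/2 * (b s)\<^sup>2)"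
      unfolding P_def Q_def sign_avg_add[symmetric] g_def h_def
      by (auto simp: power2_eq_square field_simps intro!: arg_cong[where f = "sign_avg A"])
    also have "\<dots> = sign_avg (insert x A) (\<lambda>s. (\<Psi> s)\<^sup>2)"
      unfolding sign_avg_add sign_avg_cmult sign_avg_insert[OF insert.hyps] a_def b_def by simp
    finally show ?thesis .
  qed
  finally show ?case .
qed

text \<open>Hypercontractivity is applied to \<Psi>^(2^j) with m = j + 1: its fourth power has order
  2 * 2^m and its square has order 2^m. Homogeneity extracts the factor c^(2 * 2^m) from the halved
  signs.\<close>

lemma sign_avg_moment_double:
  assumes A: "finite A" and \<Psi>: "midconvex \<Psi>" and c: "0 < c" "\<And>s. \<Psi> (halve A s) = c * \<Psi> s"
    and m: "1 \<le> m"
  shows "sign_avg A (\<lambda>s. \<Psi> s ^ (2 * 2 ^ m)) \<le> (1 / c) ^ (2 * 2 ^ m) * (sign_avg A (\<lambda>s. \<Psi> s ^ 2 ^ m))\<^sup>2"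
proof -
  obtain j where j: "m = Suc j" using m by (cases m) auto
  have "c ^ (2 * 2 ^ m) * sign_avg A (\<lambda>s. \<Psi> s ^ (2 * 2 ^ m)) =
      sign_avg A (\<lambda>s. (\<Psi> (halve A s) ^ 2 ^ j) ^ 4)"
    unfolding sign_avg_cmult[symmetric] c(2) j
    by (simp add: power_mult_distrib flip: power_mult) (simp add: mult.commute)
  also have "\<dots> \<le> (sign_avg A (\<lambda>s. (\<Psi> s ^ 2 ^ j)\<^sup>2))\<^sup>2"
    by (rule sign_avg_hypercontractive[OF A midconvex_power_two[OF \<Psi>]])
  also have "\<dots> = (sign_avg A (\<lambda>s. \<Psi> s ^ 2 ^ m))\<^sup>2"
    by (simp add: j mult.commute flip: power_mult)
  finally show ?thesis
    using c(1) by (simp add: power_divide field_simps)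
qed

text \<open>Splitting at a level \<open>\<lambda>\<close> replaces interpolation between moments.\<close>

lemma sign_avg_moment_two:
  assumes A: "finite A" and \<Psi>: "midconvex \<Psi>" and c: "0 < c" "\<And>s. \<Psi> (halve A s) = c * \<Psi> s"
  shows "sign_avg A (\<lambda>s. (\<Psi> s)\<^sup>2) \<le> 8 * (1 / c) ^ 4 * (sign_avg A \<Psi>)\<^sup>2"
proof -
  define E where "E = sign_avg A (\<lambda>s. (\<Psi> s)\<^sup>2)"
  define e where "e = sign_avg A \<Psi>"
  have nn: "0 \<le> \<Psi> s" for s
    using \<Psi> by (simp add: midconvex_def)
  have E0: "0 \<le> E"
    by (simp add: E_def sign_avg_nonneg)
  have e0: "0 \<le> e"
    by (simp add: e_def sign_avg_nonneg nn)
  have 4: "sign_avg A (\<lambda>s. \<Psi> s ^ 4) \<le> (1 / c) ^ 4 * E\<^sup>2"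
    using sign_avg_moment_double[OF A \<Psi> c, of 1] by (simp add: E_def)
  show ?thesis
  proof (cases "E = 0")
    case True
    then show ?thesis using e0 c by (simp add: E_def[symmetric])
  next
    case False
    then have E: "0 < E" using E0 by simp
    \<comment> \<open>Chosen so that the fourth-moment term of the split is exactly E/2 and can be
      absorbed into the left-hand side.\<close>
    define l where "l = sqrt (2 * (1 / c) ^ 4 * E)"
    have l: "0 < l" and l2: "l\<^sup>2 = 2 * (1 / c) ^ 4 * E"
      using E c by (auto simp: l_def)
    have "(\<Psi> s)\<^sup>2 \<le> l * \<Psi> s + 1 / l\<^sup>2 * \<Psi> s ^ 4" for s
    proof (cases "\<Psi> s \<le> l")
      case True
      then have "(\<Psi> s)\<^sup>2 \<le> l * \<Psi> s"
        using nn[of s] by (simp add: power2_eq_square mult_right_mono)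
      moreover have "0 \<le> 1 / l\<^sup>2 * \<Psi> s ^ 4"
        by simp
      ultimately show ?thesis by linarith
    next
      case False
      then have "l\<^sup>2 \<le> (\<Psi> s)\<^sup>2"
        using l by (intro power_mono) auto
      then have "l\<^sup>2 * (\<Psi> s)\<^sup>2 \<le> (\<Psi> s)\<^sup>2 * (\<Psi> s)\<^sup>2"
        by (rule mult_right_mono) simp
      then have "(\<Psi> s)\<^sup>2 \<le> 1 / l\<^sup>2 * \<Psi> s ^ 4"
        using l by (simp add: field_simps power2_eq_square power4_eq_xxxx)
      moreover have "0 \<le> l * \<Psi> s"
        using l nn[of s] by simp
      ultimately show ?thesis by linarith
    qed
    then have "E \<le> sign_avg A (\<lambda>s. l * \<Psi> s + 1 / l\<^sup>2 * \<Psi> s ^ 4)"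
      unfolding E_def by (rule sign_avg_mono)
    also have "\<dots> = l * e + 1 / l\<^sup>2 * sign_avg A (\<lambda>s. \<Psi> s ^ 4)"
      by (simp only: sign_avg_add sign_avg_cmult e_def)
    also have "\<dots> \<le> l * e + 1 / l\<^sup>2 * ((1 / c) ^ 4 * E\<^sup>2)"
      by (intro add_left_mono mult_left_mono 4) simp
    also have "1 / l\<^sup>2 * ((1 / c) ^ 4 * E\<^sup>2) = E / 2"
      unfolding l2 using E c by (simp add: power2_eq_square)
    finally have "E \<le> 2 * (l * e)" by simp
    \<comment> \<open>Squaring replaces l by l^2, which is proportional to E; one factor E then
      cancels.\<close>
    then have "E\<^sup>2 \<le> (2 * (l * e))\<^sup>2"
      using E by (intro power_mono) auto
    also have "\<dots> = E * (8 * (1 / c) ^ 4 * e\<^sup>2)"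
      by (simp add: power_mult_distrib l2)
    finally have "E \<le> 8 * (1 / c) ^ 4 * e\<^sup>2"
      using E by (simp add: power2_eq_square[of E])
    then show ?thesis by (simp add: E_def e_def)
  qed
qed

text \<open>The order of the quantifiers is the point: \<open>K\<close> depends on \<open>c\<close>
  and \<open>m\<close> only, not on the number of signs. Each induction step squares the previous
  constant and multiplies it by the doubling constant.\<close>

lemma sign_avg_moment_power_two:
  assumes "0 < c"
  shows "\<exists>K\<ge>1. \<forall>A \<Psi>. finite A \<longrightarrow> midconvex \<Psi> \<longrightarrow> (\<forall>s. \<Psi> (halve A s) = c * \<Psi> s) \<longrightarrow>
    sign_avg A (\<lambda>s. \<Psi> s ^ 2 ^ Suc m) \<le> K * sign_avg A \<Psi> ^ 2 ^ Suc m"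
proof (induction m)
  case 0
  show ?case
  proof (intro exI conjI allI impI)
    fix A \<Psi> assume *: "finite A" "midconvex \<Psi>" "\<forall>s. \<Psi> (halve A s) = c * \<Psi> s"
    have "sign_avg A (\<lambda>s. (\<Psi> s)\<^sup>2) \<le> 8 * (1 / c) ^ 4 * (sign_avg A \<Psi>)\<^sup>2"
      by (rule sign_avg_moment_two) (use * assms in auto)
    also have "\<dots> \<le> max 1 (8 * (1 / c) ^ 4) * (sign_avg A \<Psi>)\<^sup>2"
      by (intro mult_right_mono) auto
    finally show "sign_avg A (\<lambda>s. \<Psi> s ^ 2 ^ Suc 0) \<le> max 1 (8 * (1 / c) ^ 4) * sign_avg A \<Psi> ^ 2 ^ Suc 0"
      by simp
  qed simp
next
  case (Suc m)
  then obtain K where K: "1 \<le> K" "\<And>A \<Psi>. finite A \<Longrightarrow> midconvex \<Psi> \<Longrightarrow> (\<And>s. \<Psi> (halve A s) = c * \<Psi> s) \<Longrightarrow>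
    sign_avg A (\<lambda>s. \<Psi> s ^ 2 ^ Suc m) \<le> K * sign_avg A \<Psi> ^ 2 ^ Suc m"
    by metis
  define K' where "K' = (1 / c) ^ (2 * 2 ^ Suc m) * K\<^sup>2"
  show ?case
  proof (intro exI conjI allI impI)
    fix A \<Psi> assume *: "finite A" "midconvex \<Psi>" "\<forall>s. \<Psi> (halve A s) = c * \<Psi> s"
    have nn: "0 \<le> \<Psi> s" for s
      using * by (simp add: midconvex_def)
    have "sign_avg A (\<lambda>s. \<Psi> s ^ (2 * 2 ^ Suc m)) \<le>
        (1 / c) ^ (2 * 2 ^ Suc m) * (sign_avg A (\<lambda>s. \<Psi> s ^ 2 ^ Suc m))\<^sup>2"
      by (rule sign_avg_moment_double) (use * assms in auto)
    also have "\<dots> \<le> (1 / c) ^ (2 * 2 ^ Suc m) * (K * sign_avg A \<Psi> ^ 2 ^ Suc m)\<^sup>2"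
      using K(2)[of A \<Psi>] * assms nn by (intro mult_left_mono power_mono sign_avg_nonneg) auto
    also have "\<dots> = K' * sign_avg A \<Psi> ^ 2 ^ Suc (Suc m)"
      by (simp add: K'_def power_mult_distrib mult.commute flip: power_mult)
    also have "\<dots> \<le> max 1 K' * sign_avg A \<Psi> ^ 2 ^ Suc (Suc m)"
      by (intro mult_right_mono zero_le_power sign_avg_nonneg nn) auto
    finally show "sign_avg A (\<lambda>s. \<Psi> s ^ 2 ^ Suc (Suc m)) \<le> max 1 K' * sign_avg A \<Psi> ^ 2 ^ Suc (Suc m)"
      by simp
  qed simp
qed

text \<open>Above the level l the quotient (x / l)^(L - \<theta>) is at least 1, so the integer
  power dominates; below it the constant does. This gives a real moment from an integer one, with l
  taken to be the mean.\<close>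

lemma powr_le_split:
  fixes x l \<theta> :: real
  assumes "0 \<le> x" "0 < l" "0 < \<theta>" "\<theta> \<le> real L"
  shows "x powr \<theta> \<le> l powr \<theta> + l powr (\<theta> - L) * x ^ L"
proof (cases "x \<le> l")
  case True
  then have "x powr \<theta> \<le> l powr \<theta>"
    using assms by (intro powr_mono2) auto
  then show ?thesis using assms by (simp add: add_increasing2)
next
  case False
  then have "x powr \<theta> = x powr (\<theta> - L) * x ^ L"
    using assms by (simp add: powr_diff powr_realpow)
  also have "\<dots> \<le> l powr (\<theta> - L) * x ^ L"
    using False assms by (intro mult_right_mono powr_mono2') auto
  finally show ?thesis by (smt (verit) powr_ge_zero)
qed

text \<open>The three terms serve the ranges below a, between a and b, and above b. In the middle
  x^(1 - \<theta>) is monotone, so it is bounded by its value at one endpoint; the sum of both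
  values covers either sign of 1 - \<theta>.\<close>

lemma le_powr_split:
  fixes x a b \<theta> :: real
  assumes "0 \<le> x" "0 < a" "0 < b"
  shows "x \<le> a + (a powr (1 - \<theta>) + b powr (1 - \<theta>)) * x powr \<theta> + 1 / b * x\<^sup>2"
proof -
  have 0: "0 \<le> (a powr (1 - \<theta>) + b powr (1 - \<theta>)) * x powr \<theta>" "0 \<le> 1 / b * x\<^sup>2"
    using assms by simp_all
  consider "x \<le> a" | "b \<le> x" | "a < x" "x < b" by linarith
  then show ?thesis
  proof cases
    case 2
    then have "b * x \<le> x * x"
      using assms by (intro mult_right_mono)
    then have "x \<le> 1 / b * x\<^sup>2"
      using assms by (simp add: field_simps power2_eq_square)
    then show ?thesis using 0 assms by linarith
  next
    case 3
    then have "x = x powr (1 - \<theta>) * x powr \<theta>"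
      using assms by (simp flip: powr_add)
    also have "x powr (1 - \<theta>) \<le> a powr (1 - \<theta>) + b powr (1 - \<theta>)"
    proof (cases "\<theta> \<le> 1")
      case True
      then have "x powr (1 - \<theta>) \<le> b powr (1 - \<theta>)"
        using 3 assms by (intro powr_mono2) auto
      then show ?thesis by (smt (verit) powr_ge_zero)
    next
      case False
      then have "x powr (1 - \<theta>) \<le> a powr (1 - \<theta>)"
        using 3 assms by (intro powr_mono2') auto
      then show ?thesis by (smt (verit) powr_ge_zero)
    qed
    finally show ?thesis using 0 assms by (smt (verit) mult_right_mono powr_ge_zero)
  qed (use 0 in linarith)
qed

text \<open>The first inequality bounds a real moment by an integer one of higher order. The second
  is the reverse comparison: the second moment controls large values, small values contribute a
  fraction of the mean, and the mean must therefore come largely from the middle range, where the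
  moment of order \<theta> sees it.\<close>

lemma Kahane:
  assumes c: "0 < c" and \<theta>: "0 < \<theta>"
  shows "\<exists>K>0. \<forall>A \<Psi>. finite A \<longrightarrow> midconvex \<Psi> \<longrightarrow> (\<forall>s. \<Psi> (halve A s) = c * \<Psi> s) \<longrightarrow>
    sign_avg A (\<lambda>s. \<Psi> s powr \<theta>) \<le> K * sign_avg A \<Psi> powr \<theta> \<and>
    sign_avg A \<Psi> powr \<theta> \<le> K * sign_avg A (\<lambda>s. \<Psi> s powr \<theta>)"
proof -
  \<comment> \<open>Provides a power of two above \<theta>, the order of the integer moment that
    dominates.\<close>
  obtain m :: nat where "\<theta> \<le> real m"
    using real_arch_simple by blast
  moreover have "real m \<le> 2 ^ Suc m"
    by (metis less_imp_le of_nat_less_two_power power_Suc mult_2 add_increasing zero_le_power zero_le_numeral)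
  ultimately have L: "\<theta> \<le> real (2 ^ Suc m)" by simp
  obtain K where K: "1 \<le> K" "\<And>A \<Psi>. finite A \<Longrightarrow> midconvex \<Psi> \<Longrightarrow> (\<And>s. \<Psi> (halve A s) = c * \<Psi> s) \<Longrightarrow>
    sign_avg A (\<lambda>s. \<Psi> s ^ 2 ^ Suc m) \<le> K * sign_avg A \<Psi> ^ 2 ^ Suc m"
    using sign_avg_moment_power_two[OF c] by metis
  obtain K2 where K2: "1 \<le> K2" "\<And>A \<Psi>. finite A \<Longrightarrow> midconvex \<Psi> \<Longrightarrow> (\<And>s. \<Psi> (halve A s) = c * \<Psi> s) \<Longrightarrow>
    sign_avg A (\<lambda>s. (\<Psi> s)\<^sup>2) \<le> K2 * (sign_avg A \<Psi>)\<^sup>2"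
    using sign_avg_moment_power_two[OF c, of 0] by auto
  \<comment> \<open>The middle coefficient of \<open>le_powr_split\<close> at the levels e/4 and 4
    K2 e, after e^(1 - \<theta>) is taken out. The factor 2 comes from solving for e once e/2 has
    been absorbed.\<close>
  define K3 where "K3 = 2 * ((1/4) powr (1 - \<theta>) + (4 * K2) powr (1 - \<theta>))"
  have K3: "0 < K3"
    using K2(1) by (auto simp: K3_def intro!: add_pos_pos)
  show ?thesis
  proof (intro exI[of _ "max (1 + K) K3"] conjI allI impI)
    show "0 < max (1 + K) K3" using K3 by simp
  next
    fix A \<Psi> assume *: "finite A" "midconvex \<Psi>" "\<forall>s. \<Psi> (halve A s) = c * \<Psi> s"
    define e where "e = sign_avg A \<Psi>"
    define t where "t = sign_avg A (\<lambda>s. \<Psi> s powr \<theta>)"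
    have nn: "0 \<le> \<Psi> s" for s
      using * by (simp add: midconvex_def)
    have e0: "0 \<le> e" and t0: "0 \<le> t"
      by (simp_all add: e_def t_def sign_avg_nonneg nn)
    have "t \<le> (1 + K) * e powr \<theta> \<and> e powr \<theta> \<le> K3 * t"
    proof (cases "e = 0")
      \<comment> \<open>A vanishing mean cannot serve as a splitting level, but it forces \<Psi> to
        vanish at every sign vector.\<close>
      case True
      then have "t = 0"
        using sign_avg_eq_0D[OF *(1) nn] unfolding t_def e_def sign_avg_def
        by (auto intro!: sum.neutral)
      then show ?thesis by (simp add: True)
    next
      case False
      then have e: "0 < e" using e0 by simp
      let ?L = "2 ^ Suc m"
      have "t \<le> sign_avg A (\<lambda>s. e powr \<theta> + e powr (\<theta> - real ?L) * \<Psi> s ^ ?L)"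
        unfolding t_def by (intro sign_avg_mono powr_le_split nn e \<theta> L)
      also have "\<dots> = e powr \<theta> + e powr (\<theta> - real ?L) * sign_avg A (\<lambda>s. \<Psi> s ^ ?L)"
        by (simp only: sign_avg_add sign_avg_cmult sign_avg_const[OF *(1)])
      also have "\<dots> \<le> e powr \<theta> + e powr (\<theta> - real ?L) * (K * e ^ ?L)"
        unfolding e_def using * by (intro add_left_mono mult_left_mono K(2)) auto
      also have "e powr (\<theta> - real ?L) * (K * e ^ ?L) = K * e powr \<theta>"
        using e by (simp add: powr_diff powr_realpow[symmetric])
      finally have 1: "t \<le> (1 + K) * e powr \<theta>"
        by (simp add: algebra_simps)
      \<comment> \<open>With these two levels the outer ranges contribute at most e/4 each, by
        \<open>K2(2)\<close> in the case of the upper one, so half of e is left to the middle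
        range.\<close>
      define a where "a = e / 4"
      define b where "b = 4 * K2 * e"
      have ab: "0 < a" "0 < b"
        using e K2(1) by (auto simp: a_def b_def)
      have "e \<le> sign_avg A (\<lambda>s. a + (a powr (1 - \<theta>) + b powr (1 - \<theta>)) * \<Psi> s powr \<theta> + 1 / b * (\<Psi> s)\<^sup>2)"
        unfolding e_def by (intro sign_avg_mono le_powr_split nn ab)
      also have "\<dots> = a + (a powr (1 - \<theta>) + b powr (1 - \<theta>)) * t + 1 / b * sign_avg A (\<lambda>s. (\<Psi> s)\<^sup>2)"
        by (simp only: sign_avg_add sign_avg_cmult sign_avg_const[OF *(1)] t_def)
      also have "\<dots> \<le> a + (a powr (1 - \<theta>) + b powr (1 - \<theta>)) * t + 1 / b * (K2 * e\<^sup>2)"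
        unfolding e_def using * ab by (intro add_left_mono mult_left_mono K2(2)) auto
      also have "1 / b * (K2 * e\<^sup>2) = e / 4"
        using e K2(1) by (simp add: b_def power2_eq_square)
      also have "a powr (1 - \<theta>) + b powr (1 - \<theta>) = e powr (1 - \<theta>) * (K3 / 2)"
        using e K2(1) by (simp add: a_def b_def K3_def powr_mult powr_divide algebra_simps)
      finally have "e / 2 \<le> e powr (1 - \<theta>) * (K3 / 2) * t"
        by (simp add: a_def)
      then have "e powr (1 - \<theta>) * e powr \<theta> \<le> e powr (1 - \<theta>) * (K3 * t)"
        using e by (simp flip: powr_add)
      then have "e powr \<theta> \<le> K3 * t"
        using e by simp
      with 1 show ?thesis by simp
    qed
    moreover have "(1 + K) * e powr \<theta> \<le> max (1 + K) K3 * e powr \<theta>" "K3 * t \<le> max (1 + K) K3 * t"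
      using t0 by (auto intro!: mult_right_mono)
    ultimately show "sign_avg A (\<lambda>s. \<Psi> s powr \<theta>) \<le> max (1 + K) K3 * sign_avg A \<Psi> powr \<theta>"
      "sign_avg A \<Psi> powr \<theta> \<le> max (1 + K) K3 * sign_avg A (\<lambda>s. \<Psi> s powr \<theta>)"
      by (auto simp: e_def t_def)
  qed
qed

section \<open>Strong measurability and Bochner spaces\<close>

lemma strongly_measurable_borel:
  "strongly_measurable M f \<Longrightarrow> f \<in> borel_measurable M"
  unfolding strongly_measurable_def
  by (metis borel_measurable_LIMSEQ_metric borel_measurable_simple_function)

lemma strongly_measurable_simple_function:
  "simple_function M f \<Longrightarrow> strongly_measurable M f"
  unfolding strongly_measurable_def by (intro exI[of _ "\<lambda>_. f"]) auto

lemma strongly_measurable_const: "strongly_measurable M (\<lambda>_. c)"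
  by (rule strongly_measurable_simple_function) simp

lemma strongly_measurable_of_borel:
  fixes f :: "'a \<Rightarrow> 'b::{real_normed_vector, second_countable_topology}"
  assumes "f \<in> borel_measurable M"
  shows "strongly_measurable M f"
  using borel_measurable_implies_sequence_metric[OF assms, of 0]
  unfolding strongly_measurable_def by metis

lemma strongly_measurable_compose2:
  assumes "strongly_measurable M f" "strongly_measurable M g"
    and h: "\<And>U V u v. U \<longlonglongrightarrow> u \<Longrightarrow> V \<longlonglongrightarrow> v \<Longrightarrow> (\<lambda>i. h (U i) (V i)) \<longlonglongrightarrow> h u v"
  shows "strongly_measurable M (\<lambda>t. h (f t) (g t))"
proof -
  obtain s where s: "\<And>i. simple_function M (s i)" "\<And>t. t \<in> space M \<Longrightarrow> (\<lambda>i. s i t) \<longlonglongrightarrow> f t"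
    using assms(1) unfolding strongly_measurable_def by blast
  obtain r where r: "\<And>i. simple_function M (r i)" "\<And>t. t \<in> space M \<Longrightarrow> (\<lambda>i. r i t) \<longlonglongrightarrow> g t"
    using assms(2) unfolding strongly_measurable_def by blast
  show ?thesis
    unfolding strongly_measurable_def
  proof (intro exI conjI allI ballI)
    show "simple_function M (\<lambda>t. h (s i t) (r i t))" for i
      by (rule simple_function_compose2[OF s(1) r(1)])
    show "(\<lambda>i. h (s i t) (r i t)) \<longlonglongrightarrow> h (f t) (g t)" if "t \<in> space M" for t
      by (intro h s r that)
  qed
qed

lemma strongly_measurable_add:
  "strongly_measurable M f \<Longrightarrow> strongly_measurable M g \<Longrightarrow> strongly_measurable M (\<lambda>t. f t + g t)"
  by (rule strongly_measurable_compose2) (auto intro: tendsto_add)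

lemma strongly_measurable_diff:
  "strongly_measurable M f \<Longrightarrow> strongly_measurable M g \<Longrightarrow> strongly_measurable M (\<lambda>t. f t - g t)"
  by (rule strongly_measurable_compose2) (auto intro: tendsto_diff)

lemma strongly_measurable_mult:
  fixes f g :: "'a \<Rightarrow> 'b::real_normed_algebra"
  shows "strongly_measurable M f \<Longrightarrow> strongly_measurable M g \<Longrightarrow> strongly_measurable M (\<lambda>t. f t * g t)"
  by (rule strongly_measurable_compose2) (auto intro: tendsto_mult)

lemma strongly_measurable_scaleR:
  assumes "r \<in> borel_measurable M" "strongly_measurable M f"
  shows "strongly_measurable M (\<lambda>t. r t *\<^sub>R f t)"
  using strongly_measurable_of_borel[OF assms(1)] assms(2)
  by (rule strongly_measurable_compose2) (auto intro: tendsto_scaleR)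

lemma strongly_measurable_sum:
  assumes "\<And>i. i \<in> I \<Longrightarrow> strongly_measurable M (f i)"
  shows "strongly_measurable M (\<lambda>t. \<Sum>i\<in>I. f i t)"
  using assms
proof (induction I rule: infinite_finite_induct)
  case (insert i I)
  then have "strongly_measurable M (\<lambda>t. f i t + (\<Sum>i\<in>I. f i t))"
    by (intro strongly_measurable_add) auto
  then show ?case using insert.hyps by simp
qed (auto intro: strongly_measurable_const)

lemma strongly_measurable_prod:
  fixes f :: "'i \<Rightarrow> 'a \<Rightarrow> 'b::real_normed_field"
  assumes "\<And>i. i \<in> I \<Longrightarrow> strongly_measurable M (f i)"
  shows "strongly_measurable M (\<lambda>t. \<Prod>i\<in>I. f i t)"
  using assms
proof (induction I rule: infinite_finite_induct)
  case (insert i I)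
  then have "strongly_measurable M (\<lambda>t. f i t * (\<Prod>i\<in>I. f i t))"
    by (intro strongly_measurable_mult) auto
  then show ?case using insert.hyps by simp
qed (auto intro: strongly_measurable_const)

lemma strongly_measurable_comp:
  assumes f: "strongly_measurable M f" and \<phi>: "\<phi> \<in> N \<rightarrow>\<^sub>M M"
  shows "strongly_measurable N (\<lambda>t. f (\<phi> t))"
proof -
  obtain s where s: "\<And>i. simple_function M (s i)" "\<And>t. t \<in> space M \<Longrightarrow> (\<lambda>i. s i t) \<longlonglongrightarrow> f t"
    using f unfolding strongly_measurable_def by blast
  have "simple_function N (\<lambda>t. s i (\<phi> t))" for i
    by (rule simple_function_comp[OF \<phi> s(1)])
  moreover have "\<phi> t \<in> space M" if "t \<in> space N" for t
    using \<phi> that by (rule measurable_space)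
  ultimately show ?thesis
    unfolding strongly_measurable_def using s(2) by (intro exI[of _ "\<lambda>i t. s i (\<phi> t)"]) auto
qed

lemma strongly_measurable_cong:
  assumes "strongly_measurable M f" "\<And>t. t \<in> space M \<Longrightarrow> f t = g t"
  shows "strongly_measurable M g"
  using assms unfolding strongly_measurable_def by metis

text \<open>Pettis' characterization is what makes strong measurability stable under pointwise limits.\<close>

lemma strongly_measurable_separable:
  assumes "strongly_measurable M f"
  shows "\<exists>D. countable D \<and> f ` space M \<subseteq> closure D"
proof -
  obtain s where s: "\<And>i. simple_function M (s i)" "\<And>t. t \<in> space M \<Longrightarrow> (\<lambda>i. s i t) \<longlonglongrightarrow> f t"
    using assms unfolding strongly_measurable_def by blast
  show ?thesis
  proof (intro exI conjI subsetI)
    show "countable (\<Union>i. s i ` space M)"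
      by (rule countable_UN) (auto intro: countable_finite simple_functionD(1)[OF s(1)])
    fix y assume "y \<in> f ` space M"
    then obtain t where t: "t \<in> space M" "y = f t" by auto
    then show "y \<in> closure (\<Union>i. s i ` space M)"
      unfolding closure_sequential using s(2)[OF t(1)] by (intro exI[of _ "\<lambda>i. s i t"]) auto
  qed
qed

text \<open>The i-th approximant selects a point nearest to f t among the first i + 1 points of an
  enumeration of \<open>D\<close>. It takes finitely many values, and its distance to f t tends to 0
  because f t lies in the closure of \<open>D\<close>.\<close>

lemma strongly_measurable_if_separable:
  fixes f :: "'a \<Rightarrow> 'b::real_normed_vector"
  assumes [measurable]: "f \<in> borel_measurable M" and D: "countable D" "f ` space M \<subseteq> closure D"
  shows "strongly_measurable M f"
proof (cases "D = {}")
  case True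
  then have "space M = {}" using D by simp
  then show ?thesis
    by (intro strongly_measurable_cong[OF strongly_measurable_const[of M 0]]) simp
next
  case False
  define x where "x = from_nat_into D"
  have x: "range x = D"
    unfolding x_def using False D(1) by (rule range_from_nat_into)
  define s where "s = rec_nat (\<lambda>t. x 0)
    (\<lambda>i s t. if dist (f t) (x (Suc i)) < dist (f t) (s t) then x (Suc i) else s t)"
  have s0: "s 0 = (\<lambda>t. x 0)" and sS: "s (Suc i) =
      (\<lambda>t. if dist (f t) (x (Suc i)) < dist (f t) (s i t) then x (Suc i) else s i t)" for i
    unfolding s_def by simp_all
  \<comment> \<open>Measurability of the distance is carried through the induction because the next
    selection is a case distinction on it.\<close>
  have s: "simple_function M (s i) \<and> (\<lambda>t. dist (f t) (s i t)) \<in> borel_measurable M \<and>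
      (\<forall>t. \<forall>j\<le>i. dist (f t) (s i t) \<le> dist (f t) (x j))" for i
  proof (induction i)
    case 0
    have "(\<lambda>t. dist (f t) (x 0)) \<in> borel_measurable M"
      by (rule measurable_compose[OF _ borel_measurable_continuous_onI])
         (auto intro: continuous_intros)
    then show ?case by (simp add: s0)
  next
    case (Suc i)
    have [measurable]: "(\<lambda>t. dist (f t) (x (Suc i))) \<in> borel_measurable M"
      by (rule measurable_compose[OF _ borel_measurable_continuous_onI])
         (auto intro: continuous_intros)
    have [measurable]: "(\<lambda>t. dist (f t) (s i t)) \<in> borel_measurable M"
      using Suc by blast
    have "simple_function M (s (Suc i))"
      unfolding sS using Suc by (intro simple_function_If) auto
    moreover have e: "(\<lambda>t. dist (f t) (s (Suc i) t)) =
        (\<lambda>t. min (dist (f t) (x (Suc i))) (dist (f t) (s i t)))"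
      by (auto simp: sS)
    moreover have "(\<lambda>t. dist (f t) (s (Suc i) t)) \<in> borel_measurable M"
      unfolding e by measurable
    moreover have "dist (f t) (s (Suc i) t) \<le> dist (f t) (x j)" if "j \<le> Suc i" for t j
      using Suc that fun_cong[OF e, of t] by (cases "j = Suc i") (auto intro: min.coboundedI2)
    ultimately show ?case by blast
  qed
  have "(\<lambda>i. s i t) \<longlonglongrightarrow> f t" if t: "t \<in> space M" for t
  proof (rule LIMSEQ_I)
    fix r :: real assume "0 < r"
    moreover have "f t \<in> closure D"
      using D(2) t by blast
    ultimately obtain y where "y \<in> D" "dist y (f t) < r"
      unfolding closure_approachable by blast
    then obtain j where j: "dist (f t) (x j) < r"
      using x by (auto simp: dist_commute)
    have "norm (s i t - f t) < r" if "j \<le> i" for i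
      using s[of i] that j by (smt (verit) dist_norm norm_minus_commute)
    then show "\<exists>n0. \<forall>n\<ge>n0. norm (s n t - f t) < r" by blast
  qed
  then show ?thesis
    unfolding strongly_measurable_def using s by blast
qed

text \<open>A diagonal choice among the simple approximants of the F i need not converge pointwise.
  Borel measurability and separability of the range do pass to the limit: the union of countable
  sets that serve for the individual F i serves for f.\<close>

lemma strongly_measurable_LIMSEQ:
  fixes f :: "'a \<Rightarrow> 'b::real_normed_vector"
  assumes F: "\<And>i. strongly_measurable M (F i)"
    and lim: "\<And>t. t \<in> space M \<Longrightarrow> (\<lambda>i. F i t) \<longlonglongrightarrow> f t"
  shows "strongly_measurable M f"
proof -
  have "f \<in> borel_measurable M"
    by (rule borel_measurable_LIMSEQ_metric[OF strongly_measurable_borel[OF F] lim])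
  moreover obtain D where D: "\<And>i. countable (D i)" "\<And>i. F i ` space M \<subseteq> closure (D i)"
    using strongly_measurable_separable[OF F] by metis
  moreover have "f ` space M \<subseteq> closure (\<Union>i. D i)"
  proof
    fix y assume "y \<in> f ` space M"
    then obtain t where t: "t \<in> space M" "y = f t" by auto
    have "F i t \<in> closure (\<Union>i. D i)" for i
      using D(2)[of i] t(1) closure_mono[of "D i" "\<Union>i. D i"] by blast
    then show "y \<in> closure (\<Union>i. D i)"
      unfolding t(2) by (rule closed_sequentially[OF closed_closure _ lim[OF t(1)]])
  qed
  ultimately show ?thesis
    using strongly_measurable_if_separable[of f M "\<Union>i. D i"] by auto
qed

section \<open>Scalar multiplication as a bounded bilinear map\<close>

lemma normed_scaling_bounded_bilinear:
  assumes "normed_scaling sc"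
  shows "bounded_bilinear sc"
proof
  interpret vector_space sc
    using assms by (simp add: normed_scaling_def)
  have r: "sc (of_real r) x = r *\<^sub>R x" for r x
    using assms by (simp add: normed_scaling_def)
  show "sc (a + b) x = sc a x + sc b x" "sc a (x + y) = sc a x + sc a y" for a b x y
    by (simp_all add: scale_left_distrib scale_right_distrib)
  show "sc (q *\<^sub>R a) x = q *\<^sub>R sc a x" for q a x
    unfolding scaleR_conv_of_real[of q a] by (simp flip: scale_scale add: r)
  show "sc a (q *\<^sub>R x) = q *\<^sub>R sc a x" for q a x
    by (simp add: r[symmetric] scale_left_commute)
  show "\<exists>K. \<forall>a b. norm (sc a b) \<le> norm a * norm b * K"
    using assms by (intro exI[of _ 1]) (simp add: normed_scaling_def)
qed

lemma normed_scaling_norm: "normed_scaling sc \<Longrightarrow> norm (sc a x) = norm a * norm x"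
  by (simp add: normed_scaling_def)

lemma normed_scaling_of_real: "normed_scaling sc \<Longrightarrow> sc (of_real r) x = r *\<^sub>R x"
  by (simp add: normed_scaling_def)

lemma normed_scaling_scale: "normed_scaling sc \<Longrightarrow> sc a (sc b x) = sc (a * b) x"
  by (simp add: normed_scaling_def vector_space.vector_space_assms(3))

lemma strongly_measurable_scaling:
  assumes "normed_scaling sc" "strongly_measurable M h" "strongly_measurable M w"
  shows "strongly_measurable M (\<lambda>t. sc (h t) (w t))"
  using assms(2,3)
  by (rule strongly_measurable_compose2)
     (auto intro: bounded_bilinear.tendsto[OF normed_scaling_bounded_bilinear[OF assms(1)]])

text \<open>The p-th power of the norm. It turns Fubini's theorem into an identity without roots,
  and a triangle inequality with the factor 2^p is enough for every limit argument below.\<close>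

definition Lp_int :: "real \<Rightarrow> 'a measure \<Rightarrow> ('a \<Rightarrow> 'b::real_normed_vector) \<Rightarrow> real" where
  "Lp_int p M f = (\<integral>t. norm (f t) powr p \<partial>M)"

lemma Lp_norm_eq_Lp_int: "Lp_norm p M f = Lp_int p M f powr (1 / p)"
  by (simp add: Lp_norm_def Lp_int_def)

lemma Lp_int_nonneg [simp]: "0 \<le> Lp_int p M f"
  by (simp add: Lp_int_def)

lemma Lp_norm_nonneg [simp]: "0 \<le> Lp_norm p M f"
  by (simp add: Lp_norm_eq_Lp_int)

lemma Lp_norm_powr: "0 < p \<Longrightarrow> Lp_norm p M f powr p = Lp_int p M f"
  by (simp add: Lp_norm_eq_Lp_int powr_powr)

lemma Lp_spaceD:
  assumes "f \<in> Lp_space p M"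
  shows "strongly_measurable M f" "f \<in> borel_measurable M" "integrable M (\<lambda>t. norm (f t) powr p)"
  using assms by (auto simp: Lp_space_def strongly_measurable_borel)

lemma Lp_spaceI:
  assumes "strongly_measurable M f" "integrable M g" "AE t in M. norm (f t) powr p \<le> g t"
  shows "f \<in> Lp_space p M"
proof -
  have [measurable]: "f \<in> borel_measurable M"
    using assms(1) by (rule strongly_measurable_borel)
  have "integrable M (\<lambda>t. norm (f t) powr p)"
    by (rule Bochner_Integration.integrable_bound[OF assms(2)]) (use assms(3) in auto)
  then show ?thesis using assms(1) by (simp add: Lp_space_def)
qed

lemma Lp_int_cong_AE:
  assumes "f \<in> Lp_space p M" "g \<in> Lp_space p M" "AE t in M. f t = g t"
  shows "Lp_int p M f = Lp_int p M g"
proof -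
  have [measurable]: "f \<in> borel_measurable M" "g \<in> borel_measurable M"
    using assms(1,2) by (auto dest: Lp_spaceD)
  show ?thesis
    unfolding Lp_int_def using assms(3) by (intro integral_cong_AE) auto
qed

lemma Lp_int_eq_0_iff:
  assumes "f \<in> Lp_space p M"
  shows "Lp_int p M f = 0 \<longleftrightarrow> (AE t in M. f t = 0)"
  unfolding Lp_int_def
  by (subst integral_nonneg_eq_0_iff_AE[OF Lp_spaceD(3)[OF assms]]) auto

section \<open>Linear structure of the Bochner spaces\<close>

lemma powr_add_le:
  fixes a b p :: real
  assumes "0 \<le> a" "0 \<le> b" "0 < p"
  shows "(a + b) powr p \<le> 2 powr p * (a powr p + b powr p)"
proof -
  have "(a + b) powr p \<le> (2 * max a b) powr p"
    using assms by (intro powr_mono2) auto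
  also have "\<dots> = 2 powr p * max a b powr p"
    using assms by (simp add: powr_mult)
  also have "max a b powr p \<le> a powr p + b powr p"
    by (simp add: max_def)
  finally show ?thesis by simp
qed

lemma norm_add_powr_le:
  assumes "0 < p"
  shows "norm (x + y) powr p \<le> 2 powr p * (norm x powr p + norm y powr p)"
proof -
  have "norm (x + y) powr p \<le> (norm x + norm y) powr p"
    using assms by (intro powr_mono2 norm_triangle_ineq) auto
  also have "\<dots> \<le> 2 powr p * (norm x powr p + norm y powr p)"
    using assms by (intro powr_add_le) auto
  finally show ?thesis .
qed

lemma Lp_space_add:
  assumes f: "f \<in> Lp_space p M" and g: "g \<in> Lp_space p M" and p: "0 < p"
  shows "(\<lambda>t. f t + g t) \<in> Lp_space p M"
    and "Lp_int p M (\<lambda>t. f t + g t) \<le> 2 powr p * (Lp_int p M f + Lp_int p M g)"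
proof -
  note [simp] = Lp_spaceD(3)[OF f] Lp_spaceD(3)[OF g]
  show 1: "(\<lambda>t. f t + g t) \<in> Lp_space p M"
  proof (rule Lp_spaceI)
    show "integrable M (\<lambda>t. 2 powr p * (norm (f t) powr p + norm (g t) powr p))"
      by simp
  qed (use f g p in \<open>auto intro: strongly_measurable_add norm_add_powr_le dest: Lp_spaceD\<close>)
  have "Lp_int p M (\<lambda>t. f t + g t) \<le> (\<integral>t. 2 powr p * (norm (f t) powr p + norm (g t) powr p) \<partial>M)"
    unfolding Lp_int_def using Lp_spaceD(3)[OF 1] p
    by (intro integral_mono norm_add_powr_le) auto
  then show "Lp_int p M (\<lambda>t. f t + g t) \<le> 2 powr p * (Lp_int p M f + Lp_int p M g)"
    by (simp add: Lp_int_def)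
qed

lemma Lp_space_scaling:
  assumes f: "f \<in> Lp_space p M" and sc: "normed_scaling sc"
  shows "(\<lambda>t. sc a (f t)) \<in> Lp_space p M"
    and "Lp_int p M (\<lambda>t. sc a (f t)) = norm a powr p * Lp_int p M f"
proof -
  show "(\<lambda>t. sc a (f t)) \<in> Lp_space p M"
  proof (rule Lp_spaceI)
    show "integrable M (\<lambda>t. norm a powr p * norm (f t) powr p)"
      using Lp_spaceD(3)[OF f] by simp
    show "strongly_measurable M (\<lambda>t. sc a (f t))"
      by (rule strongly_measurable_scaling[OF sc strongly_measurable_const Lp_spaceD(1)[OF f]])
  qed (use sc in \<open>simp add: normed_scaling_norm powr_mult\<close>)
  show "Lp_int p M (\<lambda>t. sc a (f t)) = norm a powr p * Lp_int p M f"
    using sc by (simp add: Lp_int_def normed_scaling_norm powr_mult)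
qed

lemmas Lp_space_scaleR = Lp_space_scaling[OF _ normed_scaling_scaleR]

lemma Lp_space_diff:
  assumes f: "f \<in> Lp_space p M" and g: "g \<in> Lp_space p M" and p: "0 < p"
  shows "(\<lambda>t. f t - g t) \<in> Lp_space p M"
    and "Lp_int p M (\<lambda>t. f t - g t) \<le> 2 powr p * (Lp_int p M f + Lp_int p M g)"
  using Lp_space_add[OF f Lp_space_scaleR(1)[OF g, of "-1"] p] Lp_space_scaleR(2)[OF g, of "-1"]
  by auto

lemma Lp_space_zero: "(\<lambda>_. 0) \<in> Lp_space p M"
  by (rule Lp_spaceI[of _ _ "\<lambda>_. 0"]) (auto intro: strongly_measurable_const)

lemma Lp_space_sum:
  assumes "\<And>i. i \<in> I \<Longrightarrow> f i \<in> Lp_space p M" "0 < p"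
  shows "(\<lambda>t. \<Sum>i\<in>I. f i t) \<in> Lp_space p M"
  using assms(1)
proof (induction I rule: infinite_finite_induct)
  case (insert i I)
  then have "(\<lambda>t. f i t + (\<Sum>i\<in>I. f i t)) \<in> Lp_space p M"
    using assms(2) by (intro Lp_space_add) auto
  then show ?case using insert.hyps by simp
qed (auto intro: Lp_space_zero)

section \<open>Completeness of the Bochner spaces\<close>

lemma AE_summable_of_integral:
  fixes f :: "nat \<Rightarrow> 'a \<Rightarrow> real"
  assumes f: "\<And>i. integrable M (f i)" "\<And>i t. 0 \<le> f i t" and s: "summable (\<lambda>i. \<integral>t. f i t \<partial>M)"
  shows "AE t in M. summable (\<lambda>i. f i t)"
    and "integrable M (\<lambda>t. enn2real (\<Sum>i. ennreal (f i t)))"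
    and "AE t in M. (\<Sum>i. ennreal (f i t)) < \<top>"
proof -
  have [measurable]: "f i \<in> borel_measurable M" for i
    using f(1) by auto
  have "(\<integral>\<^sup>+t. (\<Sum>i. ennreal (f i t)) \<partial>M) = (\<Sum>i. \<integral>\<^sup>+t. ennreal (f i t) \<partial>M)"
    by (rule nn_integral_suminf) auto
  also have "\<dots> = (\<Sum>i. ennreal (\<integral>t. f i t \<partial>M))"
    using f by (simp add: nn_integral_eq_integral)
  also have "\<dots> < \<top>"
    using s f(2) by (simp add: suminf_ennreal2 ennreal_less_top)
  finally have fin: "(\<integral>\<^sup>+t. (\<Sum>i. ennreal (f i t)) \<partial>M) < \<top>" .
  have "AE t in M. (\<Sum>i. ennreal (f i t)) \<noteq> \<infinity>"
    by (rule nn_integral_PInf_AE) (use fin in auto)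
  then show 1: "AE t in M. (\<Sum>i. ennreal (f i t)) < \<top>"
    by (simp add: less_top[symmetric])
  then show "AE t in M. summable (\<lambda>i. f i t)"
    by (rule eventually_mono) (use f(2) in \<open>auto intro!: summable_suminf_not_top\<close>)
  \<comment> \<open>Summing in \<open>ennreal\<close> gives a total function;
    \<open>enn2real\<close> sends the value \<infinity>, attained on a null set only, to 0.\<close>
  show "integrable M (\<lambda>t. enn2real (\<Sum>i. ennreal (f i t)))"
  proof (rule integrableI_bounded)
    have "(\<integral>\<^sup>+t. ennreal (norm (enn2real (\<Sum>i. ennreal (f i t)))) \<partial>M) \<le> (\<integral>\<^sup>+t. (\<Sum>i. ennreal (f i t)) \<partial>M)"
      by (intro nn_integral_mono) (simp add: ennreal_enn2real_if)
    with fin show "(\<integral>\<^sup>+t. ennreal (norm (enn2real (\<Sum>i. ennreal (f i t)))) \<partial>M) < \<infinity>"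
      by (simp add: le_less_trans)
  qed measurable
qed

lemma geometric_Cauchy_bound:
  fixes u :: "nat \<Rightarrow> 'b::banach"
  assumes u: "\<And>i. norm (u (Suc i) - u i) \<le> a * (1/2) ^ i"
  shows "\<exists>L. u \<longlonglongrightarrow> L \<and> (\<forall>i. norm (L - u i) \<le> 2 * a * (1/2) ^ i)"
proof -
  have a: "0 \<le> a"
    using order_trans[OF norm_ge_zero u[of 0]] by simp
  \<comment> \<open>Keeping the subtracted tail makes the telescoping induction close with
    equality.\<close>
  have b: "norm (u (i + j) - u i) \<le> 2 * a * ((1/2) ^ i - (1/2) ^ (i + j))" for i j
  proof (induction j)
    case (Suc j)
    have "norm (u (i + Suc j) - u i) \<le> norm (u (Suc (i + j)) - u (i + j)) + norm (u (i + j) - u i)"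
      using norm_triangle_ineq[of "u (Suc (i + j)) - u (i + j)" "u (i + j) - u i"] by simp
    also have "\<dots> \<le> a * (1/2) ^ (i + j) + 2 * a * ((1/2) ^ i - (1/2) ^ (i + j))"
      by (intro add_mono u Suc)
    also have "\<dots> = 2 * a * ((1/2) ^ i - (1/2) ^ (i + Suc j))"
      by (simp add: algebra_simps)
    finally show ?case .
  qed simp
  have b': "norm (u j - u i) \<le> 2 * a * (1/2) ^ i" if "i \<le> j" for i j
  proof -
    have "norm (u j - u i) \<le> 2 * a * ((1/2) ^ i - (1/2) ^ j)"
      using b[of i "j - i"] that by simp
    also have "\<dots> \<le> 2 * a * (1/2) ^ i"
      using a by (intro mult_left_mono) auto
    finally show ?thesis .
  qed
  have lim0: "(\<lambda>i. 2 * a * (1/2) ^ i) \<longlonglongrightarrow> 0"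
    by (intro tendsto_mult_right_zero LIMSEQ_power_zero) simp
  have "Cauchy u"
  proof (rule CauchyI')
    fix e :: real assume "0 < e"
    then have "eventually (\<lambda>i. 2 * a * (1/2) ^ i < e) sequentially"
      using lim0 by (simp add: order_tendsto_iff)
    then obtain i0 where i0: "\<And>i. i0 \<le> i \<Longrightarrow> 2 * a * (1/2) ^ i < e"
      by (auto simp: eventually_sequentially)
    have "dist (u m) (u n) < e" if "i0 \<le> m" "m < n" for m n
      using le_less_trans[OF b'[of m n] i0[of m]] that by (simp add: dist_norm norm_minus_commute)
    then show "\<exists>M. \<forall>m\<ge>M. \<forall>n>m. dist (u m) (u n) < e"
      by blast
  qed
  then obtain L where L: "u \<longlonglongrightarrow> L"
    by (meson Cauchy_convergent convergent_def)
  have "norm (L - u i) \<le> 2 * a * (1/2) ^ i" for i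
  proof (rule Lim_bounded)
    show "(\<lambda>j. norm (u j - u i)) \<longlonglongrightarrow> norm (L - u i)"
      by (intro tendsto_intros L)
    show "\<forall>j\<ge>i. norm (u j - u i) \<le> 2 * a * (1/2) ^ i"
      using b' by blast
  qed
  then show ?thesis using L by blast
qed

text \<open>
  The weights \<open>2 powr p\<close> give pointwise geometric convergence almost everywhere, so the infinite
  Minkowski inequality is not needed.
\<close>

lemma Lp_complete:
  fixes g :: "nat \<Rightarrow> 'a \<Rightarrow> 'b::banach"
  assumes p: "0 < p" and g: "\<And>i. g i \<in> Lp_space p M"
    and K: "\<And>i. Lp_int p M (\<lambda>t. g (Suc i) t - g i t) \<le> K * (4 powr - p) ^ i"
  shows "\<exists>G K'. G \<in> Lp_space p M \<and> (\<forall>i. Lp_int p M (\<lambda>t. G t - g i t) \<le> K' * (2 powr - p) ^ i)"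
proof -
  \<comment> \<open>The weight 2^(p i) against the rate 4^(-p i) leaves integrals of size 2^(-p i),
    which are summable. Since the sum dominates each term, its p-th root times 2^(-i) bounds the
    i-th increment.\<close>
  define D where "D i t = (2 powr p) ^ i * norm (g (Suc i) t - g i t) powr p" for i t
  define H where "H t = (\<Sum>i. ennreal (D i t))" for t
  define h where "h t = enn2real (H t)" for t
  have D_int: "integrable M (D i)" for i
    using Lp_spaceD(3)[OF Lp_space_diff(1)[OF g g p]] by (auto simp: D_def[abs_def])
  have [measurable]: "D i \<in> borel_measurable M" for i
    using D_int by auto
  have D_nn: "0 \<le> D i t" for i t
    by (simp add: D_def)
  have "(\<integral>t. D i t \<partial>M) \<le> K * (2 powr - p) ^ i" for i
  proof -
    have "(\<integral>t. D i t \<partial>M) = (2 powr p) ^ i * Lp_int p M (\<lambda>t. g (Suc i) t - g i t)"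
      by (simp add: D_def Lp_int_def)
    also have "\<dots> \<le> (2 powr p) ^ i * (K * (4 powr - p) ^ i)"
      by (intro mult_left_mono K) auto
    also have "\<dots> = K * (2 powr p * 4 powr - p) ^ i"
      by (simp add: power_mult_distrib)
    also have "2 powr p * (4::real) powr - p = 2 powr - p"
    proof -
      have "(4::real) powr - p = 2 powr (- p - p)"
        using powr_powr[of 2 2 "- p"] by (simp add: powr_numeral)
      then show ?thesis by (simp flip: powr_add)
    qed
    finally show ?thesis .
  qed
  moreover have sg: "summable (\<lambda>i. K * (2 powr - p) ^ i)"
    using powr_less_mono[of "- p" 0 2] p by (intro summable_mult summable_geometric) simp
  moreover have "0 \<le> (\<integral>t. D i t \<partial>M)" for i
    by (simp add: D_nn)
  ultimately have s: "summable (\<lambda>i. \<integral>t. D i t \<partial>M)"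
    by (intro summable_comparison_test'[OF sg, of 0]) simp
  note fin = AE_summable_of_integral[OF D_int D_nn s]
  define S where "S = {t \<in> space M. H t < \<top>}"
  have [measurable]: "S \<in> sets M"
    unfolding S_def H_def by measurable
  have AE_S: "AE t in M. t \<in> S"
    using fin(3) AE_space by eventually_elim (simp add: S_def H_def)
  define a where "a t = h t powr (1 / p)" for t
  have bd: "norm (g (Suc i) t - g i t) \<le> a t * (1/2) ^ i" if t: "t \<in> S" for i t
  proof -
    have "ennreal (D i t) \<le> H t"
      unfolding H_def using sum_le_suminf[of "\<lambda>i. ennreal (D i t)" "{i}"] by auto
    then have "D i t \<le> h t"
      unfolding h_def using t D_nn[of i t] by (auto simp: S_def enn2real_mono intro: enn2real_leI
        dest: enn2real_mono)
    then have "(2 powr p) ^ i * norm (g (Suc i) t - g i t) powr p \<le> h t"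
      by (simp add: D_def)
    also have "(2 powr p) ^ i = (2 ^ i) powr p"
      by (simp add: powr_realpow[symmetric] powr_powr mult.commute)
    also have "(2 ^ i) powr p * norm (g (Suc i) t - g i t) powr p = (2 ^ i * norm (g (Suc i) t - g i t)) powr p"
      by (simp add: powr_mult)
    finally have "((2 ^ i * norm (g (Suc i) t - g i t)) powr p) powr (1 / p) \<le> a t"
      unfolding a_def using p by (intro powr_mono2) auto
    then have "2 ^ i * norm (g (Suc i) t - g i t) \<le> a t"
      using p by (simp add: powr_powr)
    then show ?thesis by (simp add: field_simps power_divide)
  qed
  \<comment> \<open>The limit is known to exist on \<open>S\<close>, a set of full measure. With the
    default 0 elsewhere, G is the limit at every point of the functions g i cut off to
    \<open>S\<close>, so strong measurability follows.\<close>
  define G where "G t = (if t \<in> S then lim (\<lambda>i. g i t) else 0)" for t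
  have G: "(\<lambda>i. g i t) \<longlonglongrightarrow> G t" "norm (G t - g i t) \<le> 2 * a t * (1/2) ^ i" if t: "t \<in> S" for i t
    using geometric_Cauchy_bound[of "\<lambda>i. g i t" "a t", OF bd[OF t]] t
    by (auto simp: G_def dest: limI)
  have G_sm: "strongly_measurable M G"
  proof (rule strongly_measurable_LIMSEQ)
    show "strongly_measurable M (\<lambda>t. indicat_real S t *\<^sub>R g i t)" for i
      using g by (intro strongly_measurable_scaleR) (auto dest: Lp_spaceD)
    show "(\<lambda>i. indicat_real S t *\<^sub>R g i t) \<longlonglongrightarrow> G t" for t
      using G(1)[of t] by (cases "t \<in> S") (auto simp: G_def)
  qed
  have h_int: "integrable M h"
    unfolding h_def[abs_def] H_def using fin(2) by simp
  have bd2: "AE t in M. norm (G t - g i t) powr p \<le> 2 powr p * (2 powr - p) ^ i * h t" for i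
    using AE_S
  proof eventually_elim
    fix t assume t: "t \<in> S"
    have "norm (G t - g i t) powr p \<le> (2 * a t * (1/2) ^ i) powr p"
      using p by (intro powr_mono2 G(2) t) auto
    also have "\<dots> = 2 powr p * (a t powr p) * ((1/2) ^ i) powr p"
      by (simp add: powr_mult a_def)
    also have "a t powr p = h t"
      using p by (simp add: a_def powr_powr h_def)
    also have "((1/2) ^ i :: real) powr p = (2 powr - p) ^ i"
      by (simp add: powr_realpow[symmetric] powr_powr mult.commute powr_minus_divide powr_divide power_divide)
    finally show "norm (G t - g i t) powr p \<le> 2 powr p * (2 powr - p) ^ i * h t"
      by (simp add: mult_ac)
  qed
  have G_diff: "(\<lambda>t. G t - g i t) \<in> Lp_space p M" for i
  proof (rule Lp_spaceI[OF _ _ bd2])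
    show "strongly_measurable M (\<lambda>t. G t - g i t)"
      using G_sm g by (intro strongly_measurable_diff) (auto dest: Lp_spaceD)
  qed (use h_int in simp)
  \<comment> \<open>Integrability comes from G = (G - g 0) + g 0, both terms being in the
    space.\<close>
  have "G \<in> Lp_space p M"
    using Lp_space_add(1)[OF G_diff[of 0] g[of 0] p] by simp
  moreover have "Lp_int p M (\<lambda>t. G t - g i t) \<le> 2 powr p * integral\<^sup>L M h * (2 powr - p) ^ i" for i
  proof -
    have "Lp_int p M (\<lambda>t. G t - g i t) \<le> (\<integral>t. 2 powr p * (2 powr - p) ^ i * h t \<partial>M)"
      unfolding Lp_int_def using Lp_spaceD(3)[OF G_diff] h_int by (intro integral_mono_AE bd2) auto
    then show ?thesis by (simp add: mult_ac)
  qed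
  ultimately show ?thesis by blast
qed

section \<open>Density of simple functions\<close>

lemma Lp_simple_approx:
  assumes p: "0 < p" and f: "f \<in> Lp_space p M"
  shows "\<exists>s. (\<forall>i. simple_function M (s i) \<and> s i \<in> Lp_space p M) \<and> (\<lambda>i. Lp_int p M (\<lambda>t. s i t - f t)) \<longlonglongrightarrow> 0"
proof -
  have [measurable]: "f \<in> borel_measurable M" and f_int: "integrable M (\<lambda>t. norm (f t) powr p)"
    using f by (auto dest: Lp_spaceD)
  obtain s where s: "\<And>i. simple_function M (s i)" "\<And>t. t \<in> space M \<Longrightarrow> (\<lambda>i. s i t) \<longlonglongrightarrow> f t"
    using Lp_spaceD(1)[OF f] unfolding strongly_measurable_def by blast
  obtain r :: "nat \<Rightarrow> 'a \<Rightarrow> real" where r: "\<And>i. simple_function M (r i)" "\<And>t. t \<in> space M \<Longrightarrow> (\<lambda>i. r i t) \<longlonglongrightarrow> norm (f t)"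
    "\<And>i t. t \<in> space M \<Longrightarrow> norm (r i t) \<le> 2 * norm (norm (f t))"
  proof -
    have "(\<lambda>t. norm (f t)) \<in> borel_measurable M" by measurable
    from borel_measurable_implies_sequence_metric[OF this, of 0] obtain F where
      "\<forall>i. simple_function M (F i)" "\<forall>t\<in>space M. (\<lambda>i. F i t) \<longlonglongrightarrow> norm (f t)"
      "\<forall>i. \<forall>t\<in>space M. dist (F i t) 0 \<le> 2 * dist (norm (f t)) 0"
      by blast
    then show ?thesis
      by (intro that[of F]) auto
  qed
  \<comment> \<open>The approximants \<open>s i\<close> need not be dominated by f. They are cut off
    by comparison with simple approximants \<open>r i\<close> of the norm of f, which keeps the
    result simple and bounds it by 4 times that norm. Where f t = 0 the cut-off gives 0; elsewhere
    it is eventually inactive.\<close>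
  define s' where "s' i t = (if norm (s i t) \<le> 2 * \<bar>r i t\<bar> then s i t else 0)" for i t
  have s'_simple: "simple_function M (s' i)" for i
    unfolding s'_def[abs_def]
    by (rule simple_function_compose2[of M "s i" "r i" "\<lambda>x y. if norm x \<le> 2 * \<bar>y\<bar> then x else 0"]) (rule s r)+
  have s'_lim: "(\<lambda>i. s' i t) \<longlonglongrightarrow> f t" if t: "t \<in> space M" for t
  proof (cases "f t = 0")
    case True
    then have "s' i t = 0" for i
      using r(3)[OF t, of i] by (simp add: s'_def)
    then show ?thesis using True by simp
  next
    case False
    have "(\<lambda>i. 2 * \<bar>r i t\<bar> - norm (s i t)) \<longlonglongrightarrow> 2 * \<bar>norm (f t)\<bar> - norm (f t)"
      by (intro tendsto_intros s r t)
    then have "eventually (\<lambda>i. 0 < 2 * \<bar>r i t\<bar> - norm (s i t)) sequentially"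
      using False by (intro order_tendstoD(1)) auto
    then have "eventually (\<lambda>i. s' i t = s i t) sequentially"
      by eventually_elim (simp add: s'_def)
    then show ?thesis
      using s(2)[OF t] by (simp add: filterlim_cong)
  qed
  have s'_le: "norm (s' i t) \<le> 4 * norm (f t)" if t: "t \<in> space M" for i t
    using r(3)[OF t, of i] by (auto simp: s'_def)
  have s'_Lp: "s' i \<in> Lp_space p M" for i
  proof (rule Lp_spaceI)
    show "integrable M (\<lambda>t. 4 powr p * norm (f t) powr p)"
      using f_int by simp
    show "AE t in M. norm (s' i t) powr p \<le> 4 powr p * norm (f t) powr p"
      using s'_le p by (intro AE_I2) (simp flip: powr_mult add: powr_mono2)
  qed (intro strongly_measurable_simple_function s'_simple)
  have [measurable]: "(\<lambda>t. norm (s' i t - f t)) \<in> borel_measurable M" for i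
    using Lp_spaceD(2)[OF Lp_space_diff(1)[OF s'_Lp f p]] by measurable
  have "(\<lambda>i. Lp_int p M (\<lambda>t. s' i t - f t)) \<longlonglongrightarrow> (\<integral>t. 0 \<partial>M)"
    unfolding Lp_int_def
  proof (rule integral_dominated_convergence)
    show "integrable M (\<lambda>t. 5 powr p * norm (f t) powr p)"
      using f_int by simp
    show "AE t in M. (\<lambda>i. norm (s' i t - f t) powr p) \<longlonglongrightarrow> 0"
    proof (intro AE_I2)
      fix t assume "t \<in> space M"
      then have "(\<lambda>i. norm (s' i t - f t)) \<longlonglongrightarrow> 0"
        using s'_lim by (simp add: LIM_zero_iff tendsto_norm_zero_iff)
      then show "(\<lambda>i. norm (s' i t - f t) powr p) \<longlonglongrightarrow> 0"
        using tendsto_zero_powrI[of _ sequentially "\<lambda>_. p" p] p by auto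
    qed
    show "AE t in M. norm (norm (s' i t - f t) powr p) \<le> 5 powr p * norm (f t) powr p" for i
    proof (intro AE_I2)
      fix t assume "t \<in> space M"
      then have "norm (s' i t - f t) \<le> 5 * norm (f t)"
        using s'_le[of t i] norm_triangle_ineq4[of "s' i t" "f t"] by linarith
      then show "norm (norm (s' i t - f t) powr p) \<le> 5 powr p * norm (f t) powr p"
        using p by (simp flip: powr_mult add: powr_mono2)
    qed
  qed auto
  then show ?thesis using s'_simple s'_Lp by (intro exI[of _ s']) auto
qed

lemma Lp_space_indicator:
  assumes "A \<in> sets M" "emeasure M A < \<infinity>" and p: "0 < p"
  shows "(\<lambda>t. indicat_real A t *\<^sub>R x) \<in> Lp_space p M"
proof (rule Lp_spaceI)
  show "integrable M (\<lambda>t. indicat_real A t * norm x powr p)"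
    using assms by simp
  show "strongly_measurable M (\<lambda>t. indicat_real A t *\<^sub>R x)"
    using assms by (intro strongly_measurable_scaleR strongly_measurable_const) auto
  show "AE t in M. norm (indicat_real A t *\<^sub>R x) powr p \<le> indicat_real A t * norm x powr p"
    by (auto simp: indicator_def)
qed

text \<open>Integrability gives finite measure to the nonzero level sets of a simple function in the
  space, so such a function is a finite sum of admissible indicators; density does the rest.\<close>

lemma Lp_induct [consumes 2, case_names indicator add lim]:
  assumes f: "f \<in> Lp_space p M" and p: "0 < p"
    and ind: "\<And>A x. A \<in> sets M \<Longrightarrow> emeasure M A < \<infinity> \<Longrightarrow> Q (\<lambda>t. indicat_real A t *\<^sub>R x)"
    and add: "\<And>f g. f \<in> Lp_space p M \<Longrightarrow> g \<in> Lp_space p M \<Longrightarrow> Q f \<Longrightarrow> Q g \<Longrightarrow> Q (\<lambda>t. f t + g t)"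
    and lim: "\<And>F f. (\<And>i::nat. F i \<in> Lp_space p M) \<Longrightarrow> (\<And>i. Q (F i)) \<Longrightarrow> f \<in> Lp_space p M \<Longrightarrow>
      (\<lambda>i. Lp_int p M (\<lambda>t. F i t - f t)) \<longlonglongrightarrow> 0 \<Longrightarrow> Q f"
  shows "Q f"
proof -
  have simple: "Q s" if s: "simple_function M s" "s \<in> Lp_space p M" for s
  proof -
    define B where "B v = s -` {v} \<inter> space M" for v
    have B: "B v \<in> sets M" for v
      unfolding B_def by (rule simple_functionD(2)[OF s(1)])
    have Bfin: "emeasure M (B v) < \<infinity>" if "v \<noteq> 0" for v
    proof -
      have "integrable M (\<lambda>t. indicat_real (B v) t)"
      proof (rule Bochner_Integration.integrable_bound)
        show "integrable M (\<lambda>t. norm (s t) powr p / norm v powr p)"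
          using Lp_spaceD(3)[OF s(2)] by simp
        show "AE t in M. norm (indicat_real (B v) t) \<le> norm (norm (s t) powr p / norm v powr p)"
          using that by (auto simp: B_def indicator_def)
      qed (use B in measurable)
      then show ?thesis
        using B sets.sets_into_space[OF B] by (simp add: integrable_indicator_iff Int_absorb2)
    qed
    have ind': "Q (\<lambda>t. indicat_real (B v) t *\<^sub>R v) \<and> (\<lambda>t. indicat_real (B v) t *\<^sub>R v) \<in> Lp_space p M" for v
    proof (cases "v = 0")
      \<comment> \<open>The level set of 0 may have infinite measure, but its term is the zero
        function, which the empty set also provides.\<close>
      case True
      then show ?thesis using ind[of "{}" v] Lp_space_zero by simp
    next
      case False
      then show ?thesis using ind[OF B Bfin] Lp_space_indicator[OF B Bfin p] by blast
    qed
    have "finite V \<Longrightarrow> Q (\<lambda>t. \<Sum>v\<in>V. indicat_real (B v) t *\<^sub>R v)" for V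
    proof (induction V rule: finite_induct)
      case empty
      then show ?case using ind[of "{}" 0] by simp
    next
      case (insert v V)
      then have "Q (\<lambda>t. indicat_real (B v) t *\<^sub>R v + (\<Sum>v\<in>V. indicat_real (B v) t *\<^sub>R v))"
        using ind' p by (intro add Lp_space_sum) auto
      then show ?case unfolding sum.insert[OF insert.hyps] .
    qed
    then have Qs: "Q (\<lambda>t. \<Sum>v\<in>s ` space M. indicat_real (B v) t *\<^sub>R v)"
      using simple_functionD(1)[OF s(1)] by blast
    have eq: "(\<Sum>v\<in>s ` space M. indicat_real (B v) t *\<^sub>R v) = s t" if t: "t \<in> space M" for t
    proof -
      have "(\<Sum>v\<in>s ` space M. indicat_real (B v) t *\<^sub>R v) = (\<Sum>v\<in>s ` space M. if s t = v then v else 0)"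
        using t by (intro sum.cong) (auto simp: B_def indicator_def)
      also have "\<dots> = s t"
        using t simple_functionD(1)[OF s(1)] by (simp add: sum.delta')
      finally show ?thesis .
    qed
    \<comment> \<open>The sum represents s on \<open>space M\<close> only. As Q is a property of
      functions on the whole type, the difference outside is bridged by \<open>lim\<close> with a
      constant sequence.\<close>
    have "Lp_int p M (\<lambda>t. (\<Sum>v\<in>s ` space M. indicat_real (B v) t *\<^sub>R v) - s t) = (\<integral>t. 0 \<partial>M)"
      unfolding Lp_int_def using eq by (intro Bochner_Integration.integral_cong) auto
    then show "Q s"
      using ind' p by (intro lim[OF _ Qs s(2)] Lp_space_sum) auto
  qed
  obtain s where "\<And>i. simple_function M (s i)" "\<And>i. s i \<in> Lp_space p M"
    and lim0: "(\<lambda>i. Lp_int p M (\<lambda>t. s i t - f t)) \<longlonglongrightarrow> 0"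
    using Lp_simple_approx[OF p f] by blast
  with simple f show "Q f"
    by (intro lim[OF _ _ f lim0]) auto
qed

section \<open>Independence of the exponent\<close>

text \<open>Convexity of the power is applied to positive arguments; if one argument is 0, the claim
  reduces to u^p \<le> u on the unit interval.\<close>

lemma powr_convex_combination:
  fixes a b u v p :: real
  assumes "0 \<le> a" "0 \<le> b" "0 \<le> u" "0 \<le> v" "u + v = 1" "1 \<le> p"
  shows "(u * a + v * b) powr p \<le> u * a powr p + v * b powr p"
proof -
  have powr_le: "w powr p \<le> w" if "0 \<le> w" "w \<le> 1" for w :: real
    using powr_mono'[of 1 p w] that assms(6) by simp
  show ?thesis
  proof (cases "a = 0 \<or> b = 0")
    case True
    moreover have "(v * b) powr p \<le> v * b powr p" "(u * a) powr p \<le> u * a powr p"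
      using assms powr_le[of u] powr_le[of v] by (auto simp: powr_mult intro!: mult_right_mono)
    ultimately show ?thesis by auto
  next
    case False
    moreover have "u = 1 - v" using assms by simp
    ultimately show ?thesis
      using convex_onD[OF powr_convex[OF assms(6)], of v a b] assms(1-5) False unfolding \<open>u = 1 - v\<close> by simp
  qed
qed

text \<open>Almost every \<omega> lies in exactly one event \<open>E B\<close> with B a subset of
  \<open>A\<close>, where G takes the value at \<open>sgn_of B\<close>. Independence gives each
  event the mass 2^(-card A).\<close>

lemma rademacher_expectation:
  assumes \<epsilon>: "rademacher P \<epsilon>" and A: "finite A"
    and G: "(\<lambda>\<omega>. G (\<lambda>k. \<epsilon> k \<omega>)) \<in> borel_measurable P"
    and cong: "\<And>s s'. (\<And>k. k \<in> A \<Longrightarrow> s k = s' k) \<Longrightarrow> G s = G s'"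
  shows "(\<integral>\<omega>. G (\<lambda>k. \<epsilon> k \<omega>) \<partial>P) = sign_avg A G"
proof -
  interpret prob_space P
    using \<epsilon> by (simp add: rademacher_def)
  have indep: "indep_vars (\<lambda>_. borel) \<epsilon> UNIV"
    and half: "prob {\<omega>\<in>space P. \<epsilon> k \<omega> = 1} = 1 / 2" "prob {\<omega>\<in>space P. \<epsilon> k \<omega> = -1} = 1 / 2" for k
    using \<epsilon> by (auto simp: rademacher_def)
  have [measurable]: "\<epsilon> k \<in> borel_measurable P" for k
    using indep by (auto simp: indep_vars_def)
  \<comment> \<open>The two disjoint events of mass 1/2 exhaust the probability.\<close>
  have AE1: "AE \<omega> in P. \<epsilon> k \<omega> = 1 \<or> \<epsilon> k \<omega> = -1" for k
  proof -
    have "prob ({\<omega>\<in>space P. \<epsilon> k \<omega> = 1} \<union> {\<omega>\<in>space P. \<epsilon> k \<omega> = -1}) = 1"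
      by (subst finite_measure_Union) (auto simp: half)
    then show ?thesis
      by (subst (asm) prob_eq_1) (auto elim: eventually_mono)
  qed
  \<comment> \<open>The outer intersection with \<open>space P\<close> matters for empty
    \<open>A\<close>, where the inner one is the whole type.\<close>
  define E where "E B = (\<Inter>k\<in>A. \<epsilon> k -` {sgn_of B k} \<inter> space P) \<inter> space P" for B
  have E_sets [measurable]: "E B \<in> sets P" for B
    unfolding E_def using A by (cases "A = {}") (auto intro!: sets.Int sets.finite_INT)
  have prob_E: "prob (E B) = 1 / 2 ^ card A" for B
  proof (cases "A = {}")
    case True
    then show ?thesis by (simp add: E_def prob_space)
  next
    case False
    have "prob (E B) = prob (\<Inter>k\<in>A. \<epsilon> k -` {sgn_of B k} \<inter> space P)"
      using False by (intro arg_cong[where f = prob]) (auto simp: E_def)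
    also have "\<dots> = (\<Prod>k\<in>A. prob (\<epsilon> k -` {sgn_of B k} \<inter> space P))"
      by (rule indep_varsD[OF indep]) (use A False in auto)
    also have "\<dots> = (\<Prod>k\<in>A. 1 / 2)"
    proof (rule prod.cong)
      fix k
      have "\<epsilon> k -` {c} \<inter> space P = {\<omega>\<in>space P. \<epsilon> k \<omega> = c}" for c
        by auto
      then show "prob (\<epsilon> k -` {sgn_of B k} \<inter> space P) = 1 / 2"
        using half[of k] by (simp add: sgn_of_def)
    qed simp
    finally show ?thesis by (simp add: power_one_over)
  qed
  have "AE \<omega> in P. G (\<lambda>k. \<epsilon> k \<omega>) = (\<Sum>B\<in>Pow A. indicator (E B) \<omega> * G (sgn_of B))"
  proof -
    have "AE \<omega> in P. \<forall>k. \<epsilon> k \<omega> = 1 \<or> \<epsilon> k \<omega> = -1"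
      using AE1 by (simp add: AE_all_countable)
    with AE_space show ?thesis
    proof eventually_elim
      fix \<omega> assume \<omega>: "\<omega> \<in> space P" "\<forall>k. \<epsilon> k \<omega> = 1 \<or> \<epsilon> k \<omega> = -1"
      define B where "B = {k\<in>A. \<epsilon> k \<omega> = 1}"
      have sgnB: "\<epsilon> k \<omega> = sgn_of B k" if "k \<in> A" for k
        using \<omega>(2) that by (auto simp: B_def sgn_of_def)
      have "\<omega> \<in> E B' \<longleftrightarrow> B' = B" if "B' \<subseteq> A" for B'
      proof
        assume "\<omega> \<in> E B'"
        then have "\<epsilon> k \<omega> = sgn_of B' k" if "k \<in> A" for k
          using that by (auto simp: E_def split: if_splits)
        then have "k \<in> B' \<longleftrightarrow> \<epsilon> k \<omega> = 1" if "k \<in> A" for k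
          using that by (auto simp: sgn_of_def)
        then show "B' = B"
          using that by (auto simp: B_def)
      next
        assume "B' = B"
        then show "\<omega> \<in> E B'"
          using \<omega>(1) sgnB by (auto simp: E_def)
      qed
      then have "(\<Sum>B'\<in>Pow A. indicator (E B') \<omega> * G (sgn_of B')) =
          (\<Sum>B'\<in>Pow A. if B' = B then G (sgn_of B) else 0)"
        by (intro sum.cong) auto
      also have "\<dots> = G (sgn_of B)"
        using A by (simp add: B_def)
      also have "\<dots> = G (\<lambda>k. \<epsilon> k \<omega>)"
        by (rule cong) (simp add: sgnB)
      finally show "G (\<lambda>k. \<epsilon> k \<omega>) = (\<Sum>B\<in>Pow A. indicator (E B) \<omega> * G (sgn_of B))" ..
    qed
  qed
  then have "(\<integral>\<omega>. G (\<lambda>k. \<epsilon> k \<omega>) \<partial>P) = (\<integral>\<omega>. (\<Sum>B\<in>Pow A. indicator (E B) \<omega> * G (sgn_of B)) \<partial>P)"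
    using G by (intro integral_cong_AE) auto
  also have "\<dots> = (\<Sum>B\<in>Pow A. prob (E B) * G (sgn_of B))"
    by (subst Bochner_Integration.integral_sum) (auto simp: less_top[symmetric])
  also have "\<dots> = sign_avg A G"
    by (simp add: prob_E sign_avg_def sum_divide_distrib)
  finally show ?thesis .
qed

section \<open>Random sums in a Bochner space\<close>

lemma Lp_space_sign_sum:
  assumes "\<And>k. k \<in> A \<Longrightarrow> f k \<in> Lp_space p M" "0 < p"
  shows "(\<lambda>t. \<Sum>k\<in>A. (s k :: real) *\<^sub>R f k t) \<in> Lp_space p M"
  using assms by (intro Lp_space_sum Lp_space_scaleR(1)) auto

text \<open>The sum is affine in each sign: its value at c = u - v is the combination with weights u
  and v of the values at 1 and -1. Convexity of the p-th power then applies pointwise, and this is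
  where \<open>1 \<le> p\<close> enters.\<close>

lemma midconvex_Lp_int_sign_sum:
  assumes f: "\<And>k. k \<in> A \<Longrightarrow> f k \<in> Lp_space p M" and p: "1 \<le> p" and A: "finite A"
  shows "midconvex (\<lambda>s. Lp_int p M (\<lambda>t. \<Sum>k\<in>A. s k *\<^sub>R f k t))"
proof -
  define F where "F s t = (\<Sum>k\<in>A. s k *\<^sub>R f k t)" for s :: "nat \<Rightarrow> real" and t
  have F: "F s \<in> Lp_space p M" for s
    unfolding F_def[abs_def] using f p by (intro Lp_space_sign_sum) auto
  have comb: "Lp_int p M (F (s(j := c))) \<le> u * Lp_int p M (F (s(j := 1))) + v * Lp_int p M (F (s(j := -1)))"
    if uv: "0 \<le> u" "0 \<le> v" "u + v = 1" "u - v = c" for s j c u v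
  proof -
    have lin: "F (s(j := c)) t = u *\<^sub>R F (s(j := 1)) t + v *\<^sub>R F (s(j := -1)) t" for t
      unfolding F_def scaleR_sum_right sum.distrib[symmetric] scaleR_scaleR scaleR_add_left[symmetric]
      using uv by (intro sum.cong) (auto simp flip: distrib_right)
    have "norm (F (s(j := c)) t) powr p \<le> u * norm (F (s(j := 1)) t) powr p + v * norm (F (s(j := -1)) t) powr p" for t
    proof -
      have "norm (F (s(j := c)) t) \<le> u * norm (F (s(j := 1)) t) + v * norm (F (s(j := -1)) t)"
        unfolding lin using norm_triangle_ineq[of "u *\<^sub>R F (s(j := 1)) t" "v *\<^sub>R F (s(j := -1)) t"] uv by simp
      then have "norm (F (s(j := c)) t) powr p \<le> (u * norm (F (s(j := 1)) t) + v * norm (F (s(j := -1)) t)) powr p"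
        using p by (intro powr_mono2) auto
      also have "\<dots> \<le> u * norm (F (s(j := 1)) t) powr p + v * norm (F (s(j := -1)) t) powr p"
        using uv p by (intro powr_convex_combination) auto
      finally show ?thesis .
    qed
    then have "Lp_int p M (F (s(j := c))) \<le>
        (\<integral>t. u * norm (F (s(j := 1)) t) powr p + v * norm (F (s(j := -1)) t) powr p \<partial>M)"
      unfolding Lp_int_def using Lp_spaceD(3)[OF F] by (intro integral_mono) auto
    also have "\<dots> = u * Lp_int p M (F (s(j := 1))) + v * Lp_int p M (F (s(j := -1)))"
      unfolding Lp_int_def using Lp_spaceD(3)[OF F] by simp
    finally show ?thesis .
  qed
  have "midconvex (\<lambda>s. Lp_int p M (F s))"
    unfolding midconvex_def
  proof (intro conjI allI)
    show "Lp_int p M (F (s(k := 1/2))) \<le> 3/4 * Lp_int p M (F (s(k := 1))) + 1/4 * Lp_int p M (F (s(k := -1)))" for s k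
      by (rule comb) auto
    show "Lp_int p M (F (s(k := -1/2))) \<le> 1/4 * Lp_int p M (F (s(k := 1))) + 3/4 * Lp_int p M (F (s(k := -1)))" for s k
      by (rule comb) auto
  qed simp
  then show ?thesis by (simp add: F_def[abs_def])
qed

lemma Lp_int_sign_sum_halve:
  "Lp_int p M (\<lambda>t. \<Sum>k\<in>A. halve A s k *\<^sub>R f k t) = (1/2) powr p * Lp_int p M (\<lambda>t. \<Sum>k\<in>A. s k *\<^sub>R f k t)"
proof -
  have "(\<Sum>k\<in>A. halve A s k *\<^sub>R f k t) = (1/2) *\<^sub>R (\<Sum>k\<in>A. s k *\<^sub>R f k t)" for t
    unfolding scaleR_sum_right by (intro sum.cong) (auto simp: halve_def)
  then show ?thesis by (simp add: Lp_int_def powr_mult powr_divide)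
qed

text \<open>The inner norm is \<Psi>^(1/p), so its q-th power is \<Psi>^(q/p), a function of
  finitely many signs. Its measurability in \<omega> comes from joint measurability and
  \<sigma>-finiteness of \<open>M\<close>.\<close>

lemma rademacher_Lp_norm:
  assumes \<epsilon>: "rademacher P \<epsilon>" and M: "sigma_finite_measure M" and A: "finite A"
    and f: "\<And>k. k \<in> A \<Longrightarrow> f k \<in> Lp_space p M" and p: "0 < p" and q: "0 < q"
  shows "Lp_norm q P (\<lambda>\<omega>. Lp_norm p M (\<lambda>t. \<Sum>k\<in>A. \<epsilon> k \<omega> *\<^sub>R f k t)) =
    sign_avg A (\<lambda>s. Lp_int p M (\<lambda>t. \<Sum>k\<in>A. s k *\<^sub>R f k t) powr (q / p)) powr (1 / q)"
proof -
  define \<Psi> where "\<Psi> s = Lp_int p M (\<lambda>t. \<Sum>k\<in>A. s k *\<^sub>R f k t)" for s :: "nat \<Rightarrow> real"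
  have \<epsilon>_meas: "\<epsilon> k \<in> borel_measurable P" for k
    using \<epsilon> by (auto simp: rademacher_def prob_space.indep_vars_def)
  have sm: "strongly_measurable (P \<Otimes>\<^sub>M M) (\<lambda>z. \<Sum>k\<in>A. \<epsilon> k (fst z) *\<^sub>R f k (snd z))"
    using f by (intro strongly_measurable_sum strongly_measurable_scaleR measurable_compose[OF measurable_fst \<epsilon>_meas]
        strongly_measurable_comp[OF _ measurable_snd]) (auto dest: Lp_spaceD)
  have "(\<lambda>\<omega>. \<Psi> (\<lambda>k. \<epsilon> k \<omega>)) \<in> borel_measurable P"
    unfolding \<Psi>_def Lp_int_def
    using strongly_measurable_borel[OF sm]
    by (intro sigma_finite_measure.borel_measurable_lebesgue_integral[OF M]) (simp add: split_beta)
  then have meas: "(\<lambda>\<omega>. \<Psi> (\<lambda>k. \<epsilon> k \<omega>) powr (q / p)) \<in> borel_measurable P"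
    by measurable
  have "Lp_norm q P (\<lambda>\<omega>. Lp_norm p M (\<lambda>t. \<Sum>k\<in>A. \<epsilon> k \<omega> *\<^sub>R f k t)) =
      (\<integral>\<omega>. \<Psi> (\<lambda>k. \<epsilon> k \<omega>) powr (q / p) \<partial>P) powr (1 / q)"
    unfolding Lp_norm_def[of q P] \<Psi>_def by (simp add: Lp_norm_eq_Lp_int powr_powr)
  also have "(\<integral>\<omega>. \<Psi> (\<lambda>k. \<epsilon> k \<omega>) powr (q / p) \<partial>P) = sign_avg A (\<lambda>s. \<Psi> s powr (q / p))"
    by (rule rademacher_expectation[OF \<epsilon> A meas]) (simp add: \<Psi>_def)
  finally show ?thesis by (simp add: \<Psi>_def)
qed

text \<open>
  By Kahane's inequality \<open>R\<close>-boundedness does not depend on the exponent \<open>q\<close>. The choice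
  \<open>q = p\<close> makes it an inequality between integrals.
\<close>

definition R_bound_int ::
  "real \<Rightarrow> 'a measure \<Rightarrow> (('a \<Rightarrow> 'x::real_normed_vector) \<Rightarrow> ('a \<Rightarrow> 'x)) set \<Rightarrow> real \<Rightarrow> bool" where
  "R_bound_int p M F C \<longleftrightarrow>
     (\<forall>N::nat. \<forall>T f. (\<forall>k\<in>{1..N}. T k \<in> F \<and> f k \<in> Lp_space p M) \<longrightarrow>
        sign_avg {1..N} (\<lambda>s. Lp_int p M (\<lambda>t. \<Sum>k=1..N. s k *\<^sub>R T k (f k) t))
        \<le> C * sign_avg {1..N} (\<lambda>s. Lp_int p M (\<lambda>t. \<Sum>k=1..N. s k *\<^sub>R f k t)))"

text \<open>Kahane's inequality is applied to the images T k (f k) and to the f k; the assumption on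
  \<open>F\<close> puts the images into the space. Each direction uses it once on either side, hence
  the factor K twice in the new constants.\<close>

lemma R_bounded_Lp_iff:
  fixes F :: "(('a \<Rightarrow> 'x::real_normed_vector) \<Rightarrow> ('a \<Rightarrow> 'x)) set"
  assumes \<epsilon>: "rademacher P \<epsilon>" and M: "sigma_finite_measure M" and p: "1 \<le> p" and q: "0 < q"
    and F: "\<And>T f. T \<in> F \<Longrightarrow> f \<in> Lp_space p M \<Longrightarrow> T f \<in> Lp_space p M"
  shows "R_bounded_Lp P \<epsilon> q p M F \<longleftrightarrow> (\<exists>C\<ge>0. R_bound_int p M F C)"
proof -
  define \<theta> where "\<theta> = q / p"
  define \<Psi> :: "nat \<Rightarrow> (nat \<Rightarrow> 'a \<Rightarrow> 'x) \<Rightarrow> (nat \<Rightarrow> real) \<Rightarrow> real"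
    where "\<Psi> N f s = Lp_int p M (\<lambda>t. \<Sum>k=1..N. s k *\<^sub>R f k t)" for N f s
  define U where "U N f = sign_avg {1..N} (\<Psi> N f)" for N f
  define u where "u N f = sign_avg {1..N} (\<lambda>s. \<Psi> N f s powr \<theta>)" for N f
  have \<theta>: "0 < \<theta>" using p q by (simp add: \<theta>_def)
  obtain K where K: "0 < K" "\<And>A \<Psi>. finite A \<Longrightarrow> midconvex \<Psi> \<Longrightarrow> (\<And>s. \<Psi> (halve A s) = (1/2) powr p * \<Psi> s) \<Longrightarrow>
      sign_avg A (\<lambda>s. \<Psi> s powr \<theta>) \<le> K * sign_avg A \<Psi> powr \<theta> \<and>
      sign_avg A \<Psi> powr \<theta> \<le> K * sign_avg A (\<lambda>s. \<Psi> s powr \<theta>)"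
    using Kahane[OF _ \<theta>, of "(1/2) powr p"] by auto
  have nn [simp]: "0 \<le> U N f" "0 \<le> u N f" for N f
    by (simp_all add: U_def u_def \<Psi>_def sign_avg_nonneg)
  have Kh: "u N f \<le> K * U N f powr \<theta>" "U N f powr \<theta> \<le> K * u N f"
    if "\<forall>k\<in>{1..N}. f k \<in> Lp_space p M" for N f
  proof -
    have "midconvex (\<Psi> N f)"
      unfolding \<Psi>_def[abs_def] using that p by (intro midconvex_Lp_int_sign_sum) auto
    moreover have "\<Psi> N f (halve {1..N} s) = (1/2) powr p * \<Psi> N f s" for s
      unfolding \<Psi>_def by (rule Lp_int_sign_sum_halve)
    ultimately show "u N f \<le> K * U N f powr \<theta>" "U N f powr \<theta> \<le> K * u N f"
      using K(2)[of "{1..N}" "\<Psi> N f"] by (auto simp: u_def U_def)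
  qed
  have norm_eq: "Lp_norm q P (\<lambda>\<omega>. Lp_norm p M (\<lambda>t. \<Sum>k=1..N. \<epsilon> k \<omega> *\<^sub>R f k t)) = u N f powr (1 / q)"
    if "\<forall>k\<in>{1..N}. f k \<in> Lp_space p M" for N f
    unfolding u_def \<Psi>_def \<theta>_def using that p q
    by (intro rademacher_Lp_norm[OF \<epsilon> M]) auto
  have eqv: "(Lp_norm q P (\<lambda>\<omega>. Lp_norm p M (\<lambda>t. \<Sum>k=1..N. \<epsilon> k \<omega> *\<^sub>R T k (f k) t))
        \<le> C * Lp_norm q P (\<lambda>\<omega>. Lp_norm p M (\<lambda>t. \<Sum>k=1..N. \<epsilon> k \<omega> *\<^sub>R f k t))) =
      (u N (\<lambda>k. T k (f k)) powr (1 / q) \<le> C * u N f powr (1 / q))"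
    if "\<forall>k\<in>{1..N}. T k \<in> F \<and> f k \<in> Lp_space p M" for N T f C
    using norm_eq[of N f] norm_eq[of N "\<lambda>k. T k (f k)"] F that by auto
  have R1: "R_bounded_Lp P \<epsilon> q p M F \<longleftrightarrow> (\<exists>C\<ge>0. \<forall>N T f. (\<forall>k\<in>{1..N}. T k \<in> F \<and> f k \<in> Lp_space p M) \<longrightarrow>
      u N (\<lambda>k. T k (f k)) powr (1 / q) \<le> C * u N f powr (1 / q))"
    unfolding R_bounded_Lp_def by (intro ex_cong1 conj_cong refl all_cong1 imp_cong eqv)
  have R2: "R_bound_int p M F C \<longleftrightarrow> (\<forall>N T f. (\<forall>k\<in>{1..N}. T k \<in> F \<and> f k \<in> Lp_space p M) \<longrightarrow>
      U N (\<lambda>k. T k (f k)) \<le> C * U N f)" for C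
    unfolding R_bound_int_def U_def \<Psi>_def[abs_def] by (rule refl)
  show ?thesis
    unfolding R1 R2
  proof (intro iffI; elim exE conjE)
    fix C :: real assume C: "0 \<le> C" and *: "\<forall>N T f. (\<forall>k\<in>{1..N}. T k \<in> F \<and> f k \<in> Lp_space p M) \<longrightarrow>
      u N (\<lambda>k. T k (f k)) powr (1 / q) \<le> C * u N f powr (1 / q)"
    have "U N (\<lambda>k. T k (f k)) \<le> (K * C powr q * K) powr (1 / \<theta>) * U N f"
      if Tf: "\<forall>k\<in>{1..N}. T k \<in> F \<and> f k \<in> Lp_space p M" for N T f
    proof -
      have "(u N (\<lambda>k. T k (f k)) powr (1 / q)) powr q \<le> (C * u N f powr (1 / q)) powr q"
        using * Tf q by (intro powr_mono2) auto
      then have 1: "u N (\<lambda>k. T k (f k)) \<le> C powr q * u N f"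
        using q by (simp add: powr_mult powr_powr)
      have "U N (\<lambda>k. T k (f k)) powr \<theta> \<le> K * u N (\<lambda>k. T k (f k))"
        using Tf F by (intro Kh) auto
      also have "\<dots> \<le> K * (C powr q * u N f)"
        using 1 K(1) by (intro mult_left_mono) auto
      also have "\<dots> \<le> K * (C powr q * (K * U N f powr \<theta>))"
        using Tf K(1) by (intro mult_left_mono Kh) auto
      finally have "(U N (\<lambda>k. T k (f k)) powr \<theta>) powr (1 / \<theta>) \<le> (K * C powr q * K * U N f powr \<theta>) powr (1 / \<theta>)"
        using \<theta> by (intro powr_mono2) (auto simp: mult_ac)
      then show ?thesis
        using \<theta> by (simp add: powr_mult powr_powr)
    qed
    then show "\<exists>C\<ge>0. \<forall>N T f. (\<forall>k\<in>{1..N}. T k \<in> F \<and> f k \<in> Lp_space p M) \<longrightarrow> U N (\<lambda>k. T k (f k)) \<le> C * U N f"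
      by (intro exI[of _ "(K * C powr q * K) powr (1 / \<theta>)"]) auto
  next
    fix C :: real assume C: "0 \<le> C" and *: "\<forall>N T f. (\<forall>k\<in>{1..N}. T k \<in> F \<and> f k \<in> Lp_space p M) \<longrightarrow>
      U N (\<lambda>k. T k (f k)) \<le> C * U N f"
    have "u N (\<lambda>k. T k (f k)) powr (1 / q) \<le> (K * C powr \<theta> * K) powr (1 / q) * u N f powr (1 / q)"
      if Tf: "\<forall>k\<in>{1..N}. T k \<in> F \<and> f k \<in> Lp_space p M" for N T f
    proof -
      have "u N (\<lambda>k. T k (f k)) \<le> K * U N (\<lambda>k. T k (f k)) powr \<theta>"
        using Tf F by (intro Kh) auto
      also have "\<dots> \<le> K * (C * U N f) powr \<theta>"
        using * Tf K(1) \<theta> by (intro mult_left_mono powr_mono2) auto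
      also have "\<dots> = K * C powr \<theta> * U N f powr \<theta>"
        by (simp add: powr_mult)
      also have "\<dots> \<le> K * C powr \<theta> * (K * u N f)"
        using Tf K(1) by (intro mult_left_mono Kh) auto
      finally have "u N (\<lambda>k. T k (f k)) powr (1 / q) \<le> (K * C powr \<theta> * K * u N f) powr (1 / q)"
        using q by (intro powr_mono2) (auto simp: mult_ac)
      then show ?thesis by (simp add: powr_mult)
    qed
    then show "\<exists>C\<ge>0. \<forall>N T f. (\<forall>k\<in>{1..N}. T k \<in> F \<and> f k \<in> Lp_space p M) \<longrightarrow>
      u N (\<lambda>k. T k (f k)) powr (1 / q) \<le> C * u N f powr (1 / q)"
      by (intro exI[of _ "(K * C powr \<theta> * K) powr (1 / q)"]) auto
  qed
qed

section \<open>Operators acting in one of two variables\<close>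

lemma bounded_operator_LpD:
  assumes "bounded_operator_Lp sc p M T" "0 < p"
  shows "\<exists>C\<ge>0. \<forall>f\<in>Lp_space p M. Lp_int p M (T f) \<le> C * Lp_int p M f"
proof -
  obtain C where C: "0 \<le> C" "\<And>f. f \<in> Lp_space p M \<Longrightarrow> Lp_norm p M (T f) \<le> C * Lp_norm p M f"
    using assms(1) unfolding bounded_operator_Lp_def by blast
  have "Lp_int p M (T f) \<le> C powr p * Lp_int p M f" if "f \<in> Lp_space p M" for f
  proof -
    have "Lp_norm p M (T f) powr p \<le> (C * Lp_norm p M f) powr p"
      using C that assms(2) by (intro powr_mono2) auto
    then show ?thesis using assms(2) by (simp add: powr_mult Lp_norm_powr)
  qed
  then show ?thesis by (intro exI[of _ "C powr p"]) simp
qed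

lemma bounded_operator_LpI:
  assumes "0 < p" "0 \<le> C"
    and "\<And>f. f \<in> Lp_space p M \<Longrightarrow> T f \<in> Lp_space p M"
    and "\<And>f g. f \<in> Lp_space p M \<Longrightarrow> g \<in> Lp_space p M \<Longrightarrow> AE t in M. T (\<lambda>t. f t + g t) t = T f t + T g t"
    and "\<And>a f. f \<in> Lp_space p M \<Longrightarrow> AE t in M. T (\<lambda>t. sc a (f t)) t = sc a (T f t)"
    and C: "\<And>f. f \<in> Lp_space p M \<Longrightarrow> Lp_int p M (T f) \<le> C * Lp_int p M f"
  shows "bounded_operator_Lp sc p M T"
proof -
  have "Lp_norm p M (T f) \<le> C powr (1 / p) * Lp_norm p M f" if "f \<in> Lp_space p M" for f
  proof -
    have "Lp_norm p M (T f) \<le> (C * Lp_int p M f) powr (1 / p)"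
      unfolding Lp_norm_eq_Lp_int using assms(1) C[OF that] by (intro powr_mono2) auto
    then show ?thesis by (simp add: powr_mult Lp_norm_eq_Lp_int)
  qed
  then show ?thesis
    unfolding bounded_operator_Lp_def using assms(3-5) by (auto intro!: exI[of _ "C powr (1 / p)"])
qed

lemma bounded_operator_Lp_in:
  "bounded_operator_Lp sc p M T \<Longrightarrow> f \<in> Lp_space p M \<Longrightarrow> T f \<in> Lp_space p M"
  by (simp add: bounded_operator_Lp_def)

lemma bounded_operator_Lp_add:
  "bounded_operator_Lp sc p M T \<Longrightarrow> f \<in> Lp_space p M \<Longrightarrow> g \<in> Lp_space p M \<Longrightarrow>
    AE t in M. T (\<lambda>t. f t + g t) t = T f t + T g t"
  by (simp add: bounded_operator_Lp_def)

lemma bounded_operator_Lp_scale: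
  "bounded_operator_Lp sc p M T \<Longrightarrow> f \<in> Lp_space p M \<Longrightarrow> AE t in M. T (\<lambda>t. sc a (f t)) t = sc a (T f t)"
  by (simp add: bounded_operator_Lp_def)

lemma bounded_operator_Lp_diff:
  assumes "bounded_operator_Lp sc p M T" "f \<in> Lp_space p M" "g \<in> Lp_space p M" "0 < p"
  shows "AE t in M. T (\<lambda>t. f t - g t) t = T f t - T g t"
  using bounded_operator_Lp_add[OF assms(1,3) Lp_space_diff(1)[OF assms(2-4)]]
  by (auto elim: eventually_mono)

lemma bounded_operator_Lp_cong_AE:
  assumes T: "bounded_operator_Lp sc p M T" and fg: "f \<in> Lp_space p M" "g \<in> Lp_space p M" and p: "0 < p"
    and eq: "AE t in M. f t = g t"
  shows "AE t in M. T f t = T g t"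
proof -
  obtain C where C: "\<And>f. f \<in> Lp_space p M \<Longrightarrow> Lp_int p M (T f) \<le> C * Lp_int p M f"
    using bounded_operator_LpD[OF T p] by blast
  let ?d = "\<lambda>t. f t - g t"
  have d: "?d \<in> Lp_space p M"
    by (rule Lp_space_diff(1)[OF fg p])
  have "Lp_int p M ?d = 0"
    unfolding Lp_int_eq_0_iff[OF d] using eq by eventually_elim simp
  then have "Lp_int p M (T ?d) = 0"
    using C[OF d] Lp_int_nonneg[of p M "T ?d"] by simp
  then have "AE t in M. T ?d t = 0"
    unfolding Lp_int_eq_0_iff[OF bounded_operator_Lp_in[OF T d]] .
  with bounded_operator_Lp_diff[OF T fg p] show ?thesis
    by eventually_elim simp
qed

lemma bounded_operator_Lp_compose:
  fixes sc :: "'k::real_normed_field \<Rightarrow> 'x::real_normed_vector \<Rightarrow> 'x" and M :: "'a measure"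
  assumes S: "bounded_operator_Lp sc p M S" and T: "bounded_operator_Lp sc p M T"
    and p: "0 < p" and sc: "normed_scaling sc"
  shows "bounded_operator_Lp sc p M (\<lambda>f. S (T f))"
proof -
  obtain C where C: "0 \<le> C" "\<And>f. f \<in> Lp_space p M \<Longrightarrow> Lp_int p M (S f) \<le> C * Lp_int p M f"
    using bounded_operator_LpD[OF S p] by blast
  obtain D where D: "0 \<le> D" "\<And>f. f \<in> Lp_space p M \<Longrightarrow> Lp_int p M (T f) \<le> D * Lp_int p M f"
    using bounded_operator_LpD[OF T p] by blast
  note in_S = bounded_operator_Lp_in[OF S] and in_T = bounded_operator_Lp_in[OF T]
  show ?thesis
  proof (rule bounded_operator_LpI[OF p, of "C * D"])
    fix f g :: "'a \<Rightarrow> 'x" assume fg: "f \<in> Lp_space p M" "g \<in> Lp_space p M"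
    \<comment> \<open>\<open>T\<close> is additive almost everywhere only, so the exceptional null
      set has to be carried through \<open>S\<close>.\<close>
    have "AE t in M. S (T (\<lambda>t. f t + g t)) t = S (\<lambda>t. T f t + T g t) t"
      by (intro bounded_operator_Lp_cong_AE[OF S] bounded_operator_Lp_add[OF T] in_T Lp_space_add(1) fg p)
    with bounded_operator_Lp_add[OF S in_T[OF fg(1)] in_T[OF fg(2)]]
    show "AE t in M. S (T (\<lambda>t. f t + g t)) t = S (T f) t + S (T g) t"
      by eventually_elim simp
  next
    fix a and f :: "'a \<Rightarrow> 'x" assume f: "f \<in> Lp_space p M"
    have "AE t in M. S (T (\<lambda>t. sc a (f t))) t = S (\<lambda>t. sc a (T f t)) t"
      by (rule bounded_operator_Lp_cong_AE[OF S in_T[OF Lp_space_scaling(1)[OF f sc]]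
            Lp_space_scaling(1)[OF in_T[OF f] sc] p bounded_operator_Lp_scale[OF T f]])
    with bounded_operator_Lp_scale[OF S in_T[OF f]]
    show "AE t in M. S (T (\<lambda>t. sc a (f t))) t = sc a (S (T f) t)"
      by eventually_elim simp
  next
    fix f :: "'a \<Rightarrow> 'x" assume f: "f \<in> Lp_space p M"
    have "Lp_int p M (S (T f)) \<le> C * Lp_int p M (T f)"
      by (intro C in_T f)
    also have "\<dots> \<le> C * (D * Lp_int p M f)"
      by (intro mult_left_mono C D f)
    finally show "Lp_int p M (S (T f)) \<le> C * D * Lp_int p M f"
      by simp
  qed (use C D in_S in_T in auto)
qed

lemma bounded_operator_Lp_id:
  "0 < p \<Longrightarrow> bounded_operator_Lp sc p M (\<lambda>f. f)"
  by (rule bounded_operator_LpI[of _ 1]) auto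

section \<open>Slices and the graph of a slicewise operator\<close>

lemma Lp_space_slice:
  assumes AB: "pair_sigma_finite A B" and f: "f \<in> Lp_space p (A \<Otimes>\<^sub>M B)"
  shows "AE a in A. (\<lambda>b. f (a, b)) \<in> Lp_space p B"
    and "integrable A (\<lambda>a. Lp_int p B (\<lambda>b. f (a, b)))"
    and "(\<integral>a. Lp_int p B (\<lambda>b. f (a, b)) \<partial>A) = Lp_int p (A \<Otimes>\<^sub>M B) f"
proof -
  interpret pair_sigma_finite A B by (rule AB)
  note int = Lp_spaceD(3)[OF f]
  show "AE a in A. (\<lambda>b. f (a, b)) \<in> Lp_space p B"
    using AE_integrable_fst'[OF int] AE_space
    by eventually_elim
       (auto simp: Lp_space_def intro!: strongly_measurable_comp[OF Lp_spaceD(1)[OF f]])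
  show "integrable A (\<lambda>a. Lp_int p B (\<lambda>b. f (a, b)))"
    unfolding Lp_int_def by (rule integrable_fst'[OF int])
  show "(\<integral>a. Lp_int p B (\<lambda>b. f (a, b)) \<partial>A) = Lp_int p (A \<Otimes>\<^sub>M B) f"
    unfolding Lp_int_def by (rule integral_fst'[OF int])
qed

lemma Lp_space_tensor:
  assumes AB: "pair_sigma_finite A B" and sc: "normed_scaling sc"
    and h: "h \<in> Lp_space p B" and w: "w \<in> Lp_space p A"
  shows "(\<lambda>z. sc (h (snd z)) (w (fst z))) \<in> Lp_space p (A \<Otimes>\<^sub>M B)"
proof -
  interpret pair_sigma_finite A B by (rule AB)
  note [measurable] = Lp_spaceD(2)[OF h] Lp_spaceD(2)[OF w]
  show ?thesis
  proof (rule Lp_spaceI)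
    show "strongly_measurable (A \<Otimes>\<^sub>M B) (\<lambda>z. sc (h (snd z)) (w (fst z)))"
      by (intro strongly_measurable_scaling[OF sc] strongly_measurable_comp[OF Lp_spaceD(1)[OF h]]
          strongly_measurable_comp[OF Lp_spaceD(1)[OF w]] measurable_fst measurable_snd)
    show "integrable (A \<Otimes>\<^sub>M B) (\<lambda>z. norm (w (fst z)) powr p * norm (h (snd z)) powr p)"
      by (rule Fubini_integrable) (use Lp_spaceD(3)[OF h] Lp_spaceD(3)[OF w] in auto)
    show "AE z in A \<Otimes>\<^sub>M B. norm (sc (h (snd z)) (w (fst z))) powr p
        \<le> norm (w (fst z)) powr p * norm (h (snd z)) powr p"
      by (simp add: normed_scaling_norm[OF sc] powr_mult mult.commute)
  qed
qed

text \<open>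
  The graph of the operator acting by \<open>U\<close> in the second variable. Applying \<open>U\<close> to every slice does
  not define a function directly, since the representatives \<open>U (\<lambda>b. f (a, b))\<close> need not be jointly
  measurable.
\<close>

definition slice_graph ::
  "real \<Rightarrow> 'a measure \<Rightarrow> 'b measure \<Rightarrow> (('b \<Rightarrow> 'x::real_normed_vector) \<Rightarrow> ('b \<Rightarrow> 'x))
     \<Rightarrow> ('a \<times> 'b \<Rightarrow> 'x) \<Rightarrow> ('a \<times> 'b \<Rightarrow> 'x) \<Rightarrow> bool" where
  "slice_graph p A B U f g \<longleftrightarrow> f \<in> Lp_space p (A \<Otimes>\<^sub>M B) \<and> g \<in> Lp_space p (A \<Otimes>\<^sub>M B) \<and>
     (AE a in A. AE b in B. g (a, b) = U (\<lambda>b. f (a, b)) b)"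

lemma slice_graph_in:
  assumes "slice_graph p A B U f g"
  shows "f \<in> Lp_space p (A \<Otimes>\<^sub>M B)" "g \<in> Lp_space p (A \<Otimes>\<^sub>M B)"
  using assms by (auto simp: slice_graph_def)

lemma slice_graph_AE:
  assumes AB: "pair_sigma_finite A B" and fg: "slice_graph p A B U f g"
  shows "AE a in A. (\<lambda>b. f (a, b)) \<in> Lp_space p B \<and> (\<lambda>b. g (a, b)) \<in> Lp_space p B \<and>
    (AE b in B. g (a, b) = U (\<lambda>b. f (a, b)) b)"
  using Lp_space_slice(1)[OF AB slice_graph_in(1)[OF fg]] Lp_space_slice(1)[OF AB slice_graph_in(2)[OF fg]] fg
  by (auto simp: slice_graph_def)

text \<open>On almost every slice the difference has norm 0; integrating over the slices gives norm
  0 on the product. A choice from the graph is thus determined up to null sets, which is how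
  linearity of \<open>slice_op\<close> is obtained.\<close>

lemma slice_graph_unique:
  assumes AB: "pair_sigma_finite A B" and p: "0 < p"
    and g: "slice_graph p A B U f g" "slice_graph p A B U f g'"
  shows "AE z in A \<Otimes>\<^sub>M B. g z = g' z"
proof -
  let ?d = "\<lambda>z. g z - g' z"
  have d: "?d \<in> Lp_space p (A \<Otimes>\<^sub>M B)"
    using g p by (intro Lp_space_diff) (auto dest: slice_graph_in)
  have "AE a in A. Lp_int p B (\<lambda>b. ?d (a, b)) = 0"
    using slice_graph_AE[OF AB g(1)] slice_graph_AE[OF AB g(2)] Lp_space_slice(1)[OF AB d]
  proof eventually_elim
    case (elim a)
    then have "AE b in B. ?d (a, b) = 0" by auto
    then show ?case using Lp_int_eq_0_iff elim by blast
  qed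
  then have "Lp_int p (A \<Otimes>\<^sub>M B) ?d = 0"
    unfolding Lp_space_slice(3)[OF AB d, symmetric] by (rule integral_eq_zero_AE)
  then show ?thesis
    unfolding Lp_int_eq_0_iff[OF d] by simp
qed

lemma slice_graph_bound:
  assumes AB: "pair_sigma_finite A B"
    and U: "\<And>f. f \<in> Lp_space p B \<Longrightarrow> U f \<in> Lp_space p B"
      "\<And>f. f \<in> Lp_space p B \<Longrightarrow> Lp_int p B (U f) \<le> C * Lp_int p B f"
    and g: "slice_graph p A B U f g"
  shows "Lp_int p (A \<Otimes>\<^sub>M B) g \<le> C * Lp_int p (A \<Otimes>\<^sub>M B) f"
proof -
  note f_slice = Lp_space_slice[OF AB slice_graph_in(1)[OF g]]
  note g_slice = Lp_space_slice[OF AB slice_graph_in(2)[OF g]]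
  have "(\<integral>a. Lp_int p B (\<lambda>b. g (a, b)) \<partial>A) \<le> (\<integral>a. C * Lp_int p B (\<lambda>b. f (a, b)) \<partial>A)"
  proof (rule integral_mono_AE)
    show "AE a in A. Lp_int p B (\<lambda>b. g (a, b)) \<le> C * Lp_int p B (\<lambda>b. f (a, b))"
      using slice_graph_AE[OF AB g]
    proof eventually_elim
      case (elim a)
      then have "Lp_int p B (\<lambda>b. g (a, b)) = Lp_int p B (U (\<lambda>b. f (a, b)))"
        by (intro Lp_int_cong_AE U) auto
      then show ?case using U(2) elim by simp
    qed
  qed (use f_slice(2) g_slice(2) in auto)
  then show ?thesis by (simp add: f_slice(3) g_slice(3))
qed

lemma slice_graph_add:
  assumes AB: "pair_sigma_finite A B" and p: "0 < p" and U: "bounded_operator_Lp sc p B U"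
    and g: "slice_graph p A B U f g" "slice_graph p A B U f' g'"
  shows "slice_graph p A B U (\<lambda>z. f z + f' z) (\<lambda>z. g z + g' z)"
  unfolding slice_graph_def
proof (intro conjI)
  show "AE a in A. AE b in B. g (a, b) + g' (a, b) = U (\<lambda>b. f (a, b) + f' (a, b)) b"
    using slice_graph_AE[OF AB g(1)] slice_graph_AE[OF AB g(2)]
  proof eventually_elim
    case (elim a)
    then have "AE b in B. g (a, b) = U (\<lambda>b. f (a, b)) b" "AE b in B. g' (a, b) = U (\<lambda>b. f' (a, b)) b"
      by blast+
    moreover have "AE b in B. U (\<lambda>b. f (a, b) + f' (a, b)) b = U (\<lambda>b. f (a, b)) b + U (\<lambda>b. f' (a, b)) b"
      using elim by (intro bounded_operator_Lp_add[OF U]) auto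
    ultimately show ?case by eventually_elim simp
  qed
qed (use g p in \<open>auto intro: Lp_space_add dest: slice_graph_in\<close>)

lemma slice_graph_scale:
  assumes AB: "pair_sigma_finite A B" and sc: "normed_scaling sc" and U: "bounded_operator_Lp sc p B U"
    and g: "slice_graph p A B U f g"
  shows "slice_graph p A B U (\<lambda>z. sc c (f z)) (\<lambda>z. sc c (g z))"
  unfolding slice_graph_def
proof (intro conjI)
  show "AE a in A. AE b in B. sc c (g (a, b)) = U (\<lambda>b. sc c (f (a, b))) b"
    using slice_graph_AE[OF AB g]
  proof eventually_elim
    case (elim a)
    then have "AE b in B. g (a, b) = U (\<lambda>b. f (a, b)) b"
      by blast
    moreover have "AE b in B. U (\<lambda>b. sc c (f (a, b))) b = sc c (U (\<lambda>b. f (a, b)) b)"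
      using elim by (intro bounded_operator_Lp_scale[OF U]) auto
    ultimately show ?case by eventually_elim simp
  qed
qed (use g sc in \<open>auto intro: Lp_space_scaling dest: slice_graph_in\<close>)

lemma slice_graph_diff:
  assumes AB: "pair_sigma_finite A B" and p: "0 < p" and sc: "normed_scaling sc"
    and U: "bounded_operator_Lp sc p B U"
    and g: "slice_graph p A B U f g" "slice_graph p A B U f' g'"
  shows "slice_graph p A B U (\<lambda>z. f z - f' z) (\<lambda>z. g z - g' z)"
  using slice_graph_add[OF AB p U g(1) slice_graph_scale[OF AB sc U g(2), of "of_real (-1)"]]
  unfolding normed_scaling_of_real[OF sc] by simp

text \<open>With q = p both sides are integrals over \<open>a\<close> of the corresponding
  quantities on the slices, the sign average being a finite sum. The R-bound on \<open>B\<close>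
  holds on almost every slice and is integrated with the same constant.\<close>

lemma slice_graph_R_bound:
  assumes AB: "pair_sigma_finite A B" and p: "0 < p" and C: "R_bound_int p B F C"
    and F: "\<And>U f. U \<in> F \<Longrightarrow> f \<in> Lp_space p B \<Longrightarrow> U f \<in> Lp_space p B"
    and U: "\<And>k. k \<in> {1..N} \<Longrightarrow> U k \<in> F"
    and g: "\<And>k. k \<in> {1..N} \<Longrightarrow> slice_graph p A B (U k) (f k) (g k)"
  shows "sign_avg {1..N} (\<lambda>s. Lp_int p (A \<Otimes>\<^sub>M B) (\<lambda>z. \<Sum>k=1..N. s k *\<^sub>R g k z))
    \<le> C * sign_avg {1..N} (\<lambda>s. Lp_int p (A \<Otimes>\<^sub>M B) (\<lambda>z. \<Sum>k=1..N. s k *\<^sub>R f k z))"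
proof -
  define I where "I h a = sign_avg {1..N} (\<lambda>s. Lp_int p B (\<lambda>b. \<Sum>k=1..N. s k *\<^sub>R h k (a, b)))"
    for h :: "nat \<Rightarrow> 'a \<times> 'b \<Rightarrow> 'c" and a
  have Fubini: "integrable A (I h)"
    "(\<integral>a. I h a \<partial>A) = sign_avg {1..N} (\<lambda>s. Lp_int p (A \<Otimes>\<^sub>M B) (\<lambda>z. \<Sum>k=1..N. s k *\<^sub>R h k z))"
    if h: "\<And>k. k \<in> {1..N} \<Longrightarrow> h k \<in> Lp_space p (A \<Otimes>\<^sub>M B)" for h
  proof -
    note sl = Lp_space_slice[OF AB Lp_space_sign_sum[of "{1..N}" h, OF h p]]
    have sl3: "(\<integral>a. Lp_int p B (\<lambda>b. \<Sum>k=1..N. s k *\<^sub>R h k (a, b)) \<partial>A) =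
        Lp_int p (A \<Otimes>\<^sub>M B) (\<lambda>z. \<Sum>k=1..N. s k *\<^sub>R h k z)" for s
      by (rule sl(3))
    show "integrable A (I h)"
      unfolding I_def[abs_def] sign_avg_def using sl(2) by auto
    show "(\<integral>a. I h a \<partial>A) = sign_avg {1..N} (\<lambda>s. Lp_int p (A \<Otimes>\<^sub>M B) (\<lambda>z. \<Sum>k=1..N. s k *\<^sub>R h k z))"
      unfolding I_def sign_avg_def using sl(2) by (simp add: Bochner_Integration.integral_sum sl3 del: One_nat_def)
  qed
  have f_in: "f k \<in> Lp_space p (A \<Otimes>\<^sub>M B)" and g_in: "g k \<in> Lp_space p (A \<Otimes>\<^sub>M B)" if "k \<in> {1..N}" for k
    using slice_graph_in[OF g[OF that]] .
  have "(\<integral>a. I g a \<partial>A) \<le> (\<integral>a. C * I f a \<partial>A)"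
  proof (rule integral_mono_AE)
    have "AE a in A. \<forall>k\<in>{1..N}. (\<lambda>b. f k (a, b)) \<in> Lp_space p B \<and> (\<lambda>b. g k (a, b)) \<in> Lp_space p B \<and>
        (AE b in B. g k (a, b) = U k (\<lambda>b. f k (a, b)) b)"
      by (intro AE_finite_allI slice_graph_AE[OF AB] g) auto
    then show "AE a in A. I g a \<le> C * I f a"
    proof eventually_elim
      case (elim a)
      have AE_eq: "AE b in B. \<forall>k\<in>{1..N}. g k (a, b) = U k (\<lambda>b. f k (a, b)) b"
        using elim by (intro AE_finite_allI) auto
      have "Lp_int p B (\<lambda>b. \<Sum>k=1..N. s k *\<^sub>R g k (a, b)) =
          Lp_int p B (\<lambda>b. \<Sum>k=1..N. s k *\<^sub>R U k (\<lambda>b. f k (a, b)) b)" for s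
      proof (rule Lp_int_cong_AE)
        show "AE b in B. (\<Sum>k=1..N. s k *\<^sub>R g k (a, b)) = (\<Sum>k=1..N. s k *\<^sub>R U k (\<lambda>b. f k (a, b)) b)"
          using AE_eq by eventually_elim simp
      qed (use elim U F p in \<open>auto intro!: Lp_space_sign_sum\<close>)
      then have "I g a = sign_avg {1..N} (\<lambda>s. Lp_int p B (\<lambda>b. \<Sum>k=1..N. s k *\<^sub>R U k (\<lambda>b. f k (a, b)) b))"
        by (simp add: I_def)
      also have "\<dots> \<le> C * I f a"
        unfolding I_def
        by (rule C[unfolded R_bound_int_def, rule_format, of N U "\<lambda>k b. f k (a, b)"]) (use U elim in blast)
      finally show ?case .
    qed
  qed (use Fubini(1) f_in g_in in auto)
  then show ?thesis
    using Fubini(2)[of f] Fubini(2)[of g] f_in g_in by simp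
qed

text \<open>For fixed \<open>a\<close> the vector \<open>w a\<close> does not depend on
  \<open>b\<close>, so every slice is an elementary tensor on which U is prescribed.\<close>

lemma slice_graph_tensor:
  assumes AB: "pair_sigma_finite A B" and p: "0 < p" and sc: "normed_scaling sc"
    and S: "bounded_operator_Lp (*) p B S" and U: "extends_tensor_Id sc p B S U"
    and h: "h \<in> Lp_space p B" and w: "w \<in> Lp_space p A"
  shows "slice_graph p A B U (\<lambda>z. sc (h (snd z)) (w (fst z))) (\<lambda>z. sc (S h (snd z)) (w (fst z)))"
proof -
  have "AE a in A. AE b in B. sc (S h b) (w a) = U (\<lambda>b. sc (h b) (w a)) b"
  proof (rule AE_I2)
    fix a
    have "AE b in B. U (\<lambda>b. sc (h b) (w a)) b = sc (S h b) (w a)"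
      using U h unfolding extends_tensor_Id_def by blast
    then show "AE b in B. sc (S h b) (w a) = U (\<lambda>b. sc (h b) (w a)) b"
      by eventually_elim simp
  qed
  then show ?thesis
    unfolding slice_graph_def
    using Lp_space_tensor[OF AB sc h w] Lp_space_tensor[OF AB sc bounded_operator_Lp_in[OF S h] w] by simp
qed

text \<open>The domain of the graph is closed. Along a fast subsequence the images converge in the
  product space to some G, and on almost every slice both f and G are limits, so continuity of U
  identifies G there.\<close>

lemma slice_graph_LIMSEQ:
  fixes sc :: "'k::real_normed_field \<Rightarrow> 'x::banach \<Rightarrow> 'x"
  assumes AB: "pair_sigma_finite A B" and p: "0 < p" and sc: "normed_scaling sc"
    and U: "bounded_operator_Lp sc p B U"
    and F: "\<And>i::nat. \<exists>g. slice_graph p A B U (F i) g" and f: "f \<in> Lp_space p (A \<Otimes>\<^sub>M B)"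
    and lim: "(\<lambda>i. Lp_int p (A \<Otimes>\<^sub>M B) (\<lambda>z. F i z - f z)) \<longlonglongrightarrow> 0"
  shows "\<exists>g. slice_graph p A B U f g"
proof -
  interpret pair_sigma_finite A B by (rule AB)
  let ?M = "A \<Otimes>\<^sub>M B"
  obtain C where C: "0 \<le> C" "\<And>f. f \<in> Lp_space p B \<Longrightarrow> Lp_int p B (U f) \<le> C * Lp_int p B f"
    using bounded_operator_LpD[OF U p] by blast
  note U_in = bounded_operator_Lp_in[OF U]
  \<comment> \<open>The rate 4^(-p i) passes to the images by boundedness and is the one
    \<open>Lp_complete\<close> asks for.\<close>
  have "\<exists>n. Lp_int p ?M (\<lambda>z. F n z - f z) < (4 powr - p) ^ i" for i
  proof -
    have "eventually (\<lambda>n. Lp_int p ?M (\<lambda>z. F n z - f z) < (4 powr - p) ^ i) sequentially"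
      by (rule order_tendstoD(2)[OF lim]) simp
    then show ?thesis by (auto simp: eventually_sequentially)
  qed
  then obtain r where r: "\<And>i. Lp_int p ?M (\<lambda>z. F (r i) z - f z) < (4 powr - p) ^ i"
    using choice[of "\<lambda>i n. Lp_int p ?M (\<lambda>z. F n z - f z) < (4 powr - p) ^ i"] by blast
  define H where "H i = F (r i)" for i
  obtain g where g: "\<And>i. slice_graph p A B U (H i) (g i)"
    using choice[of "\<lambda>i g. slice_graph p A B U (H i) g"] F unfolding H_def by blast
  have H_in: "H i \<in> Lp_space p ?M" and g_in: "g i \<in> Lp_space p ?M" for i
    using slice_graph_in[OF g] by auto
  have Hf_in: "(\<lambda>z. H i z - f z) \<in> Lp_space p ?M" for i
    by (rule Lp_space_diff(1)[OF H_in f p])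
  have q: "4 powr - p \<le> (1::real)" "2 powr - p < (1::real)" "4 powr - p < (1::real)"
    using p powr_less_mono[of "- p" 0 2] powr_less_mono[of "- p" 0 4] by auto
  have "Lp_int p ?M (\<lambda>z. g (Suc i) z - g i z) \<le> C * 2 powr p * 2 * (4 powr - p) ^ i" for i
  proof -
    have "Lp_int p ?M (\<lambda>z. g (Suc i) z - g i z) \<le> C * Lp_int p ?M (\<lambda>z. H (Suc i) z - H i z)"
      by (intro slice_graph_bound[OF AB U_in C(2)] slice_graph_diff[OF AB p sc U] g)
    also have "Lp_int p ?M (\<lambda>z. H (Suc i) z - H i z) \<le>
        2 powr p * (Lp_int p ?M (\<lambda>z. H (Suc i) z - f z) + Lp_int p ?M (\<lambda>z. H i z - f z))"
      using Lp_space_diff(2)[OF Hf_in[of "Suc i"] Hf_in[of i] p] by simp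
    also have "\<dots> \<le> 2 powr p * ((4 powr - p) ^ i + (4 powr - p) ^ i)"
    proof (intro mult_left_mono add_mono)
      have "(4 powr - p) ^ Suc i \<le> (4 powr - p :: real) ^ i"
        using q by (intro power_decreasing) auto
      then show "Lp_int p ?M (\<lambda>z. H (Suc i) z - f z) \<le> (4 powr - p) ^ i"
        using r[of "Suc i"] unfolding H_def by linarith
      show "Lp_int p ?M (\<lambda>z. H i z - f z) \<le> (4 powr - p) ^ i"
        using r[of i] by (simp add: H_def)
    qed simp
    finally show ?thesis
      using C(1) by (simp add: mult_right_mono mult_ac)
  qed
  from Lp_complete[OF p g_in this] obtain G K where G: "G \<in> Lp_space p ?M"
    and K: "\<And>i. Lp_int p ?M (\<lambda>z. G z - g i z) \<le> K * (2 powr - p) ^ i"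
    by blast
  have Gg_in: "(\<lambda>z. G z - g i z) \<in> Lp_space p ?M" for i
    by (rule Lp_space_diff(1)[OF G g_in p])
  \<comment> \<open>Mere convergence to 0 would give convergence on slices along a subsequence;
    geometric decay makes the slice norms summable almost everywhere.\<close>
  have conv: "AE a in A. (\<lambda>i. Lp_int p B (\<lambda>b. h i (a, b))) \<longlonglongrightarrow> 0"
    if h: "\<And>i. h i \<in> Lp_space p ?M" and bd: "\<And>i. Lp_int p ?M (h i) \<le> c * x ^ i" and x: "0 < x" "x < 1"
    for h :: "nat \<Rightarrow> 'a \<times> 'b \<Rightarrow> 'x" and c x
  proof -
    note sl = Lp_space_slice[OF AB h]
    have "summable (\<lambda>i. \<integral>a. Lp_int p B (\<lambda>b. h i (a, b)) \<partial>A)"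
      unfolding sl(3)
    proof (rule summable_comparison_test'[of "\<lambda>i. c * x ^ i" 0])
      show "summable (\<lambda>i. c * x ^ i)"
        using x by (intro summable_mult summable_geometric) simp
    qed (use bd in simp)
    then have "AE a in A. summable (\<lambda>i. Lp_int p B (\<lambda>b. h i (a, b)))"
      by (intro AE_summable_of_integral(1) sl(2)) auto
    then show ?thesis
      by eventually_elim (rule summable_LIMSEQ_zero)
  qed
  have conv1: "AE a in A. (\<lambda>i. Lp_int p B (\<lambda>b. H i (a, b) - f (a, b))) \<longlonglongrightarrow> 0"
    using r by (intro conv[of "\<lambda>i z. H i z - f z" 1 "4 powr - p"] Hf_in) (auto simp: H_def q intro: less_imp_le)
  have conv2: "AE a in A. (\<lambda>i. Lp_int p B (\<lambda>b. G (a, b) - g i (a, b))) \<longlonglongrightarrow> 0"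
    by (intro conv[of "\<lambda>i z. G z - g i z" K "2 powr - p"] Gg_in K) (auto simp: q)
  have all: "AE a in A. \<forall>i. (\<lambda>b. H i (a, b)) \<in> Lp_space p B \<and> (\<lambda>b. g i (a, b)) \<in> Lp_space p B \<and>
      (AE b in B. g i (a, b) = U (\<lambda>b. H i (a, b)) b)"
    by (intro AE_all_countable[THEN iffD2] allI slice_graph_AE[OF AB] g)
  have "AE a in A. AE b in B. G (a, b) = U (\<lambda>b. f (a, b)) b"
    using conv1 conv2 all Lp_space_slice(1)[OF AB G] Lp_space_slice(1)[OF AB f]
  proof eventually_elim
    case (elim a)
    let ?f = "\<lambda>b. f (a, b)" and ?G = "\<lambda>b. G (a, b)"
    let ?H = "\<lambda>i b. H i (a, b)" and ?g = "\<lambda>i b. g i (a, b)"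
    have in_B: "?H i \<in> Lp_space p B" "?g i \<in> Lp_space p B" for i
      using elim by auto
    \<comment> \<open>The triangle inequality through \<open>?g i\<close>, which agrees with U
      applied to the slice of \<open>H i\<close>; both error terms tend to 0.\<close>
    have bd: "Lp_int p B (\<lambda>b. ?G b - U ?f b) \<le>
        2 powr p * (Lp_int p B (\<lambda>b. ?G b - ?g i b) + C * Lp_int p B (\<lambda>b. ?H i b - ?f b))" for i
    proof -
      have "AE b in B. ?g i b = U (?H i) b"
        using elim by auto
      with bounded_operator_Lp_diff[OF U in_B(1)[of i] elim(5) p]
      have eq: "AE b in B. ?g i b - U ?f b = U (\<lambda>b. ?H i b - ?f b) b"
        by eventually_elim simp
      have "Lp_int p B (\<lambda>b. ?G b - U ?f b) = Lp_int p B (\<lambda>b. (?G b - ?g i b) + (?g i b - U ?f b))"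
        by simp
      also have "\<dots> \<le> 2 powr p * (Lp_int p B (\<lambda>b. ?G b - ?g i b) + Lp_int p B (\<lambda>b. ?g i b - U ?f b))"
        by (intro Lp_space_add(2) Lp_space_diff(1) elim in_B U_in p)
      also have "Lp_int p B (\<lambda>b. ?g i b - U ?f b) = Lp_int p B (U (\<lambda>b. ?H i b - ?f b))"
        by (intro Lp_int_cong_AE[OF _ _ eq] U_in Lp_space_diff(1) elim in_B p)
      also have "\<dots> \<le> C * Lp_int p B (\<lambda>b. ?H i b - ?f b)"
        by (intro C(2) Lp_space_diff(1) elim in_B p)
      finally show ?thesis by simp
    qed
    have "(\<lambda>i. 2 powr p * (Lp_int p B (\<lambda>b. ?G b - ?g i b) + C * Lp_int p B (\<lambda>b. ?H i b - ?f b)))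
        \<longlonglongrightarrow> 2 powr p * (0 + C * 0)"
      by (intro tendsto_intros elim)
    then have "Lp_int p B (\<lambda>b. ?G b - U ?f b) \<le> 2 powr p * (0 + C * 0)"
      by (rule LIMSEQ_le_const) (use bd in blast)
    then have "Lp_int p B (\<lambda>b. ?G b - U ?f b) = 0"
      using Lp_int_nonneg[of p B "\<lambda>b. ?G b - U ?f b"] by simp
    then have "AE b in B. ?G b - U ?f b = 0"
      by (subst (asm) Lp_int_eq_0_iff) (intro Lp_space_diff(1) elim U_in p)
    then show ?case by simp
  qed
  then show ?thesis
    using f G unfolding slice_graph_def by blast
qed

lemma Lp_int_indicator_LIMSEQ:
  assumes E: "\<And>i. E i \<in> sets M" "D \<in> sets M" "emeasure M D < \<infinity>" "\<And>i. E i \<subseteq> D" and p: "0 < p"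
    and lim: "\<And>t. t \<in> space M \<Longrightarrow> (\<lambda>i. indicat_real (E i) t) \<longlonglongrightarrow> indicat_real D t"
  shows "(\<lambda>i. Lp_int p M (\<lambda>t. indicat_real (E i) t *\<^sub>R x - indicat_real D t *\<^sub>R x)) \<longlonglongrightarrow> 0"
proof -
  note [measurable] = E(1,2)
  have *: "norm (indicat_real (E i) t *\<^sub>R x - indicat_real D t *\<^sub>R x) =
      \<bar>indicat_real (E i) t - indicat_real D t\<bar> * norm x" for i t
    by (simp flip: scaleR_diff_left)
  have "(\<lambda>i. Lp_int p M (\<lambda>t. indicat_real (E i) t *\<^sub>R x - indicat_real D t *\<^sub>R x)) \<longlonglongrightarrow> (\<integral>t. 0 \<partial>M)"
    unfolding Lp_int_def *
  proof (rule integral_dominated_convergence)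
    show "integrable M (\<lambda>t. indicat_real D t * norm x powr p)"
      using E by simp
    show "AE t in M. (\<lambda>i. (\<bar>indicat_real (E i) t - indicat_real D t\<bar> * norm x) powr p) \<longlonglongrightarrow> 0"
    proof (intro AE_I2)
      fix t assume "t \<in> space M"
      then have "(\<lambda>i. \<bar>indicat_real (E i) t - indicat_real D t\<bar> * norm x) \<longlonglongrightarrow> \<bar>indicat_real D t - indicat_real D t\<bar> * norm x"
        by (intro tendsto_intros lim)
      then show "(\<lambda>i. (\<bar>indicat_real (E i) t - indicat_real D t\<bar> * norm x) powr p) \<longlonglongrightarrow> 0"
        using tendsto_zero_powrI[of _ sequentially "\<lambda>_. p" p] p by auto
    qed
    show "AE t in M. norm ((\<bar>indicat_real (E i) t - indicat_real D t\<bar> * norm x) powr p)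
        \<le> indicat_real D t * norm x powr p" for i
      using E(4)[of i] by (intro AE_I2) (auto simp: indicator_def)
  qed auto
  then show ?thesis by simp
qed

text \<open>The domain of the graph is linear and closed, so it is enough that it contains
  indicators of sets of finite measure. Those are reached from rectangles, whose indicators are
  elementary tensors.\<close>

lemma slice_graph_total:
  fixes sc :: "'k::real_normed_field \<Rightarrow> 'x::banach \<Rightarrow> 'x"
  assumes AB: "pair_sigma_finite A B" and p: "0 < p" and sc: "normed_scaling sc"
    and S: "bounded_operator_Lp (*) p B S" and U: "extends_tensor_Id sc p B S U"
    and f: "f \<in> Lp_space p (A \<Otimes>\<^sub>M B)"
  shows "\<exists>g. slice_graph p A B U f g"
proof -
  interpret pair_sigma_finite A B by (rule AB)
  let ?M = "A \<Otimes>\<^sub>M B"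
  have U_bdd: "bounded_operator_Lp sc p B U"
    using U by (simp add: extends_tensor_Id_def)
  define Q where "Q f \<longleftrightarrow> (\<exists>g. slice_graph p A B U f g)" for f
  have Q_add: "Q (\<lambda>z. f z + g z)" and Q_diff: "Q (\<lambda>z. f z - g z)" if "Q f" "Q g" for f g
    using that slice_graph_add[OF AB p U_bdd] slice_graph_diff[OF AB p sc U_bdd] unfolding Q_def by blast+
  have Q_lim: "Q f" if "\<And>i::nat. Q (F i)" "f \<in> Lp_space p ?M"
    "(\<lambda>i. Lp_int p ?M (\<lambda>z. F i z - f z)) \<longlonglongrightarrow> 0" for F f
    using that slice_graph_LIMSEQ[OF AB p sc U_bdd] unfolding Q_def by blast
  have Q_rect: "Q (\<lambda>z. indicat_real (a \<times> b) z *\<^sub>R x)"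
    if "a \<in> sets A" "b \<in> sets B" "emeasure A a < \<infinity>" "emeasure B b < \<infinity>" for a b and x :: 'x
  proof -
    have h: "(\<lambda>t. indicat_real b t *\<^sub>R (1 :: 'k)) \<in> Lp_space p B" and w: "(\<lambda>t. indicat_real a t *\<^sub>R x) \<in> Lp_space p A"
      using that p by (auto intro!: Lp_space_indicator)
    have "(\<lambda>z. sc (indicat_real b (snd z) *\<^sub>R 1) (indicat_real a (fst z) *\<^sub>R x)) =
        (\<lambda>z. indicat_real (a \<times> b) z *\<^sub>R x)"
      unfolding scaleR_conv_of_real[where 'a = 'k] mult_1_right normed_scaling_of_real[OF sc]
      by (auto simp: indicator_def split: prod.splits)
    then show ?thesis
      using slice_graph_tensor[OF AB p sc S U h w] unfolding Q_def by auto
  qed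
  \<comment> \<open>A Dynkin argument inside a fixed rectangle of finite measure. The restriction
    keeps complements integrable: there the complement becomes a difference of two functions in the
    space.\<close>
  have Q_local: "Q (\<lambda>z. indicat_real (D \<inter> (a \<times> b)) z *\<^sub>R x)"
    if D: "D \<in> sets ?M" and ab: "a \<in> sets A" "b \<in> sets B" "emeasure A a < \<infinity>" "emeasure B b < \<infinity>"
    for D a b and x :: 'x
  proof -
    let ?R = "a \<times> b"
    have R: "?R \<in> sets ?M" "emeasure ?M ?R < \<infinity>"
      using ab by (auto simp: M2.emeasure_pair_measure_Times ennreal_mult_less_top)
    have fin: "emeasure ?M (E \<inter> ?R) < \<infinity>" if "E \<in> sets ?M" for E
      using emeasure_mono[of "E \<inter> ?R" ?R ?M] R by (simp add: le_less_trans)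
    have gen: "sets ?M = sigma_sets (space A \<times> space B) {a \<times> b | a b. a \<in> sets A \<and> b \<in> sets B}"
      by (rule sets_pair_measure)
    note gen_sub = pair_measure_closed[of A B]
    show ?thesis
      using D unfolding gen
    proof (induction rule: sigma_sets_induct_disjoint[OF Int_stable_pair_measure_generator gen_sub, consumes 1,
          case_names basic empty compl union])
      case (basic E)
      then obtain a' b' where E: "E = a' \<times> b'" "a' \<in> sets A" "b' \<in> sets B" by auto
      have "Q (\<lambda>z. indicat_real ((a' \<inter> a) \<times> (b' \<inter> b)) z *\<^sub>R x)"
        using E ab emeasure_mono[of "a' \<inter> a" a A] emeasure_mono[of "b' \<inter> b" b B]
        by (intro Q_rect) (auto simp: le_less_trans)
      then show ?case by (simp add: E(1) Times_Int_Times)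
    next
      case empty
      show ?case using Q_rect[of "{}" "{}" x] by simp
    next
      case (compl E)
      have "indicat_real ((space A \<times> space B - E) \<inter> ?R) z *\<^sub>R x =
          indicat_real ?R z *\<^sub>R x - indicat_real (E \<inter> ?R) z *\<^sub>R x" for z
        using sets.sets_into_space[OF ab(1)] sets.sets_into_space[OF ab(2)]
        by (auto simp: indicator_def)
      then show ?case
        using Q_diff[OF Q_rect[OF ab, of x] compl.IH] by simp
    next
      case (union E)
      have E: "E i \<in> sets ?M" for i
        using union(2) by (auto simp: gen)
      have fin_union: "Q (\<lambda>z. indicat_real ((\<Union>i<n. E i) \<inter> ?R) z *\<^sub>R x)" for n
      proof (induction n)
        case 0
        show ?case using Q_rect[of "{}" "{}" x] by simp
      next
        case (Suc n)
        have "indicat_real ((\<Union>i<Suc n. E i) \<inter> ?R) z *\<^sub>R x =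
            indicat_real ((\<Union>i<n. E i) \<inter> ?R) z *\<^sub>R x + indicat_real (E n \<inter> ?R) z *\<^sub>R x" for z
        proof -
          have "z \<notin> E i" if "z \<in> E n" "i < n" for i
            using disjoint_family_onD[OF union(1), of i n] that by auto
          then show ?thesis
            by (auto simp: indicator_def lessThan_Suc)
        qed
        then show ?case
          using Q_add[OF Suc union.IH[of n]] by simp
      qed
      have UE: "\<Union> (range E) \<in> sets ?M"
        using E by auto
      show ?case
      proof (rule Q_lim[OF fin_union])
        show "(\<lambda>z. indicat_real (\<Union> (range E) \<inter> ?R) z *\<^sub>R x) \<in> Lp_space p ?M"
          using UE R(1) p by (intro Lp_space_indicator fin) auto
        show "(\<lambda>n. Lp_int p ?M (\<lambda>z. indicat_real ((\<Union>i<n. E i) \<inter> ?R) z *\<^sub>R x - indicat_real (\<Union> (range E) \<inter> ?R) z *\<^sub>R x)) \<longlonglongrightarrow> 0"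
        proof (rule Lp_int_indicator_LIMSEQ)
          fix z
          show "(\<lambda>n. indicat_real ((\<Union>i<n. E i) \<inter> ?R) z) \<longlonglongrightarrow> indicat_real (\<Union> (range E) \<inter> ?R) z"
            unfolding indicator_inter_arith by (intro tendsto_intros LIMSEQ_indicator_UN)
        qed (use E R(1) p fin[OF UE] in auto)
      qed
    qed
  qed
  have "Q f"
    using f p
  proof (induction rule: Lp_induct)
    case (indicator D x)
    \<comment> \<open>Exhaustion by rectangles of finite measure removes the restriction to a single
      rectangle.\<close>
    obtain a where a: "range a \<subseteq> sets A" "(\<Union>i. a i) = space A" "\<And>i. emeasure A (a i) \<noteq> \<infinity>" "incseq a"
      using M1.sigma_finite_incseq by blast
    obtain b where b: "range b \<subseteq> sets B" "(\<Union>i. b i) = space B" "\<And>i. emeasure B (b i) \<noteq> \<infinity>" "incseq b"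
      using M2.sigma_finite_incseq by blast
    let ?R = "\<lambda>i. D \<inter> (a i \<times> b i)"
    have R: "?R i \<in> sets ?M" for i
      using a(1) b(1) indicator(1) by auto
    have inc: "incseq ?R"
      using a(4) b(4) by (fastforce simp: incseq_def)
    have un: "(\<Union>i. ?R i) = D"
    proof
      show "D \<subseteq> (\<Union>i. ?R i)"
      proof
        fix z assume z: "z \<in> D"
        then have "fst z \<in> space A" "snd z \<in> space B"
          using sets.sets_into_space[OF indicator(1)] by (auto simp: space_pair_measure)
        then obtain i j where "fst z \<in> a i" "snd z \<in> b j"
          using a(2) b(2) by blast
        then have "fst z \<in> a (max i j)" "snd z \<in> b (max i j)"
          using incseqD[OF a(4), of i "max i j"] incseqD[OF b(4), of j "max i j"] by auto
        then show "z \<in> (\<Union>i. ?R i)"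
          using z by (auto simp: mem_Times_iff)
      qed
    qed auto
    show ?case
    proof (rule Q_lim)
      show "Q (\<lambda>z. indicat_real (?R i) z *\<^sub>R x)" for i
        using a(1,3) b(1,3) indicator(1) by (intro Q_local) (auto simp: less_top[symmetric])
      show "(\<lambda>z. indicat_real D z *\<^sub>R x) \<in> Lp_space p ?M"
        using indicator p by (intro Lp_space_indicator)
      show "(\<lambda>i. Lp_int p ?M (\<lambda>z. indicat_real (?R i) z *\<^sub>R x - indicat_real D z *\<^sub>R x)) \<longlonglongrightarrow> 0"
      proof (rule Lp_int_indicator_LIMSEQ)
        show "(\<lambda>i. indicat_real (?R i) z) \<longlonglongrightarrow> indicat_real D z" for z
          using LIMSEQ_indicator_incseq[OF inc, of z] un by simp
      qed (use R indicator p in auto)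
    qed
  qed (auto intro: Q_add Q_lim)
  then show ?thesis by (simp add: Q_def)
qed

section \<open>The slicewise operator\<close>

definition slice_op ::
  "real \<Rightarrow> 'a measure \<Rightarrow> 'b measure \<Rightarrow> (('b \<Rightarrow> 'x::real_normed_vector) \<Rightarrow> ('b \<Rightarrow> 'x))
     \<Rightarrow> ('a \<times> 'b \<Rightarrow> 'x) \<Rightarrow> ('a \<times> 'b \<Rightarrow> 'x)" where
  "slice_op p A B U f = (SOME g. slice_graph p A B U f g)"

lemma slice_op_graph:
  fixes sc :: "'k::real_normed_field \<Rightarrow> 'x::banach \<Rightarrow> 'x"
  assumes "pair_sigma_finite A B" "0 < p" "normed_scaling sc"
    and "bounded_operator_Lp (*) p B S" "extends_tensor_Id sc p B S U"
    and "f \<in> Lp_space p (A \<Otimes>\<^sub>M B)"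
  shows "slice_graph p A B U f (slice_op p A B U f)"
  unfolding slice_op_def using slice_graph_total[OF assms] by (rule someI_ex)

lemma bounded_operator_Lp_slice_op:
  fixes sc :: "'k::real_normed_field \<Rightarrow> 'x::banach \<Rightarrow> 'x"
  assumes AB: "pair_sigma_finite A B" and p: "0 < p" and sc: "normed_scaling sc"
    and S: "bounded_operator_Lp (*) p B S" and U: "extends_tensor_Id sc p B S U"
  shows "bounded_operator_Lp sc p (A \<Otimes>\<^sub>M B) (slice_op p A B U)"
proof -
  note graph = slice_op_graph[OF AB p sc S U]
  have U_bdd: "bounded_operator_Lp sc p B U"
    using U by (simp add: extends_tensor_Id_def)
  obtain C where C: "0 \<le> C" "\<And>f. f \<in> Lp_space p B \<Longrightarrow> Lp_int p B (U f) \<le> C * Lp_int p B f"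
    using bounded_operator_LpD[OF U_bdd p] by blast
  show ?thesis
  proof (rule bounded_operator_LpI[OF p C(1)])
    fix f :: "'a \<times> 'b \<Rightarrow> 'x" assume f: "f \<in> Lp_space p (A \<Otimes>\<^sub>M B)"
    show "slice_op p A B U f \<in> Lp_space p (A \<Otimes>\<^sub>M B)"
      by (rule slice_graph_in(2)[OF graph[OF f]])
    show "Lp_int p (A \<Otimes>\<^sub>M B) (slice_op p A B U f) \<le> C * Lp_int p (A \<Otimes>\<^sub>M B) f"
      by (rule slice_graph_bound[OF AB bounded_operator_Lp_in[OF U_bdd] C(2) graph[OF f]])
    show "AE z in A \<Otimes>\<^sub>M B. slice_op p A B U (\<lambda>z. sc a (f z)) z = sc a (slice_op p A B U f z)" for a
      by (rule slice_graph_unique[OF AB p graph[OF Lp_space_scaling(1)[OF f sc]]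
            slice_graph_scale[OF AB sc U_bdd graph[OF f]]])
    fix g :: "'a \<times> 'b \<Rightarrow> 'x" assume g: "g \<in> Lp_space p (A \<Otimes>\<^sub>M B)"
    show "AE z in A \<Otimes>\<^sub>M B. slice_op p A B U (\<lambda>z. f z + g z) z = slice_op p A B U f z + slice_op p A B U g z"
      by (rule slice_graph_unique[OF AB p graph[OF Lp_space_add(1)[OF f g p]]
            slice_graph_add[OF AB p U_bdd graph[OF f] graph[OF g]]])
  qed
qed

section \<open>Transport along measure-preserving maps\<close>

lemma Lp_space_distr:
  assumes \<phi>: "\<phi> \<in> N \<rightarrow>\<^sub>M M" "distr N M \<phi> = M" and f: "f \<in> Lp_space p M"
  shows "(\<lambda>z. f (\<phi> z)) \<in> Lp_space p N" "Lp_int p N (\<lambda>z. f (\<phi> z)) = Lp_int p M f"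
proof -
  have [measurable]: "f \<in> borel_measurable M"
    using f by (rule Lp_spaceD)
  have m: "(\<lambda>t. norm (f t) powr p) \<in> borel_measurable M"
    by measurable
  have "integrable (distr N M \<phi>) (\<lambda>t. norm (f t) powr p)"
    using Lp_spaceD(3)[OF f] \<phi>(2) by simp
  then show "(\<lambda>z. f (\<phi> z)) \<in> Lp_space p N"
    using strongly_measurable_comp[OF Lp_spaceD(1)[OF f] \<phi>(1)]
    by (simp add: integrable_distr_eq[OF \<phi>(1) m] Lp_space_def)
  show "Lp_int p N (\<lambda>z. f (\<phi> z)) = Lp_int p M f"
    unfolding Lp_int_def using integral_distr[OF \<phi>(1) m] \<phi>(2) by simp
qed

section \<open>Finite products\<close>

text \<open>The slicewise operator carried over from the product of two spaces to functions on the
  index set \<open>insert k J\<close>, by the identification of (a, b) with \<open>a(k := b)\<close>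
  and its inverse \<open>(restrict t J, t k)\<close>.\<close>

definition coord_op ::
  "real \<Rightarrow> ('i \<Rightarrow> 'a measure) \<Rightarrow> 'i set \<Rightarrow> 'i \<Rightarrow> (('a \<Rightarrow> 'x::real_normed_vector) \<Rightarrow> ('a \<Rightarrow> 'x))
     \<Rightarrow> (('i \<Rightarrow> 'a) \<Rightarrow> 'x) \<Rightarrow> (('i \<Rightarrow> 'a) \<Rightarrow> 'x)" where
  "coord_op p M J k U f t = slice_op p (PiM J M) (M k) U (\<lambda>z. f ((fst z)(k := snd z))) (restrict t J, t k)"

context product_sigma_finite
begin

section \<open>Splitting one coordinate off a product measure\<close>

lemma distr_fun_upd:
  assumes "finite J" "k \<notin> J"
  shows "distr (PiM J M \<Otimes>\<^sub>M M k) (PiM (insert k J) M) (\<lambda>z. (fst z)(k := snd z)) = PiM (insert k J) M"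
    (is "distr ?N ?O ?\<phi> = _")
proof (rule PiM_eqI)
  have \<phi>: "?\<phi> \<in> ?N \<rightarrow>\<^sub>M ?O"
    using measurable_add_dim[of k J M] by (simp add: split_beta)
  fix A assume A: "\<And>i. i \<in> insert k J \<Longrightarrow> A i \<in> sets (M i)"
  have "?\<phi> -` Pi\<^sub>E (insert k J) A \<inter> space ?N = Pi\<^sub>E J A \<times> A k"
    using sets.sets_into_space[OF A] assms(2)
    by (fastforce simp: space_pair_measure space_PiM PiE_iff extensional_def fun_upd_def split: if_splits)
  then have "emeasure (distr ?N ?O ?\<phi>) (Pi\<^sub>E (insert k J) A) = emeasure ?N (Pi\<^sub>E J A \<times> A k)"
    using A assms by (subst emeasure_distr[OF \<phi>]) (auto intro!: sets_PiM_I_finite)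
  also have "\<dots> = emeasure (PiM J M) (Pi\<^sub>E J A) * emeasure (M k) (A k)"
    using A assms by (intro sigma_finite_measure.emeasure_pair_measure_Times[OF sigma_finite_measures] sets_PiM_I_finite) auto
  also have "\<dots> = (\<Prod>i\<in>insert k J. emeasure (M i) (A i))"
    using A assms by (subst emeasure_PiM) (auto simp: mult.commute)
  finally show "emeasure (distr ?N ?O ?\<phi>) (Pi\<^sub>E (insert k J) A) = (\<Prod>i\<in>insert k J. emeasure (M i) (A i))" .
qed (use assms in auto)

text \<open>Splitting after joining is the identity on the space of the pair measure, so this
  follows by pushing forward the previous identity.\<close>

lemma distr_split_coordinate:
  assumes "finite J" "k \<notin> J"
  shows "distr (PiM (insert k J) M) (PiM J M \<Otimes>\<^sub>M M k) (\<lambda>t. (restrict t J, t k)) = PiM J M \<Otimes>\<^sub>M M k"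
    (is "distr ?O ?N ?\<psi> = _")
proof -
  have \<phi>: "(\<lambda>z. (fst z)(k := snd z)) \<in> ?N \<rightarrow>\<^sub>M ?O"
    using measurable_add_dim[of k J M] by (simp add: split_beta)
  have \<psi>: "?\<psi> \<in> ?O \<rightarrow>\<^sub>M ?N"
    by (intro measurable_Pair measurable_restrict_subset measurable_component_singleton) auto
  have "distr ?O ?N ?\<psi> = distr (distr ?N ?O (\<lambda>z. (fst z)(k := snd z))) ?N ?\<psi>"
    by (simp add: distr_fun_upd[OF assms])
  also have "\<dots> = distr ?N ?N (\<lambda>z. z)"
  proof (subst distr_distr[OF \<psi> \<phi>], intro distr_cong refl)
    fix z assume "z \<in> space ?N"
    then show "(?\<psi> \<circ> (\<lambda>z. (fst z)(k := snd z))) z = z"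
      using assms(2)
      by (cases z) (auto simp: space_pair_measure space_PiM PiE_iff extensional_def restrict_def fun_eq_iff)
  qed
  finally show ?thesis by simp
qed

lemma Lp_space_PiM_tensor:
  fixes f :: "'i \<Rightarrow> 'a \<Rightarrow> 'k::real_normed_field"
  assumes J: "finite J" and sc: "normed_scaling sc" and f: "\<And>i. i \<in> J \<Longrightarrow> f i \<in> Lp_space p (M i)"
  shows "(\<lambda>t. sc (\<Prod>i\<in>J. f i (t i)) x) \<in> Lp_space p (PiM J M)"
proof (rule Lp_spaceI)
  show "strongly_measurable (PiM J M) (\<lambda>t. sc (\<Prod>i\<in>J. f i (t i)) x)"
    by (intro strongly_measurable_scaling[OF sc _ strongly_measurable_const] strongly_measurable_prod
        strongly_measurable_comp[OF Lp_spaceD(1)[OF f]] measurable_component_singleton)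
  show "integrable (PiM J M) (\<lambda>t. (\<Prod>i\<in>J. norm (f i (t i)) powr p) * norm x powr p)"
    by (intro integrable_mult_left product_integrable_prod J Lp_spaceD(3) f)
  show "AE t in PiM J M. norm (sc (\<Prod>i\<in>J. f i (t i)) x) powr p
      \<le> (\<Prod>i\<in>J. norm (f i (t i)) powr p) * norm x powr p"
    by (simp add: normed_scaling_norm[OF sc] powr_mult prod_norm[symmetric] prod_powr_distrib)
qed

context
  fixes J :: "'i set" and k :: 'i and p :: real
    and sc :: "'k::real_normed_field \<Rightarrow> 'x::banach \<Rightarrow> 'x"
  assumes J: "finite J" "k \<notin> J" and p: "0 < p" and sc: "normed_scaling sc"
begin

lemma pair_sigma_finite_coordinate: "pair_sigma_finite (PiM J M) (M k)"
  by (intro pair_sigma_finite.intro sigma_finite[OF J(1)] sigma_finite_measures)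

lemma measurable_fun_upd_coordinate:
  "(\<lambda>z. (fst z)(k := snd z)) \<in> PiM J M \<Otimes>\<^sub>M M k \<rightarrow>\<^sub>M PiM (insert k J) M"
  using measurable_add_dim[of k J M] by (simp add: split_beta)

lemma measurable_split_coordinate:
  "(\<lambda>t. (restrict t J, t k)) \<in> PiM (insert k J) M \<rightarrow>\<^sub>M PiM J M \<Otimes>\<^sub>M M k"
  by (intro measurable_Pair measurable_restrict_subset measurable_component_singleton) auto

lemmas Lp_space_join = Lp_space_distr[OF measurable_fun_upd_coordinate distr_fun_upd[OF J]]
lemmas Lp_space_split = Lp_space_distr[OF measurable_split_coordinate distr_split_coordinate[OF J]]

lemma AE_split_coordinate:
  "AE z in PiM J M \<Otimes>\<^sub>M M k. Q z \<Longrightarrow> AE t in PiM (insert k J) M. Q (restrict t J, t k)"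
  using AE_distrD[OF measurable_split_coordinate] unfolding distr_split_coordinate[OF J] by blast

lemma bounded_operator_Lp_coord_op:
  assumes S: "bounded_operator_Lp (*) p (M k) S" and U: "extends_tensor_Id sc p (M k) S U"
  shows "bounded_operator_Lp sc p (PiM (insert k J) M) (coord_op p M J k U)"
proof -
  note V = bounded_operator_Lp_slice_op[OF pair_sigma_finite_coordinate p sc S U]
  obtain C where C: "0 \<le> C" "\<And>f. f \<in> Lp_space p (PiM J M \<Otimes>\<^sub>M M k) \<Longrightarrow>
      Lp_int p (PiM J M \<Otimes>\<^sub>M M k) (slice_op p (PiM J M) (M k) U f) \<le> C * Lp_int p (PiM J M \<Otimes>\<^sub>M M k) f"
    using bounded_operator_LpD[OF V p] by blast
  show ?thesis
  proof (rule bounded_operator_LpI[OF p C(1)])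
    fix f :: "('i \<Rightarrow> 'a) \<Rightarrow> 'x" assume f: "f \<in> Lp_space p (PiM (insert k J) M)"
    note Vf = bounded_operator_Lp_in[OF V Lp_space_join(1)[OF f]]
    show "coord_op p M J k U f \<in> Lp_space p (PiM (insert k J) M)"
      unfolding coord_op_def[abs_def] by (rule Lp_space_split(1)[OF Vf])
    show "Lp_int p (PiM (insert k J) M) (coord_op p M J k U f) \<le> C * Lp_int p (PiM (insert k J) M) f"
      unfolding coord_op_def[abs_def] Lp_space_split(2)[OF Vf]
      using C(2)[OF Lp_space_join(1)[OF f]] unfolding Lp_space_join(2)[OF f] .
    show "AE t in PiM (insert k J) M. coord_op p M J k U (\<lambda>t. sc a (f t)) t = sc a (coord_op p M J k U f t)" for a
      unfolding coord_op_def
      by (rule AE_split_coordinate[OF bounded_operator_Lp_scale[OF V Lp_space_join(1)[OF f]]])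
    fix g :: "('i \<Rightarrow> 'a) \<Rightarrow> 'x" assume g: "g \<in> Lp_space p (PiM (insert k J) M)"
    show "AE t in PiM (insert k J) M. coord_op p M J k U (\<lambda>t. f t + g t) t = coord_op p M J k U f t + coord_op p M J k U g t"
      unfolding coord_op_def
      by (rule AE_split_coordinate[OF bounded_operator_Lp_add[OF V Lp_space_join(1)[OF f] Lp_space_join(1)[OF g]]])
  qed
qed

text \<open>The factors other than the k-th, together with x, form the vector-valued function
  \<open>w\<close> of the remaining coordinates; uniqueness in the graph then evaluates the chosen
  representative.\<close>

lemma coord_op_tensor:
  assumes S: "bounded_operator_Lp (*) p (M k) S" and U: "extends_tensor_Id sc p (M k) S U"
    and f: "\<And>i. i \<in> insert k J \<Longrightarrow> f i \<in> Lp_space p (M i)"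
  shows "AE t in PiM (insert k J) M. coord_op p M J k U (\<lambda>t. sc (\<Prod>i\<in>insert k J. f i (t i)) x) t =
    sc (\<Prod>i\<in>insert k J. (f(k := S (f k))) i (t i)) x"
proof -
  define w where "w a = sc (\<Prod>i\<in>J. f i (a i)) x" for a
  have w: "w \<in> Lp_space p (PiM J M)"
    unfolding w_def[abs_def] by (rule Lp_space_PiM_tensor[OF J(1) sc]) (use f in auto)
  have fk: "f k \<in> Lp_space p (M k)"
    using f by simp
  have eq: "sc (\<Prod>i\<in>insert k J. f i (((fst z)(k := snd z)) i)) x = sc (f k (snd z)) (w (fst z))" for z
  proof -
    have "(\<Prod>i\<in>J. f i (((fst z)(k := snd z)) i)) = (\<Prod>i\<in>J. f i (fst z i))"
      using J(2) by (intro prod.cong) auto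
    then show ?thesis
      using J by (simp add: w_def normed_scaling_scale[OF sc])
  qed
  note AB = pair_sigma_finite_coordinate
  have "AE z in PiM J M \<Otimes>\<^sub>M M k. slice_op p (PiM J M) (M k) U (\<lambda>z. sc (f k (snd z)) (w (fst z))) z =
      sc (S (f k) (snd z)) (w (fst z))"
    by (rule slice_graph_unique[OF AB p slice_op_graph[OF AB p sc S U Lp_space_tensor[OF AB sc fk w]]
          slice_graph_tensor[OF AB p sc S U fk w]])
  from AE_split_coordinate[OF this] show ?thesis
  proof eventually_elim
    case (elim t)
    have "(\<Prod>i\<in>J. (f(k := S (f k))) i (t i)) = (\<Prod>i\<in>J. f i (t i))"
      using J(2) by (intro prod.cong) auto
    then show ?case
      unfolding coord_op_def eq using elim J by (simp add: w_def normed_scaling_scale[OF sc])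
  qed
qed

text \<open>The constant is that of the single variable, since both transports preserve
  \<open>Lp_int\<close>.\<close>

lemma R_bound_int_coord_op:
  assumes C: "R_bound_int p (M k) F C"
    and F: "\<And>U. U \<in> F \<Longrightarrow> \<exists>S. bounded_operator_Lp (*) p (M k) S \<and> extends_tensor_Id sc p (M k) S U"
  shows "R_bound_int p (PiM (insert k J) M) (coord_op p M J k ` F) C"
  unfolding R_bound_int_def
proof (intro allI impI)
  fix N :: nat and T and f :: "nat \<Rightarrow> ('i \<Rightarrow> 'a) \<Rightarrow> 'x"
  assume *: "\<forall>j\<in>{1..N}. T j \<in> coord_op p M J k ` F \<and> f j \<in> Lp_space p (PiM (insert k J) M)"
  let ?O = "PiM (insert k J) M" and ?N = "PiM J M \<Otimes>\<^sub>M M k"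
  from * have "\<forall>j\<in>{1..N}. \<exists>U. U \<in> F \<and> T j = coord_op p M J k U"
    by blast
  then obtain U where U: "\<And>j. j \<in> {1..N} \<Longrightarrow> U j \<in> F" "\<And>j. j \<in> {1..N} \<Longrightarrow> T j = coord_op p M J k (U j)"
    by metis
  define h where "h j z = f j ((fst z)(k := snd z))" for j z
  define g where "g j = slice_op p (PiM J M) (M k) (U j) (h j)" for j
  have f_in: "f j \<in> Lp_space p ?O" if "j \<in> {1..N}" for j
    using * that by blast
  have h_in: "h j \<in> Lp_space p ?N" if "j \<in> {1..N}" for j
    unfolding h_def[abs_def] by (rule Lp_space_join(1)[OF f_in[OF that]])
  have graph: "slice_graph p (PiM J M) (M k) (U j) (h j) (g j)" if "j \<in> {1..N}" for j
    unfolding g_def using F[OF U(1)[OF that]] slice_op_graph[OF pair_sigma_finite_coordinate p sc] h_in[OF that]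
    by blast
  have "Lp_int p ?O (\<lambda>t. \<Sum>j=1..N. s j *\<^sub>R f j t) = Lp_int p ?N (\<lambda>z. \<Sum>j=1..N. s j *\<^sub>R h j z)" for s
    unfolding h_def using Lp_space_join(2)[OF Lp_space_sign_sum[OF f_in p], of "{1..N}"] by simp
  moreover have "Lp_int p ?O (\<lambda>t. \<Sum>j=1..N. s j *\<^sub>R T j (f j) t) = Lp_int p ?N (\<lambda>z. \<Sum>j=1..N. s j *\<^sub>R g j z)" for s
  proof -
    have "T j (f j) t = g j (restrict t J, t k)" if "j \<in> {1..N}" for j t
      using U(2)[OF that] by (simp add: coord_op_def g_def h_def[abs_def])
    then have "(\<lambda>t. \<Sum>j=1..N. s j *\<^sub>R T j (f j) t) = (\<lambda>t. \<Sum>j=1..N. s j *\<^sub>R g j (restrict t J, t k))"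
      by auto
    then show ?thesis
      using Lp_space_split(2)[OF Lp_space_sign_sum[OF slice_graph_in(2)[OF graph] p], of "{1..N}"] by simp
  qed
  moreover have "sign_avg {1..N} (\<lambda>s. Lp_int p ?N (\<lambda>z. \<Sum>j=1..N. s j *\<^sub>R g j z))
      \<le> C * sign_avg {1..N} (\<lambda>s. Lp_int p ?N (\<lambda>z. \<Sum>j=1..N. s j *\<^sub>R h j z))"
  proof (rule slice_graph_R_bound[OF pair_sigma_finite_coordinate p C _ U(1) graph])
    show "V u \<in> Lp_space p (M k)" if "V \<in> F" "u \<in> Lp_space p (M k)" for V u
      using F[OF that(1)] that(2) by (auto simp: extends_tensor_Id_def intro: bounded_operator_Lp_in)
  qed
  ultimately show "sign_avg {1..N} (\<lambda>s. Lp_int p ?O (\<lambda>t. \<Sum>j=1..N. s j *\<^sub>R T j (f j) t))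
      \<le> C * sign_avg {1..N} (\<lambda>s. Lp_int p ?O (\<lambda>t. \<Sum>j=1..N. s j *\<^sub>R f j t))"
    by simp
qed

end

end

text \<open>The complementary index set is always taken in \<open>{1..n}\<close>, so that all stages
  act on functions on the full product and can be composed.\<close>

primrec iterated_coord_op ::
  "real \<Rightarrow> (nat \<Rightarrow> 'a measure) \<Rightarrow> nat \<Rightarrow> (nat \<Rightarrow> ('a \<Rightarrow> 'x::real_normed_vector) \<Rightarrow> ('a \<Rightarrow> 'x))
     \<Rightarrow> nat \<Rightarrow> ((nat \<Rightarrow> 'a) \<Rightarrow> 'x) \<Rightarrow> ((nat \<Rightarrow> 'a) \<Rightarrow> 'x)" where
  "iterated_coord_op p M n U 0 f = f"
| "iterated_coord_op p M n U (Suc m) f =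
     coord_op p M ({1..n} - {Suc m}) (Suc m) (U (Suc m)) (iterated_coord_op p M n U m f)"

section \<open>Composition over all coordinates\<close>

locale R_bounded_factors = product_sigma_finite M
  for M :: "nat \<Rightarrow> 'a measure" +
  fixes sc :: "'k::real_normed_field \<Rightarrow> 'x::banach \<Rightarrow> 'x" and p :: real and n :: nat
    and Z :: "'z set"
    and S :: "nat \<Rightarrow> 'z \<Rightarrow> ('a \<Rightarrow> 'k) \<Rightarrow> ('a \<Rightarrow> 'k)"
    and SX :: "nat \<Rightarrow> 'z \<Rightarrow> ('a \<Rightarrow> 'x) \<Rightarrow> ('a \<Rightarrow> 'x)"
  assumes sc: "normed_scaling sc" and p: "0 < p"
    and S: "\<And>k z. k \<in> {1..n} \<Longrightarrow> z \<in> Z \<Longrightarrow> bounded_operator_Lp (*) p (M k) (S k z)"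
    and SX: "\<And>k z. k \<in> {1..n} \<Longrightarrow> z \<in> Z \<Longrightarrow> extends_tensor_Id sc p (M k) (S k z) (SX k z)"
begin

abbreviation "T m z \<equiv> iterated_coord_op p M n (\<lambda>k. SX k z) m"

lemma split_index: "k \<in> {1..n} \<Longrightarrow> insert k ({1..n} - {k}) = {1..n}"
  by auto

lemma bounded_coord_op:
  assumes "k \<in> {1..n}" "z \<in> Z"
  shows "bounded_operator_Lp sc p (PiM {1..n} M) (coord_op p M ({1..n} - {k}) k (SX k z))"
  using bounded_operator_Lp_coord_op[OF _ _ p sc S[OF assms] SX[OF assms], of "{1..n} - {k}"]
  unfolding split_index[OF assms(1)] by simp

lemma bounded_T: "z \<in> Z \<Longrightarrow> m \<le> n \<Longrightarrow> bounded_operator_Lp sc p (PiM {1..n} M) (T m z)"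
proof (induction m)
  case 0
  then show ?case
    using bounded_operator_Lp_id[OF p] by simp
next
  case (Suc m)
  then show ?case
    using bounded_operator_Lp_compose[OF bounded_coord_op[of "Suc m" z] Suc.IH p sc] by simp
qed

text \<open>The invariant of the composition: after m stages the first m factors have been
  transformed and the others are untouched, so the next stage again meets an elementary
  tensor.\<close>

lemma T_tensor:
  assumes z: "z \<in> Z" and f: "\<And>k. k \<in> {1..n} \<Longrightarrow> f k \<in> Lp_space p (M k)"
  shows "m \<le> n \<Longrightarrow> AE t in PiM {1..n} M. T m z (\<lambda>t. sc (\<Prod>k=1..n. f k (t k)) x) t =
    sc (\<Prod>k=1..n. (if k \<le> m then S k z (f k) else f k) (t k)) x"
proof (induction m)
  case 0
  have "(\<Prod>k=1..n. (if k \<le> 0 then S k z (f k) else f k) (t k)) = (\<Prod>k=1..n. f k (t k))" for t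
    by (intro prod.cong) auto
  then show ?case by simp
next
  case (Suc m)
  define h where "h k = (if k \<le> m then S k z (f k) else f k)" for k
  have k: "Suc m \<in> {1..n}" using Suc.prems by simp
  have h: "h k \<in> Lp_space p (M k)" if "k \<in> {1..n}" for k
    using f[OF that] bounded_operator_Lp_in[OF S[OF that z]] by (simp add: h_def)
  let ?c = "coord_op p M ({1..n} - {Suc m}) (Suc m) (SX (Suc m) z)"
  \<comment> \<open>The previous stage is known up to a null set only, and the next operator
    respects null sets.\<close>
  have "AE t in PiM {1..n} M. ?c (T m z (\<lambda>t. sc (\<Prod>k=1..n. f k (t k)) x)) t = ?c (\<lambda>t. sc (\<Prod>k=1..n. h k (t k)) x) t"
  proof (rule bounded_operator_Lp_cong_AE[OF bounded_coord_op[OF k z] _ _ p])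
    show "T m z (\<lambda>t. sc (\<Prod>k=1..n. f k (t k)) x) \<in> Lp_space p (PiM {1..n} M)"
      using Suc.prems f by (intro bounded_operator_Lp_in[OF bounded_T[OF z]] Lp_space_PiM_tensor sc) auto
    show "(\<lambda>t. sc (\<Prod>k=1..n. h k (t k)) x) \<in> Lp_space p (PiM {1..n} M)"
      using h by (intro Lp_space_PiM_tensor sc) auto
    show "AE t in PiM {1..n} M. T m z (\<lambda>t. sc (\<Prod>k=1..n. f k (t k)) x) t = sc (\<Prod>k=1..n. h k (t k)) x"
      using Suc.IH Suc.prems by (simp add: h_def)
  qed
  moreover have "AE t in PiM {1..n} M. ?c (\<lambda>t. sc (\<Prod>k=1..n. h k (t k)) x) t =
      sc (\<Prod>k=1..n. (h(Suc m := S (Suc m) z (h (Suc m)))) k (t k)) x"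
    using coord_op_tensor[OF _ _ p sc S[OF k z] SX[OF k z], of "{1..n} - {Suc m}" h x] h
    unfolding split_index[OF k] by simp
  moreover have "h(Suc m := S (Suc m) z (h (Suc m))) = (\<lambda>k. if k \<le> Suc m then S k z (f k) else f k)"
    by (auto simp: h_def fun_eq_iff le_Suc_eq)
  ultimately show ?case by (simp add: eventually_conj_iff) (auto elim: eventually_elim2)
qed

lemma extends_T:
  assumes "z \<in> Z"
  shows "extends_tensor_prod_Id sc p n M (\<lambda>k. S k z) (T n z)"
  unfolding extends_tensor_prod_Id_def
proof (intro conjI allI impI)
  show "bounded_operator_Lp sc p (PiM {1..n} M) (T n z)"
    using assms by (rule bounded_T) simp
  fix f :: "nat \<Rightarrow> 'a \<Rightarrow> 'k" and x assume "\<forall>k\<in>{1..n}. f k \<in> Lp_space p (M k)"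
  then have "AE t in PiM {1..n} M. T n z (\<lambda>t. sc (\<Prod>k=1..n. f k (t k)) x) t =
      sc (\<Prod>k=1..n. (if k \<le> n then S k z (f k) else f k) (t k)) x"
    by (intro T_tensor assms) auto
  moreover have "(\<Prod>k=1..n. (if k \<le> n then S k z (f k) else f k) (t k)) = (\<Prod>k=1..n. S k z (f k) (t k))" for t
    by (intro prod.cong) auto
  ultimately show "AE t in PiM {1..n} M. T n z (\<lambda>t. sc (\<Prod>k=1..n. f k (t k)) x) t = sc (\<Prod>k=1..n. S k z (f k) (t k)) x"
    by simp
qed

text \<open>The constants multiply. An R-bound admits a different operator for each summand, so the
  images under stage m, each with its own index z j, can be the input to the R-bound of the next
  coordinate.\<close>

lemma R_bound_int_T:
  assumes R: "\<And>k. k \<in> {1..n} \<Longrightarrow> \<exists>C\<ge>0. R_bound_int p (M k) (SX k ` Z) C"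
  shows "m \<le> n \<Longrightarrow> \<exists>C\<ge>0. R_bound_int p (PiM {1..n} M) (T m ` Z) C"
proof (induction m)
  case 0
  have "R_bound_int p (PiM {1..n} M) (T 0 ` Z) 1"
    unfolding R_bound_int_def
  proof (intro allI impI)
    fix N :: nat and V and f :: "nat \<Rightarrow> (nat \<Rightarrow> 'a) \<Rightarrow> 'x"
    assume "\<forall>j\<in>{1..N}. V j \<in> T 0 ` Z \<and> f j \<in> Lp_space p (PiM {1..n} M)"
    then have "V j (f j) = f j" if "j \<in> {1..N}" for j
      using that by fastforce
    then show "sign_avg {1..N} (\<lambda>s. Lp_int p (PiM {1..n} M) (\<lambda>t. \<Sum>j=1..N. s j *\<^sub>R V j (f j) t))
        \<le> 1 * sign_avg {1..N} (\<lambda>s. Lp_int p (PiM {1..n} M) (\<lambda>t. \<Sum>j=1..N. s j *\<^sub>R f j t))"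
      by simp
  qed
  then show ?case
    using zero_le_one by blast
next
  case (Suc m)
  have k: "Suc m \<in> {1..n}" using Suc.prems by simp
  let ?M = "PiM {1..n} M" and ?c = "coord_op p M ({1..n} - {Suc m}) (Suc m)"
  obtain D where D: "0 \<le> D" "R_bound_int p ?M (T m ` Z) D"
    using Suc by auto
  obtain C where C: "0 \<le> C" "R_bound_int p (M (Suc m)) (SX (Suc m) ` Z) C"
    using R[OF k] by blast
  have c: "R_bound_int p ?M (?c ` SX (Suc m) ` Z) C"
    using R_bound_int_coord_op[OF _ _ p sc C(2), of "{1..n} - {Suc m}"] S[OF k] SX[OF k]
    unfolding split_index[OF k] by blast
  have "R_bound_int p ?M (T (Suc m) ` Z) (C * D)"
    unfolding R_bound_int_def
  proof (intro allI impI)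
    fix N :: nat and V and f :: "nat \<Rightarrow> (nat \<Rightarrow> 'a) \<Rightarrow> 'x"
    assume *: "\<forall>j\<in>{1..N}. V j \<in> T (Suc m) ` Z \<and> f j \<in> Lp_space p ?M"
    then have "\<forall>j\<in>{1..N}. \<exists>z. z \<in> Z \<and> V j = T (Suc m) z"
      by blast
    then obtain z where z: "\<And>j. j \<in> {1..N} \<Longrightarrow> z j \<in> Z" "\<And>j. j \<in> {1..N} \<Longrightarrow> V j = T (Suc m) (z j)"
      by metis
    let ?avg = "\<lambda>h. sign_avg {1..N} (\<lambda>s. Lp_int p ?M (\<lambda>t. \<Sum>j=1..N. s j *\<^sub>R h j t))"
    have "?avg (\<lambda>j. V j (f j)) = ?avg (\<lambda>j. ?c (SX (Suc m) (z j)) (T m (z j) (f j)))"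
    proof -
      have "V j (f j) = ?c (SX (Suc m) (z j)) (T m (z j) (f j))" if "j \<in> {1..N}" for j
        using z(2)[OF that] by simp
      then show ?thesis by (simp del: One_nat_def)
    qed
    also have "\<dots> \<le> C * ?avg (\<lambda>j. T m (z j) (f j))"
    proof (rule c[unfolded R_bound_int_def, rule_format, of N "\<lambda>j. ?c (SX (Suc m) (z j))"])
      fix j assume j: "j \<in> {1..N}"
      show "?c (SX (Suc m) (z j)) \<in> ?c ` SX (Suc m) ` Z \<and> T m (z j) (f j) \<in> Lp_space p ?M"
        using z(1)[OF j] * j bounded_operator_Lp_in[OF bounded_T[OF z(1)[OF j], of m]] Suc.prems by auto
    qed
    also have "?avg (\<lambda>j. T m (z j) (f j)) \<le> D * ?avg f"
      by (rule D(2)[unfolded R_bound_int_def, rule_format, of N "\<lambda>j. T m (z j)"]) (use z(1) * in auto)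
    finally show "?avg (\<lambda>j. V j (f j)) \<le> C * D * ?avg f"
      using C(1) by (simp add: mult_left_mono mult.assoc)
  qed
  then show ?case
    using mult_nonneg_nonneg[OF C(1) D(1)] by blast
qed

end

theorem proposition3p3p2:
  fixes sc :: "'k::{real_normed_field,banach} \<Rightarrow> 'x::banach \<Rightarrow> 'x"
    and n :: nat and p q :: real
    and M :: "nat \<Rightarrow> 'a measure"
    and P :: "'o measure" and \<epsilon> :: "nat \<Rightarrow> 'o \<Rightarrow> real"
    and Z :: "'z set"
    and S :: "nat \<Rightarrow> 'z \<Rightarrow> ('a \<Rightarrow> 'k) \<Rightarrow> ('a \<Rightarrow> 'k)"
    and SX :: "nat \<Rightarrow> 'z \<Rightarrow> ('a \<Rightarrow> 'x) \<Rightarrow> ('a \<Rightarrow> 'x)"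
  assumes "normed_scaling sc"
    and "1 \<le> n"
    and "\<And>k. k \<in> {1..n} \<Longrightarrow> sigma_finite_measure (M k)"
    and "1 \<le> p"
    and "rademacher P \<epsilon>" and "1 < q"
    and "\<And>k z. k \<in> {1..n} \<Longrightarrow> z \<in> Z \<Longrightarrow> bounded_operator_Lp (*) p (M k) (S k z)"
    and "\<And>k z. k \<in> {1..n} \<Longrightarrow> z \<in> Z \<Longrightarrow> extends_tensor_Id sc p (M k) (S k z) (SX k z)"
    and "\<And>k. k \<in> {1..n} \<Longrightarrow> R_bounded_Lp P \<epsilon> q p (M k) (SX k ` Z)"
  shows "\<exists>T. (\<forall>z\<in>Z. extends_tensor_prod_Id sc p n M (\<lambda>k. S k z) (T z)) \<and>
             R_bounded_Lp P \<epsilon> q p (PiM {1..n} M) (T ` Z)"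
proof -
  have p: "0 < p" and q: "0 < q"
    using assms(4,6) by auto
  \<comment> \<open>The locale asks for \<sigma>-finite measures at all indices, so
    \<open>M 1\<close> is the default outside \<open>{1..n}\<close>; it is \<sigma>-finite because
    \<open>1 \<le> n\<close>.\<close>
  define M' where "M' k = (if k \<in> {1..n} then M k else M 1)" for k
  have M': "M' k = M k" if "k \<in> {1..n}" for k
    using that by (simp add: M'_def)
  have PiM': "PiM {1..n} M' = PiM {1..n} M"
    by (rule PiM_cong) (simp_all add: M'_def)
  have "sigma_finite_measure (M' k)" for k
    using assms(2,3) by (simp add: M'_def)
  then interpret R_bounded_factors M' sc p n Z S SX
    using assms(1,7,8) p
    by (intro R_bounded_factors.intro R_bounded_factors_axioms.intro product_sigma_finite.intro) (simp_all add: M')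
  have R: "\<exists>C\<ge>0. R_bound_int p (M' k) (SX k ` Z) C" if k: "k \<in> {1..n}" for k
  proof -
    have "V f \<in> Lp_space p (M k)" if "V \<in> SX k ` Z" "f \<in> Lp_space p (M k)" for V f
      using that assms(8)[OF k] by (auto simp: extends_tensor_Id_def intro: bounded_operator_Lp_in)
    then show ?thesis
      using assms(9)[OF k] R_bounded_Lp_iff[OF assms(5) assms(3)[OF k] assms(4) q, of "SX k ` Z"] M'[OF k] by simp
  qed
  have "V f \<in> Lp_space p (PiM {1..n} M')" if "V \<in> T n ` Z" "f \<in> Lp_space p (PiM {1..n} M')" for V f
    using that bounded_T[of _ n] by (auto intro: bounded_operator_Lp_in)
  then have "R_bounded_Lp P \<epsilon> q p (PiM {1..n} M') (T n ` Z)"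
    using R_bounded_Lp_iff[OF assms(5) sigma_finite[of "{1..n}"] assms(4) q, of "T n ` Z"] R_bound_int_T[OF R, of n] by simp
  moreover have "extends_tensor_prod_Id sc p n M (\<lambda>k. S k z) (T n z)" if "z \<in> Z" for z
    using extends_T[OF that] M' unfolding extends_tensor_prod_Id_def PiM' by simp
  ultimately show ?thesis
    unfolding PiM' by (intro exI[of _ "T n"] conjI ballI)
qed

end
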